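(* Let $X$ be a smooth irreducible projective curve of genus $g>1$ over an algebraically closed field $k$, let $f:X\to\mathbb{P}^1$ be a surjective morphism over $k$ of degree $n$, and let $\mathcal{L}$ be a line bundle on $X$. If $n>2g-2$, then $s(\mathcal{L},f)\leq2$.
   Context: By Grothendieck's splitting theorem, the rank $n$ vector bundle $f_*\mathcal{L}$ on $\mathbb{P}^1$ decomposes as $f_*\mathcal{L}\cong\bigoplus_{j=1}^n\mathcal{O}(n_j)$ with integers $n_j$ unique up to permutation, where $\mathcal{O}(m)$ is the line bundle of degree $m$ on $\mathbb{P}^1$. Define $s(\mathcal{L},f)=\max_{1\leq j,j'\leq n}|n_j-n_{j'}|$. *)

theory Defs
  imports
    "HOL-Analysis.Abstract_Topology"
    "HOL-Algebra.Module"
    "HOL-Algebra.QuotRing"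
    "HOL-Algebra.Embedded_Algebras"
    "HOL-Computational_Algebra.Polynomial"
    "HOL-Library.Poly_Mapping"
    "HOL-Library.FuncSet"
    "HOL-Library.Extended_Nat"
begin

text \<open>
  Varieties over an algebraically closed field are taken in the classical sense: a projective
  variety is a Zariski closed set of points of \<open>P^N\<close> with its sheaf of \<open>k\<close>-valued regular
  functions.
\<close>

section \<open>Polynomials in the coordinates\<close>

type_synonym 'k mpoly = "(nat \<Rightarrow>\<^sub>0 nat) \<Rightarrow>\<^sub>0 'k"

definition mono_deg :: "(nat \<Rightarrow>\<^sub>0 nat) \<Rightarrow> nat" where
  "mono_deg m = (\<Sum>i\<in>Poly_Mapping.keys m. Poly_Mapping.lookup m i)"

definition mono_val :: "(nat \<Rightarrow> 'k::field) \<Rightarrow> (nat \<Rightarrow>\<^sub>0 nat) \<Rightarrow> 'k" where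
  "mono_val v m = (\<Prod>i\<in>Poly_Mapping.keys m. v i ^ Poly_Mapping.lookup m i)"

definition peval :: "'k::field mpoly \<Rightarrow> (nat \<Rightarrow> 'k) \<Rightarrow> 'k" where
  "peval F v = (\<Sum>m\<in>Poly_Mapping.keys F. Poly_Mapping.lookup F m * mono_val v m)"

definition homog :: "nat \<Rightarrow> 'k::field mpoly \<Rightarrow> bool" where
  "homog d F \<longleftrightarrow> (\<forall>m\<in>Poly_Mapping.keys F. mono_deg m = d)"

lemma mono_val_superset:
  assumes "finite S" "Poly_Mapping.keys m \<subseteq> S"
  shows "mono_val v m = (\<Prod>i\<in>S. v i ^ Poly_Mapping.lookup m i)"
  unfolding mono_val_def
  by (rule prod.mono_neutral_left) (use assms in \<open>auto simp: in_keys_iff\<close>)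

lemma mono_deg_superset:
  assumes "finite S" "Poly_Mapping.keys m \<subseteq> S"
  shows "mono_deg m = (\<Sum>i\<in>S. Poly_Mapping.lookup m i)"
  unfolding mono_deg_def
  by (rule sum.mono_neutral_left) (use assms in \<open>auto simp: in_keys_iff\<close>)

lemma mono_val_add: "mono_val v (m + m') = mono_val v m * mono_val v m'"
proof -
  let ?S = "Poly_Mapping.keys m \<union> Poly_Mapping.keys m'"
  have "Poly_Mapping.keys (m + m') \<subseteq> ?S" by (rule Poly_Mapping.keys_add)
  then show ?thesis
    by (simp add: mono_val_superset[of ?S] lookup_add power_add prod.distrib)
qed

lemma mono_deg_add: "mono_deg (m + m') = mono_deg m + mono_deg m'"
proof -
  let ?S = "Poly_Mapping.keys m \<union> Poly_Mapping.keys m'"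
  have "Poly_Mapping.keys (m + m') \<subseteq> ?S" by (rule Poly_Mapping.keys_add)
  then show ?thesis
    by (simp add: mono_deg_superset[of ?S] lookup_add sum.distrib)
qed

lemma peval_superset:
  assumes "finite S" "Poly_Mapping.keys F \<subseteq> S"
  shows "peval F v = (\<Sum>m\<in>S. Poly_Mapping.lookup F m * mono_val v m)"
  unfolding peval_def
  by (rule sum.mono_neutral_left) (use assms in \<open>auto simp: in_keys_iff\<close>)

lemma peval_zero [simp]: "peval 0 v = 0"
  by (simp add: peval_def)

lemma peval_add: "peval (F + G) v = peval F v + peval G v"
proof -
  let ?S = "Poly_Mapping.keys F \<union> Poly_Mapping.keys G"
  have "Poly_Mapping.keys (F + G) \<subseteq> ?S" by (rule Poly_Mapping.keys_add)
  then show ?thesis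
    by (simp add: peval_superset[of ?S] lookup_add sum.distrib distrib_right)
qed

lemma peval_sum: "peval (\<Sum>i\<in>I. F i) v = (\<Sum>i\<in>I. peval (F i) v)"
  by (induction I rule: infinite_finite_induct) (auto simp: peval_add)

lemma peval_single: "peval (Poly_Mapping.single m c) v = c * mono_val v m"
  by (simp add: peval_def)

lemma mpoly_decompose:
  "F = (\<Sum>m\<in>Poly_Mapping.keys F. Poly_Mapping.single m (Poly_Mapping.lookup F m))"
  for F :: "'k::field mpoly"
  by (rule poly_mapping_eqI)
    (auto simp: lookup_sum lookup_single when_def in_keys_iff sum.delta)

lemma peval_mult: "peval (F * G) v = peval F v * peval G v"
proof -
  have "F * G = (\<Sum>m\<in>Poly_Mapping.keys F. Poly_Mapping.single m (Poly_Mapping.lookup F m)) *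
      (\<Sum>m\<in>Poly_Mapping.keys G. Poly_Mapping.single m (Poly_Mapping.lookup G m))"
    using mpoly_decompose[of F] mpoly_decompose[of G] by simp
  also have "peval \<dots> v = peval F v * peval G v"
    by (simp add: sum_product mult_single peval_sum peval_single mono_val_add)
      (simp add: peval_def sum_product ac_simps)
  finally show ?thesis .
qed

lemma homog_mult:
  assumes "homog d F" "homog e G"
  shows "homog (d + e) (F * G)"
  using assms Poly_Mapping.keys_mult[of F G] unfolding homog_def by (fastforce simp: mono_deg_add)

lemma homog_peval_scale:
  assumes "homog d F"
  shows "peval F (\<lambda>i. c * v i) = c ^ d * peval F v"
proof -
  have "mono_val (\<lambda>i. c * v i) m = c ^ mono_deg m * mono_val v m" for m
    by (simp add: mono_val_def mono_deg_def power_mult_distrib prod.distrib power_sum)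
  then show ?thesis
    using assms by (simp add: peval_def homog_def sum_distrib_left ac_simps)
qed


section \<open>Projective space and the Zariski topology\<close>

text \<open>
  A point of \<open>P^N\<close> is the set of its vectors of homogeneous coordinates. A vector
  \<open>(v\<^sub>0, \<dots>, v\<^sub>N)\<close> is extended by \<open>v i = 0\<close> for \<open>i > N\<close>; polynomials may therefore
  involve variables of index \<open>> N\<close>, since these evaluate to 0 on \<open>P^N\<close>.
\<close>

type_synonym 'k proj_point = "(nat \<Rightarrow> 'k) set"

definition hvecs :: "nat \<Rightarrow> (nat \<Rightarrow> 'k::field) set" where
  "hvecs N = {v. (\<forall>i>N. v i = 0) \<and> (\<exists>i. v i \<noteq> 0)}"

definition hpoint :: "(nat \<Rightarrow> 'k::field) \<Rightarrow> 'k proj_point" where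
  "hpoint v = {(\<lambda>i. c * v i) | c. c \<noteq> 0}"

definition proj_space :: "nat \<Rightarrow> 'k::field proj_point set" where
  "proj_space N = hpoint ` hvecs N"

definition zero_locus :: "nat \<Rightarrow> 'k::field mpoly set \<Rightarrow> 'k proj_point set" where
  "zero_locus N S = {p \<in> proj_space N. \<forall>F\<in>S. \<forall>v\<in>p. peval F v = 0}"

definition zariski :: "nat \<Rightarrow> 'k::field proj_point topology" where
  "zariski N = topology (\<lambda>U. \<exists>S. (\<forall>F\<in>S. \<exists>d. homog d F) \<and> U = proj_space N - zero_locus N S)"

lemma istopology_zariski:
  "istopology (\<lambda>U. \<exists>S. (\<forall>F\<in>S. \<exists>d. homog d F) \<and> U = proj_space N - zero_locus N S)"
  (is "istopology ?open")
  unfolding istopology_def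
proof (intro conjI allI impI)
  fix U V :: "'a proj_point set"
  assume "?open U" "?open V"
  then obtain S S' where S: "\<forall>F\<in>S. \<exists>d. homog d F" "U = proj_space N - zero_locus N S"
    and S': "\<forall>F\<in>S'. \<exists>d. homog d F" "V = proj_space N - zero_locus N S'" by blast
  let ?P = "{F * G | F G. F \<in> S \<and> G \<in> S'}"
  have homog: "\<forall>F\<in>?P. \<exists>d. homog d F" using S(1) S'(1) homog_mult by blast
  have scale: "peval F w = 0 \<longleftrightarrow> peval F v = 0"
    if p: "p \<in> proj_space N" "v \<in> p" "w \<in> p" and F: "homog d F" for p v w F d
  proof -
    obtain u b c where "b \<noteq> 0" "c \<noteq> 0" "v = (\<lambda>i. b * u i)" "w = (\<lambda>i. c * u i)"
      using p by (auto simp: proj_space_def hpoint_def)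
    then show ?thesis using F by (simp add: homog_peval_scale)
  qed
  have "p \<in> U \<inter> V \<longleftrightarrow> p \<in> proj_space N - zero_locus N ?P" for p
  proof
    assume p: "p \<in> U \<inter> V"
    then obtain F v G w where F: "F \<in> S" "v \<in> p" "peval F v \<noteq> 0"
      and G: "G \<in> S'" "w \<in> p" "peval G w \<noteq> 0"
      using S(2) S'(2) by (auto simp: zero_locus_def)
    have pN: "p \<in> proj_space N" using p S(2) by blast
    have "peval G v \<noteq> 0" using scale[OF pN F(2) G(2)] G S'(1) by blast
    then have "peval (F * G) v \<noteq> 0" using F by (simp add: peval_mult)
    then show "p \<in> proj_space N - zero_locus N ?P"
      using pN F G by (auto simp: zero_locus_def)
  next
    assume p: "p \<in> proj_space N - zero_locus N ?P"
    then obtain F G v where "F \<in> S" "G \<in> S'" "v \<in> p" "peval (F * G) v \<noteq> 0"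
      by (auto simp: zero_locus_def)
    then show "p \<in> U \<inter> V"
      using p by (auto simp: S(2) S'(2) zero_locus_def peval_mult)
  qed
  then have "U \<inter> V = proj_space N - zero_locus N ?P" by blast
  then show "?open (U \<inter> V)" using homog by blast
next
  fix \<K> :: "'a proj_point set set"
  assume "\<forall>K\<in>\<K>. ?open K"
  from bchoice[OF this] obtain S where S':
    "\<forall>K\<in>\<K>. (\<forall>F\<in>S K. \<exists>d. homog d F) \<and> K = proj_space N - zero_locus N (S K)" ..
  note S = bspec[OF S', THEN conjunct1] bspec[OF S', THEN conjunct2]
  have "\<Union>\<K> = (\<Union>K\<in>\<K>. proj_space N - zero_locus N (S K))"
    using SUP_cong[OF refl S(2), of \<K> "\<lambda>K. K"] by (simp only: image_ident)
  also have "\<dots> = proj_space N - zero_locus N (\<Union>K\<in>\<K>. S K)"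
    unfolding zero_locus_def by blast
  finally have "\<Union>\<K> = proj_space N - zero_locus N (\<Union>K\<in>\<K>. S K)" .
  moreover have "\<forall>F\<in>(\<Union>K\<in>\<K>. S K). \<exists>d. homog d F" using S(1) by blast
  ultimately show "?open (\<Union>\<K>)" by blast
qed

lemma openin_zariski:
  "openin (zariski N) U \<longleftrightarrow>
     (\<exists>S. (\<forall>F\<in>S. \<exists>d. homog d F) \<and> U = proj_space N - zero_locus N S)"
  unfolding zariski_def topology_inverse'[OF istopology_zariski] by simp

lemma topspace_zariski [simp]: "topspace (zariski N) = proj_space N"
proof
  show "topspace (zariski N) \<subseteq> proj_space N"
    using openin_topspace[of "zariski N"] unfolding openin_zariski by blast
  have "peval (Poly_Mapping.single 0 1) v = 1" for v :: "nat \<Rightarrow> 'a"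
    by (simp add: peval_def mono_val_def)
  moreover have "p \<noteq> {}" if p: "p \<in> proj_space N" for p :: "'a proj_point"
  proof -
    obtain v where v: "p = hpoint v" using p by (auto simp: proj_space_def)
    have "(\<lambda>i. 1 * v i) \<in> p"
      unfolding v hpoint_def by (intro CollectI exI[of _ 1]) simp
    then show ?thesis by blast
  qed
  ultimately have "zero_locus N {Poly_Mapping.single 0 1 :: 'a mpoly} = {}"
    unfolding zero_locus_def by auto
  moreover have "homog 0 (Poly_Mapping.single 0 1 :: 'a mpoly)"
    by (simp add: homog_def mono_deg_def)
  ultimately have "openin (zariski N) (proj_space N :: 'a proj_point set)"
    unfolding openin_zariski by (intro exI[of _ "{Poly_Mapping.single 0 1}"]) auto
  then show "proj_space N \<subseteq> topspace (zariski N :: 'a proj_point topology)"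
    by (rule openin_subset)
qed

abbreviation zariski_on :: "nat \<Rightarrow> 'k::field proj_point set \<Rightarrow> 'k proj_point topology" where
  "zariski_on N X \<equiv> subtopology (zariski N) X"

definition irreducible_set :: "'a topology \<Rightarrow> 'a set \<Rightarrow> bool" where
  "irreducible_set T Z \<longleftrightarrow> Z \<subseteq> topspace T \<and> Z \<noteq> {} \<and>
     (\<forall>A B. closedin T A \<and> closedin T B \<and> Z \<subseteq> A \<union> B \<longrightarrow> Z \<subseteq> A \<or> Z \<subseteq> B)"

definition krull_dim :: "'a topology \<Rightarrow> enat" where
  "krull_dim T = Sup {enat n | n. \<exists>Z :: nat \<Rightarrow> 'a set.
     (\<forall>i\<le>n. closedin T (Z i) \<and> irreducible_set T (Z i)) \<and> (\<forall>i<n. Z i \<subset> Z (Suc i))}"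


section \<open>Regular functions\<close>

text \<open>
  In the following, \<open>T\<close> is a subspace of some \<open>zariski N\<close>, i.e. the underlying topological
  space of a subvariety; its structure sheaf is determined by \<open>T\<close>. Sections over \<open>U\<close> are
  functions on \<open>U\<close> that are undefined elsewhere.
\<close>

definition regular_functions ::
    "'k::field proj_point topology \<Rightarrow> 'k proj_point set \<Rightarrow> ('k proj_point \<Rightarrow> 'k) set" where
  "regular_functions T U = {h \<in> extensional U. \<forall>p\<in>U. \<exists>W F G d.
     openin T W \<and> p \<in> W \<and> W \<subseteq> U \<and> homog d F \<and> homog d G \<and>
     (\<forall>q\<in>W. \<forall>v\<in>q. peval G v \<noteq> 0 \<and> h q = peval F v / peval G v)}"

definition regular_ring ::
    "'k::field proj_point topology \<Rightarrow> 'k proj_point set \<Rightarrow> ('k proj_point \<Rightarrow> 'k) ring" where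
  "regular_ring T U =
     \<lparr>carrier = regular_functions T U,
      monoid.mult = (\<lambda>g h. restrict (\<lambda>p. g p * h p) U),
      one = restrict (\<lambda>_. 1) U,
      zero = restrict (\<lambda>_. 0) U,
      add = (\<lambda>g h. restrict (\<lambda>p. g p + h p) U)\<rparr>"

definition morphism_var ::
    "'k::field proj_point topology \<Rightarrow> 'k proj_point topology \<Rightarrow> ('k proj_point \<Rightarrow> 'k proj_point) \<Rightarrow> bool"
  where
  "morphism_var T T' f \<longleftrightarrow> continuous_map T T' f \<and>
     (\<forall>V h. openin T' V \<and> h \<in> regular_functions T' V \<longrightarrow>
        restrict (h \<circ> f) {x \<in> topspace T. f x \<in> V}
          \<in> regular_functions T {x \<in> topspace T. f x \<in> V})"


section \<open>Dimension of quotient vector spaces\<close>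

text \<open>
  For \<open>k\<close>-subspaces \<open>B\<close> and \<open>Z\<close> of a space of \<open>k\<close>-valued functions with \<open>B \<subseteq> Z\<close>: the
  classes of some \<open>e\<^sub>0, \<dots>, e\<^sub>d\<^sub>-\<^sub>1\<close> form a basis of \<open>Z / B\<close>.
\<close>

definition quot_dim :: "('a \<Rightarrow> 'k::field) set \<Rightarrow> ('a \<Rightarrow> 'k) set \<Rightarrow> nat \<Rightarrow> bool" where
  "quot_dim Z B d \<longleftrightarrow> (\<exists>e :: nat \<Rightarrow> 'a \<Rightarrow> 'k. (\<forall>i<d. e i \<in> Z) \<and>
     (\<forall>z\<in>Z. \<exists>!c :: nat \<Rightarrow> 'k. (\<forall>i\<ge>d. c i = 0) \<and> (\<lambda>x. z x - (\<Sum>i<d. c i * e i x)) \<in> B))"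


section \<open>Smooth projective curves\<close>

text \<open>
  Germs at \<open>p\<close> are represented by functions that are regular near \<open>p\<close>. Both
  \<open>max_ideal T p\<close> and \<open>max_ideal_sq T p\<close> contain the functions vanishing near \<open>p\<close>, so their
  quotient is \<open>m\<^sub>p / m\<^sub>p\<^sup>2\<close> for the maximal ideal \<open>m\<^sub>p\<close> of the local ring at \<open>p\<close>.
\<close>

definition max_ideal ::
    "'k::field proj_point topology \<Rightarrow> 'k proj_point \<Rightarrow> ('k proj_point \<Rightarrow> 'k) set" where
  "max_ideal T p = {h. h p = 0 \<and>
     (\<exists>U. openin T U \<and> p \<in> U \<and> restrict h U \<in> regular_functions T U)}"

definition max_ideal_sq ::
    "'k::field proj_point topology \<Rightarrow> 'k proj_point \<Rightarrow> ('k proj_point \<Rightarrow> 'k) set" where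
  "max_ideal_sq T p = {h. \<exists>U (r::nat) a b. openin T U \<and> p \<in> U \<and>
     (\<forall>i<r. a i \<in> max_ideal T p \<and> b i \<in> max_ideal T p) \<and>
     (\<forall>q\<in>U. h q = (\<Sum>i<r. a i q * b i q))}"

text \<open>
  For a curve, smoothness means that the Zariski cotangent space at every point has dimension 1.
\<close>

definition smooth_projective_curve :: "nat \<Rightarrow> 'k::field proj_point set \<Rightarrow> bool" where
  "smooth_projective_curve N X \<longleftrightarrow>
     closedin (zariski N) X \<and> irreducible_set (zariski N) X \<and>
     krull_dim (zariski_on N X) = 1 \<and>
     (\<forall>p\<in>X. quot_dim (max_ideal (zariski_on N X) p) (max_ideal_sq (zariski_on N X) p) 1)"


section \<open>Genus\<close>

text \<open>
  The genus is \<open>dim\<^sub>k H\<^sup>1(X, O\<^sub>X)\<close>, where \<open>H\<^sup>1\<close> is Cech cohomology (equal to sheaf cohomology in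
  degree 1 on every space). It suffices to use open covers \<open>(U\<^sub>x)\<^sub>x\<close> indexed by the
  points, with \<open>x \<in> U\<^sub>x\<close>. Let \<open>Z\<close> and \<open>B\<close> be the spaces of functions \<open>c(x, y, z)\<close> which
  restrict to a cocycle, respectively a coboundary, on some such cover, where \<open>z\<close> is the argument
  of the function \<open>c\<^sub>x\<^sub>y\<close> on \<open>U\<^sub>x \<inter> U\<^sub>y\<close>. Then \<open>Z / B\<close> is the colimit of the groups
  \<open>H\<^sup>1(U, O\<^sub>X)\<close> over all covers \<open>U\<close>.
\<close>

definition point_cover :: "'a topology \<Rightarrow> ('a \<Rightarrow> 'a set) \<Rightarrow> bool" where
  "point_cover T U \<longleftrightarrow> (\<forall>x\<in>topspace T. openin T (U x) \<and> x \<in> U x)"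

definition cech_cocycles ::
    "'k::field proj_point topology \<Rightarrow> ('k proj_point \<times> 'k proj_point \<times> 'k proj_point \<Rightarrow> 'k) set"
  where
  "cech_cocycles T = {c. \<exists>U. point_cover T U \<and>
     (\<forall>x\<in>topspace T. \<forall>y\<in>topspace T.
        restrict (\<lambda>z. c (x, y, z)) (U x \<inter> U y) \<in> regular_functions T (U x \<inter> U y)) \<and>
     (\<forall>x\<in>topspace T. \<forall>y\<in>topspace T. \<forall>w\<in>topspace T. \<forall>z\<in>U x \<inter> U y \<inter> U w.
        c (x, y, z) + c (y, w, z) = c (x, w, z))}"

definition cech_coboundaries ::
    "'k::field proj_point topology \<Rightarrow> ('k proj_point \<times> 'k proj_point \<times> 'k proj_point \<Rightarrow> 'k) set"
  where
  "cech_coboundaries T = {c. \<exists>U b. point_cover T U \<and>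
     (\<forall>x\<in>topspace T. restrict (b x) (U x) \<in> regular_functions T (U x)) \<and>
     (\<forall>x\<in>topspace T. \<forall>y\<in>topspace T. \<forall>z\<in>U x \<inter> U y. c (x, y, z) = b y z - b x z)}"

definition has_genus :: "'k::field proj_point topology \<Rightarrow> nat \<Rightarrow> bool" where
  "has_genus T g \<longleftrightarrow> quot_dim (cech_cocycles T) (cech_coboundaries T) g"


section \<open>Function field and degree of a morphism\<close>

text \<open>
  Rational functions are represented by functions that are regular on some nonempty open set,
  modulo those that vanish on some nonempty open set (for irreducible \<open>T\<close>).
\<close>

definition rational_ring :: "'k::field proj_point topology \<Rightarrow> ('k proj_point \<Rightarrow> 'k) ring" where
  "rational_ring T =
     \<lparr>carrier = {h. \<exists>U. openin T U \<and> U \<noteq> {} \<and> restrict h U \<in> regular_functions T U},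
      monoid.mult = (\<lambda>g h p. g p * h p), one = (\<lambda>_. 1), zero = (\<lambda>_. 0), add = (\<lambda>g h p. g p + h p)\<rparr>"

definition generic_null :: "'k::field proj_point topology \<Rightarrow> ('k proj_point \<Rightarrow> 'k) set" where
  "generic_null T = {h. \<exists>U. openin T U \<and> U \<noteq> {} \<and> (\<forall>p\<in>U. h p = 0)}"

definition function_field :: "'k::field proj_point topology \<Rightarrow> ('k proj_point \<Rightarrow> 'k) set ring" where
  "function_field T = rational_ring T Quot generic_null T"

definition pullback_field ::
    "'k::field proj_point topology \<Rightarrow> 'k proj_point topology \<Rightarrow> ('k proj_point \<Rightarrow> 'k proj_point)
      \<Rightarrow> ('k proj_point \<Rightarrow> 'k) set set" where
  "pullback_field T T' f =
     (\<lambda>h. generic_null T +>\<^bsub>rational_ring T\<^esub> (h \<circ> f)) ` carrier (rational_ring T')"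

text \<open>The degree of a dominant morphism \<open>f : T \<rightarrow> T'\<close> is \<open>[K(T) : f\<^sup>* K(T')]\<close>.\<close>

definition has_degree ::
    "'k::field proj_point topology \<Rightarrow> 'k proj_point topology \<Rightarrow> ('k proj_point \<Rightarrow> 'k proj_point)
      \<Rightarrow> nat \<Rightarrow> bool" where
  "has_degree T T' f n \<longleftrightarrow>
     ring.dimension (function_field T) n (pullback_field T T' f) (carrier (function_field T))"


section \<open>Sheaves of modules\<close>

record ('p, 'k, 'm) mod_sheaf =
  sections :: "'p set \<Rightarrow> ('p \<Rightarrow> 'k, 'm) module"
  restr :: "'p set \<Rightarrow> 'p set \<Rightarrow> 'm \<Rightarrow> 'm"

locale sheaf_of_modules =
  fixes T :: "'k::field proj_point topology" and M :: "('k proj_point, 'k, 'm) mod_sheaf"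
  assumes sections_module:
      "openin T U \<Longrightarrow> Module.module (regular_ring T U) (sections M U)"
    and restr_closed:
      "\<lbrakk>openin T U; openin T V; V \<subseteq> U; s \<in> carrier (sections M U)\<rbrakk>
        \<Longrightarrow> restr M U V s \<in> carrier (sections M V)"
    and restr_add:
      "\<lbrakk>openin T U; openin T V; V \<subseteq> U; s \<in> carrier (sections M U); t \<in> carrier (sections M U)\<rbrakk>
        \<Longrightarrow> restr M U V (s \<oplus>\<^bsub>sections M U\<^esub> t) = restr M U V s \<oplus>\<^bsub>sections M V\<^esub> restr M U V t"
    and restr_smult:
      "\<lbrakk>openin T U; openin T V; V \<subseteq> U; a \<in> regular_functions T U; s \<in> carrier (sections M U)\<rbrakk>
        \<Longrightarrow> restr M U V (a \<odot>\<^bsub>sections M U\<^esub> s) = restrict a V \<odot>\<^bsub>sections M V\<^esub> restr M U V s"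
    and restr_id:
      "\<lbrakk>openin T U; s \<in> carrier (sections M U)\<rbrakk> \<Longrightarrow> restr M U U s = s"
    and restr_trans:
      "\<lbrakk>openin T U; openin T V; openin T W; W \<subseteq> V; V \<subseteq> U; s \<in> carrier (sections M U)\<rbrakk>
        \<Longrightarrow> restr M V W (restr M U V s) = restr M U W s"
    and locality:
      "\<lbrakk>\<And>V. V \<in> \<U> \<Longrightarrow> openin T V; s \<in> carrier (sections M (\<Union>\<U>)); t \<in> carrier (sections M (\<Union>\<U>));
        \<And>V. V \<in> \<U> \<Longrightarrow> restr M (\<Union>\<U>) V s = restr M (\<Union>\<U>) V t\<rbrakk> \<Longrightarrow> s = t"
    and gluing:
      "\<lbrakk>\<And>V. V \<in> \<U> \<Longrightarrow> openin T V; \<And>V. V \<in> \<U> \<Longrightarrow> \<sigma> V \<in> carrier (sections M V);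
        \<And>V W. \<lbrakk>V \<in> \<U>; W \<in> \<U>\<rbrakk> \<Longrightarrow> restr M V (V \<inter> W) (\<sigma> V) = restr M W (V \<inter> W) (\<sigma> W)\<rbrakk>
        \<Longrightarrow> \<exists>s\<in>carrier (sections M (\<Union>\<U>)). \<forall>V\<in>\<U>. restr M (\<Union>\<U>) V s = \<sigma> V"

text \<open>Isomorphism of the restrictions of two sheaves of modules to the open set \<open>U\<close>.\<close>

definition sheaf_iso_on ::
    "'k::field proj_point topology \<Rightarrow> 'k proj_point set \<Rightarrow> ('k proj_point, 'k, 'm) mod_sheaf
      \<Rightarrow> ('k proj_point, 'k, 'n) mod_sheaf \<Rightarrow> bool" where
  "sheaf_iso_on T U M N \<longleftrightarrow> (\<exists>\<phi> :: 'k proj_point set \<Rightarrow> 'm \<Rightarrow> 'n.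
     (\<forall>V. openin T V \<and> V \<subseteq> U \<longrightarrow>
        bij_betw (\<phi> V) (carrier (sections M V)) (carrier (sections N V)) \<and>
        (\<forall>s\<in>carrier (sections M V). \<forall>t\<in>carrier (sections M V).
           \<phi> V (s \<oplus>\<^bsub>sections M V\<^esub> t) = \<phi> V s \<oplus>\<^bsub>sections N V\<^esub> \<phi> V t) \<and>
        (\<forall>a\<in>regular_functions T V. \<forall>s\<in>carrier (sections M V).
           \<phi> V (a \<odot>\<^bsub>sections M V\<^esub> s) = a \<odot>\<^bsub>sections N V\<^esub> \<phi> V s)) \<and>
     (\<forall>V W. openin T V \<and> openin T W \<and> W \<subseteq> V \<and> V \<subseteq> U \<longrightarrow>
        (\<forall>s\<in>carrier (sections M V). \<phi> W (restr M V W s) = restr N V W (\<phi> V s))))"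

definition structure_sheaf ::
    "'k::field proj_point topology \<Rightarrow> ('k proj_point, 'k, 'k proj_point \<Rightarrow> 'k) mod_sheaf" where
  "structure_sheaf T =
     \<lparr>sections = (\<lambda>U. ring.extend (regular_ring T U) \<lparr>module.smult = monoid.mult (regular_ring T U)\<rparr>),
      restr = (\<lambda>U V h. restrict h V)\<rparr>"

definition line_bundle ::
    "'k::field proj_point topology \<Rightarrow> ('k proj_point, 'k, 'm) mod_sheaf \<Rightarrow> bool" where
  "line_bundle T L \<longleftrightarrow> sheaf_of_modules T L \<and>
     (\<forall>p\<in>topspace T. \<exists>U. openin T U \<and> p \<in> U \<and> sheaf_iso_on T U L (structure_sheaf T))"

definition pushforward ::
    "'k::field proj_point topology \<Rightarrow> ('k proj_point \<Rightarrow> 'k proj_point)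
      \<Rightarrow> ('k proj_point, 'k, 'm) mod_sheaf \<Rightarrow> ('k proj_point, 'k, 'm) mod_sheaf" where
  "pushforward T f M =
     (let pre = (\<lambda>V. {x \<in> topspace T. f x \<in> V}) in
     \<lparr>sections = (\<lambda>V. (sections M (pre V))
        \<lparr>module.smult := (\<lambda>a s. restrict (a \<circ> f) (pre V) \<odot>\<^bsub>sections M (pre V)\<^esub> s)\<rparr>),
      restr = (\<lambda>V W. restr M (pre V) (pre W))\<rparr>)"

text \<open>
  Sections of \<open>O(m)\<close> over \<open>V\<close> are functions on the cone over \<open>V\<close> that are locally quotients of
  homogeneous polynomials with difference of degrees \<open>m\<close>. The ring structure required by the
  record is irrelevant except for addition and zero.
\<close>

definition twist_sections ::
    "'k::field proj_point topology \<Rightarrow> int \<Rightarrow> 'k proj_point set \<Rightarrow> ((nat \<Rightarrow> 'k) \<Rightarrow> 'k) set" where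
  "twist_sections T m V = {s \<in> extensional (\<Union>V). \<forall>p\<in>V. \<exists>W F G d e.
     openin T W \<and> p \<in> W \<and> W \<subseteq> V \<and> homog d F \<and> homog e G \<and> int d - int e = m \<and>
     (\<forall>q\<in>W. \<forall>v\<in>q. peval G v \<noteq> 0 \<and> s v = peval F v / peval G v)}"

definition twist ::
    "'k::field proj_point topology \<Rightarrow> int \<Rightarrow> ('k proj_point, 'k, (nat \<Rightarrow> 'k) \<Rightarrow> 'k) mod_sheaf" where
  "twist T m =
     \<lparr>sections = (\<lambda>V.
        \<lparr>carrier = twist_sections T m V,
         monoid.mult = undefined,
         one = undefined,
         zero = restrict (\<lambda>_. 0) (\<Union>V),
         add = (\<lambda>s t. restrict (\<lambda>v. s v + t v) (\<Union>V)),
         module.smult = (\<lambda>a s. restrict (\<lambda>v. a (hpoint v) * s v) (\<Union>V))\<rparr>),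
      restr = (\<lambda>V W s. restrict s (\<Union>W))\<rparr>"

definition direct_sum ::
    "'i set \<Rightarrow> ('i \<Rightarrow> ('p, 'k, 'm) mod_sheaf) \<Rightarrow> ('p, 'k, 'i \<Rightarrow> 'm) mod_sheaf" where
  "direct_sum I M =
     \<lparr>sections = (\<lambda>V.
        \<lparr>carrier = (\<Pi>\<^sub>E i\<in>I. carrier (sections (M i) V)),
         monoid.mult = undefined,
         one = undefined,
         zero = (\<lambda>i\<in>I. \<zero>\<^bsub>sections (M i) V\<^esub>),
         add = (\<lambda>s t. \<lambda>i\<in>I. s i \<oplus>\<^bsub>sections (M i) V\<^esub> t i),
         module.smult = (\<lambda>a s. \<lambda>i\<in>I. a \<odot>\<^bsub>sections (M i) V\<^esub> s i)\<rparr>),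
      restr = (\<lambda>V W s. \<lambda>i\<in>I. restr (M i) V W (s i))\<rparr>"


section \<open>Splitting type on the projective line\<close>

text \<open>
  \<open>splits_as T f L n a\<close> says that \<open>f\<^sub>* L\<close> is isomorphic to the direct sum of
  \<open>O(a\<^sub>1), \<dots>, O(a\<^sub>n)\<close> on \<open>P\<^sup>1\<close>; by Grothendieck's theorem the \<open>a\<^sub>j\<close> exist and are unique up to
  permutation. Then \<open>splitting_gap n a\<close> is the invariant \<open>s(L, f)\<close>.
\<close>

definition splits_as ::
    "'k::field proj_point topology \<Rightarrow> ('k proj_point \<Rightarrow> 'k proj_point)
      \<Rightarrow> ('k proj_point, 'k, 'm) mod_sheaf \<Rightarrow> nat \<Rightarrow> (nat \<Rightarrow> int) \<Rightarrow> bool" where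
  "splits_as T f L n a \<longleftrightarrow>
     sheaf_iso_on (zariski 1) (proj_space 1)
       (pushforward T f L) (direct_sum {1..n} (\<lambda>j. twist (zariski 1) (a j)))"

definition splitting_gap :: "nat \<Rightarrow> (nat \<Rightarrow> int) \<Rightarrow> int" where
  "splitting_gap n a = Max {\<bar>a i - a j\<bar> | i j. i \<in> {1..n} \<and> j \<in> {1..n}}"

end

(*
  Suppose a J - a I \<ge> 3 and let u = x1 / x0 be the pulled back coordinate. The two-set cover of
  the curve by the preimages of the standard affine opens of the line shows that for every twist
  L(m) of L by the pullback of O(m), the sections of L(m) and the classes in H^1(L(m)) coming from
  this cover have bases of monomials u^i e_j. Multiplication by a nonzero section s of L(m) is
  surjective from H^1(O) to H^1(L(m)), because s has only finitely many zeros and a cover can be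
  chosen whose overlap avoids them. Hence:

  - With m = -a J the twist has a nonzero section, so h^1(L(m)) = sum_j max(0, a J - a j - 1) \<le> g.
  - With m = -a I - 2 the twist has H^1 \<noteq> 0. A nonzero functional on H^1(L(m)) embeds H^0(L(m))
    into the dual of H^1(O), so h^0(L(m)) = sum_j max(0, a j - a I - 1) \<le> g.

  In the sum of both inequalities every j contributes at least 1, and I and J contribute at
  least 2. So n + 2 \<le> 2 g.
*)
theory Submission
  imports Defs "HOL-Library.Function_Algebras"
begin

section \<open>Hilbert's basis theorem\<close>

text \<open>Cohomology is given as a colimit over all covers, so sections over many open sets have
  to be compared. One nonempty open \<open>Xo\<close>, on which \<open>L\<close> is trivial and
  \<open>u\<close> is regular without zeros, makes this manageable: by irreducibility a section over
  any \<open>V\<close> is determined by a function on \<open>V \<inter> Xo\<close>. Sections, their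
  twists and cochains thus become plain functions, and twisting by m only inserts
  \<open>u z powi (- m)\<close> in the condition on \<open>X1\<close>.

  That a nonzero section has finitely many zeros rests on the finiteness of proper closed subsets of
  the curve. With dimension given by chains of irreducible closed sets, this takes the descending
  chain condition, hence Hilbert's basis theorem.

  Surjectivity of multiplication by a section serves twice: it bounds h^1 directly, and through a
  functional it bounds h^0, in the role of Serre duality. The twists turn summand J into O(0), the
  lowest degree with a nonzero section, and summand I into O(-2), the highest degree with nonzero
  H^1.\<close>

definition ring_closed :: "'a::comm_ring_1 set \<Rightarrow> bool" where
  "ring_closed R \<longleftrightarrow> 0 \<in> R \<and> 1 \<in> R \<and> (\<forall>x\<in>R. \<forall>y\<in>R. x + y \<in> R \<and> x * y \<in> R \<and> - x \<in> R)"

inductive_set ideal_span :: "'a::comm_ring_1 set \<Rightarrow> 'a set \<Rightarrow> 'a set" for R S where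
  zero: "0 \<in> ideal_span R S"
| step: "r \<in> R \<Longrightarrow> s \<in> S \<Longrightarrow> y \<in> ideal_span R S \<Longrightarrow> r * s + y \<in> ideal_span R S"

text \<open>The ascending chain condition in terms of sequences. Hilbert's argument and the
  descending chains of closed sets both produce sequences, so this form applies to them
  directly.\<close>

definition noetherian_in :: "'a::comm_ring_1 set \<Rightarrow> bool" where
  "noetherian_in R \<longleftrightarrow> (\<forall>f::nat \<Rightarrow> 'a. range f \<subseteq> R \<longrightarrow> (\<exists>m. f m \<in> ideal_span R (f ` {..<m})))"

lemma ideal_span_add:
  assumes "x \<in> ideal_span R S" "y \<in> ideal_span R S"
  shows "x + y \<in> ideal_span R S"
  using assms by induction (auto simp: add.assoc intro: ideal_span.intros)

lemma ideal_span_mult: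
  assumes "ring_closed R" "r \<in> R" "x \<in> ideal_span R S"
  shows "r * x \<in> ideal_span R S"
  using assms(3)
proof induction
  case (step r' s y)
  have "r * (r' * s + y) = (r * r') * s + r * y" by (simp add: algebra_simps)
  then show ?case using step assms(1,2) by (simp add: ideal_span.step ring_closed_def)
qed (simp add: ideal_span.zero)

lemma ideal_span_diff:
  assumes "ring_closed R" "x \<in> ideal_span R S" "y \<in> ideal_span R S"
  shows "x - y \<in> ideal_span R S"
proof -
  have "(-1) * y \<in> ideal_span R S"
    using assms by (intro ideal_span_mult) (auto simp: ring_closed_def)
  from ideal_span_add[OF assms(2) this] show ?thesis by simp
qed

lemma ideal_span_base: "ring_closed R \<Longrightarrow> s \<in> S \<Longrightarrow> s \<in> ideal_span R S"
  using ideal_span.step[of 1 R s S 0] ideal_span.zero[of R S] by (simp add: ring_closed_def)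

lemma ideal_span_least:
  assumes "ring_closed R" "S \<subseteq> ideal_span R S'" "x \<in> ideal_span R S"
  shows "x \<in> ideal_span R S'"
  using assms(3)
  by induction (use assms(1,2) in \<open>auto intro!: ideal_span.zero ideal_span_add ideal_span_mult\<close>)

lemma ideal_span_mono: "S \<subseteq> S' \<Longrightarrow> x \<in> ideal_span R S \<Longrightarrow> x \<in> ideal_span R S'"
  by (rotate_tac, induction rule: ideal_span.induct) (auto intro: ideal_span.intros)

lemma ideal_span_subset_ring:
  assumes "ring_closed R" "S \<subseteq> R"
  shows "ideal_span R S \<subseteq> R"
proof
  fix x assume "x \<in> ideal_span R S"
  then show "x \<in> R" by induction (use assms in \<open>auto simp: ring_closed_def\<close>)
qed

lemma ideal_span_range:
  fixes f :: "nat \<Rightarrow> 'a::comm_ring_1"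
  assumes "x \<in> ideal_span R (range f)"
  shows "\<exists>m. x \<in> ideal_span R (f ` {..<m})"
  using assms
proof induction
  case zero
  then show ?case by (auto intro: ideal_span.zero)
next
  case (step r s y)
  then obtain m i where "y \<in> ideal_span R (f ` {..<m})" "s = f i" by blast
  then have "y \<in> ideal_span R (f ` {..<max m (Suc i)})" "s \<in> f ` {..<max m (Suc i)}"
    by (auto intro: ideal_span_mono[of "f ` {..<m}"])
  then show ?case using step by (blast intro: ideal_span.step)
qed

lemma ideal_span_range_finite:
  fixes f :: "nat \<Rightarrow> 'a::comm_ring_1"
  assumes "finite F" "F \<subseteq> ideal_span R (range f)"
  shows "\<exists>m. F \<subseteq> ideal_span R (f ` {..<m})"
  using assms
proof induction
  case (insert x F)
  then obtain m m' where "F \<subseteq> ideal_span R (f ` {..<m})" "x \<in> ideal_span R (f ` {..<m'})"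
    using ideal_span_range by fast
  then have "insert x F \<subseteq> ideal_span R (f ` {..<max m m'})"
    by (auto intro: ideal_span_mono[of "f ` {..<m}"] ideal_span_mono[of "f ` {..<m'}"])
  then show ?case ..
qed simp

text \<open>Subrings are sets inside a fixed type: polynomials over \<open>R\<close> live in
  \<open>'a poly\<close>, and evaluation at an element of \<open>'a\<close> leads back to
  \<open>'a\<close>. So the adjunction of a variable can be iterated within one type.\<close>

definition polys_over :: "'a::comm_ring_1 set \<Rightarrow> 'a poly set" where
  "polys_over R = {p. \<forall>i. coeff p i \<in> R}"

lemma ring_closed_sum:
  assumes "ring_closed R" "\<And>i. i \<in> I \<Longrightarrow> f i \<in> R"
  shows "sum f I \<in> R"
  using assms(2) by (induction I rule: infinite_finite_induct) (use assms(1) in \<open>auto simp: ring_closed_def\<close>)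

lemma ring_closed_polys_over:
  assumes "ring_closed R"
  shows "ring_closed (polys_over R)"
proof -
  have "coeff (p * q) i \<in> R" if "p \<in> polys_over R" "q \<in> polys_over R" for p q i
    unfolding coeff_mult
    by (rule ring_closed_sum[OF assms]) (use assms that in \<open>auto simp: ring_closed_def polys_over_def\<close>)
  then show ?thesis using assms by (auto simp: ring_closed_def polys_over_def)
qed

lemma monom_polys_over: "ring_closed R \<Longrightarrow> r \<in> R \<Longrightarrow> monom r d \<in> polys_over R"
  by (simp add: polys_over_def ring_closed_def)

text \<open>
  In an ideal that is not finitely generated, generators of successively minimal degree give
  leading coefficients none of which lies in the ideal of the previous ones.
\<close>

theorem hilbert_basis:
  fixes R :: "'a::comm_ring_1 set"
  assumes R: "ring_closed R" and noeth: "noetherian_in R"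
  shows "noetherian_in (polys_over R)"
proof (rule ccontr)
  let ?P = "polys_over R"
  note P = ring_closed_polys_over[OF R]
  assume "\<not> noetherian_in ?P"
  then obtain f :: "nat \<Rightarrow> 'a poly" where f: "range f \<subseteq> ?P"
    and nf: "\<And>m. f m \<notin> ideal_span ?P (f ` {..<m})"
    unfolding noetherian_in_def by blast
  define I where "I = ideal_span ?P (range f)"
  have IP: "I \<subseteq> ?P" unfolding I_def by (rule ideal_span_subset_ring[OF P f])
  have ex: "\<exists>p. p \<in> I \<and> p \<notin> ideal_span ?P F" if F: "finite F" "F \<subseteq> I" for F
  proof (rule ccontr)
    assume *: "\<not> ?thesis"
    \<comment> \<open>A finite F lies in the ideal of an initial segment of f. If F generated all of
      I, the next member f m would lie in that ideal too.\<close>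
    obtain m where "F \<subseteq> ideal_span ?P (f ` {..<m})"
      using ideal_span_range_finite F unfolding I_def by blast
    moreover have "f m \<in> I" unfolding I_def by (rule ideal_span_base[OF P]) simp
    ultimately show False using * nf ideal_span_least[OF P] by metis
  qed
  define h where "h F = (ARG_MIN degree p. p \<in> I \<and> p \<notin> ideal_span ?P F)" for F
  have h: "h F \<in> I \<and> h F \<notin> ideal_span ?P F"
    "\<And>q. q \<in> I \<Longrightarrow> q \<notin> ideal_span ?P F \<Longrightarrow> degree (h F) \<le> degree q"
    if "finite F" "F \<subseteq> I" for F
  proof -
    from ex[OF that] obtain p0 where p0: "p0 \<in> I \<and> p0 \<notin> ideal_span ?P F" by blast
    show "h F \<in> I \<and> h F \<notin> ideal_span ?P F"
      unfolding h_def
      using arg_min_nat_lemma[of "\<lambda>p. p \<in> I \<and> p \<notin> ideal_span ?P F" p0 degree, OF p0] by blast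
    show "degree (h F) \<le> degree q" if "q \<in> I" "q \<notin> ideal_span ?P F" for q
      unfolding h_def
      using arg_min_nat_lemma[of "\<lambda>p. p \<in> I \<and> p \<notin> ideal_span ?P F" p0 degree, OF p0] that by blast
  qed
  \<comment> \<open>Each generator depends on all earlier ones, so the recursion runs over the set
    of generators chosen so far.\<close>
  define Fs where "Fs = rec_nat {} (\<lambda>_ F. insert (h F) F)"
  define g where "g k = h (Fs k)" for k
  have Fs: "Fs k = g ` {..<k}" for k
    by (induction k) (simp_all add: Fs_def g_def lessThan_Suc)
  have gI: "g k \<in> I" for k
  proof (induction k rule: less_induct)
    case (less k)
    then have "finite (Fs k)" "Fs k \<subseteq> I" by (auto simp: Fs)
    then show ?case using h(1) by (simp add: g_def)
  qed
  have FsI: "finite (Fs k)" "Fs k \<subseteq> I" for k using gI by (auto simp: Fs)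
  have g_eq: "g k = h (g ` {..<k})" for k by (subst g_def) (simp add: Fs)
  have g_notin: "g k \<notin> ideal_span ?P (g ` {..<k})" for k
    using h(1)[OF FsI[of k]] by (metis Fs g_eq)
  have g_min: "degree (g k) \<le> degree q" if "q \<in> I" "q \<notin> ideal_span ?P (g ` {..<k})" for k q
    using h(2)[OF FsI[of k], of q] that by (metis Fs g_eq)
  have deg_mono: "degree (g i) \<le> degree (g m)" if "i \<le> m" for i m
  proof (rule g_min[OF gI])
    show "g m \<notin> ideal_span ?P (g ` {..<i})"
      using g_notin[of m] ideal_span_mono[of "g ` {..<i}" "g ` {..<m}"] that by fastforce
  qed
  define a where "a k = lead_coeff (g k)" for k
  have "range a \<subseteq> R" using gI IP by (auto simp: a_def polys_over_def)
  then obtain m where m: "a m \<in> ideal_span R (a ` {..<m})"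
    using noeth unfolding noetherian_in_def by blast
  \<comment> \<open>A combination of the earlier leading coefficients is realized by an element of
    the earlier ideal: each g i is lifted to the degree of g m by a power of the variable, which is
    possible because the degrees never decrease.\<close>
  have "\<exists>q\<in>ideal_span ?P (g ` {..<m}). degree q \<le> degree (g m) \<and> coeff q (degree (g m)) = c"
    if "c \<in> ideal_span R (a ` {..<m})" for c
    using that
  proof induction
    case zero
    show ?case by (intro bexI[of _ 0]) (auto intro: ideal_span.zero)
  next
    case (step r s y)
    then obtain i q where i: "i < m" "s = a i" and q: "q \<in> ideal_span ?P (g ` {..<m})"
      "degree q \<le> degree (g m)" "coeff q (degree (g m)) = y" by blast
    let ?d = "degree (g m) - degree (g i)"
    have d: "?d + degree (g i) = degree (g m)" using deg_mono i(1) by simp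
    let ?q = "monom r ?d * g i + q"
    have "?q \<in> ideal_span ?P (g ` {..<m})"
      using i q monom_polys_over[OF R step(1)] by (auto intro: ideal_span.step)
    moreover have "degree (monom r ?d * g i) \<le> degree (g m)"
      using degree_mult_le[of "monom r ?d" "g i"] degree_monom_le[of r ?d] d by linarith
    then have "degree ?q \<le> degree (g m)" using q(2) by (rule degree_add_le)
    moreover have "coeff ?q (degree (g m)) = r * s + y"
      using d q(3) i(2) deg_mono[of i m] by (simp add: coeff_monom_mult a_def)
    ultimately show ?case by blast
  qed
  from this[OF m] obtain q where q: "q \<in> ideal_span ?P (g ` {..<m})" "degree q \<le> degree (g m)"
    "coeff q (degree (g m)) = lead_coeff (g m)" by (auto simp: a_def)
  \<comment> \<open>q cancels the leading term of g m, while g m - q stays outside the earlier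
    ideal. Minimality of the degree of g m then leaves only g m - q = 0, which lies in every
    ideal.\<close>
  let ?r = "g m - q"
  have qI: "q \<in> I"
    using q(1) ideal_span_least[OF P, of "g ` {..<m}" "range f" q] gI unfolding I_def by blast
  have "?r \<in> I" using ideal_span_diff[OF P] gI[of m] qI unfolding I_def by blast
  moreover have r: "?r \<notin> ideal_span ?P (g ` {..<m})"
  proof
    assume "?r \<in> ideal_span ?P (g ` {..<m})"
    from ideal_span_add[OF this q(1)] g_notin[of m] show False by simp
  qed
  ultimately have "degree (g m) \<le> degree ?r" by (rule g_min)
  moreover have "degree ?r \<le> degree (g m)" using q(2) by (simp add: degree_diff_le)
  ultimately have "lead_coeff ?r = coeff ?r (degree (g m))" by (metis antisym)
  also have "\<dots> = 0" using q(3) by simp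
  finally have "?r = 0" by (simp only: leading_coeff_0_iff)
  then show False using r ideal_span.zero by metis
qed

text \<open>Preimages of the given sequence are chosen in \<open>R\<close>, and the relation among
  them is mapped forward.\<close>

lemma noetherian_in_image:
  assumes noeth: "noetherian_in R"
    and hom: "\<phi> 0 = 0" "\<And>x y. \<phi> (x + y) = \<phi> x + \<phi> y" "\<And>x y. \<phi> (x * y) = \<phi> x * \<phi> y"
  shows "noetherian_in (\<phi> ` R)"
  unfolding noetherian_in_def
proof (intro allI impI)
  fix f :: "nat \<Rightarrow> 'b" assume "range f \<subseteq> \<phi> ` R"
  then have "\<forall>i. \<exists>x. x \<in> R \<and> f i = \<phi> x" by blast
  then obtain g where g: "\<And>i. g i \<in> R" "\<And>i. f i = \<phi> (g i)" by metis
  then obtain m where m: "g m \<in> ideal_span R (g ` {..<m})"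
    using noeth unfolding noetherian_in_def by blast
  have "\<phi> x \<in> ideal_span (\<phi> ` R) (f ` {..<m})" if "x \<in> ideal_span R (g ` {..<m})" for x
    using that
  proof induction
    case (step r s y)
    then have "\<phi> r \<in> \<phi> ` R" "\<phi> s \<in> f ` {..<m}" using g(2) by auto
    then show ?case using step by (simp add: hom ideal_span.step)
  qed (simp add: hom ideal_span.zero)
  then show "\<exists>m. f m \<in> ideal_span (\<phi> ` R) (f ` {..<m})" using m g(2) by auto
qed


section \<open>Polynomial functions\<close>

text \<open>Polynomials are built as functions, one variable at a time: each stage is the image of a
  polynomial ring over the previous stage under substitution of a coordinate function, so that
  Hilbert's theorem applies once per variable.\<close>

primrec poly_funs :: "nat \<Rightarrow> ((nat \<Rightarrow> 'k::field) \<Rightarrow> 'k) set" where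
  "poly_funs 0 = range (\<lambda>c _. c)"
| "poly_funs (Suc j) = (\<lambda>p. poly p (\<lambda>v. v j)) ` polys_over (poly_funs j)"

lemma ring_closed_image_poly:
  assumes "ring_closed R"
  shows "ring_closed ((\<lambda>p. poly p x) ` polys_over R)"
  unfolding ring_closed_def
proof (intro conjI ballI)
  note P = ring_closed_polys_over[OF assms]
  show "0 \<in> (\<lambda>p. poly p x) ` polys_over R"
    using P by (intro image_eqI[of _ _ 0]) (auto simp: ring_closed_def)
  show "1 \<in> (\<lambda>p. poly p x) ` polys_over R"
    using P by (intro image_eqI[of _ _ 1]) (auto simp: ring_closed_def)
  fix y z assume "y \<in> (\<lambda>p. poly p x) ` polys_over R" "z \<in> (\<lambda>p. poly p x) ` polys_over R"
  then obtain p q where p: "y = poly p x" "p \<in> polys_over R" "z = poly q x" "q \<in> polys_over R"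
    by blast
  then show "y + z \<in> (\<lambda>p. poly p x) ` polys_over R" "y * z \<in> (\<lambda>p. poly p x) ` polys_over R"
    "- y \<in> (\<lambda>p. poly p x) ` polys_over R"
    using P by (auto simp: ring_closed_def intro: image_eqI[of _ _ "p + q"]
        image_eqI[of _ _ "p * q"] image_eqI[of _ _ "- p"])
qed

lemma ring_closed_poly_funs: "ring_closed (poly_funs j :: ((nat \<Rightarrow> 'k::field) \<Rightarrow> 'k) set)"
proof (induction j)
  case 0
  show ?case
    by (auto simp: ring_closed_def zero_fun_def one_fun_def plus_fun_def times_fun_def fun_Compl_def)
qed (simp add: ring_closed_image_poly)

lemma noetherian_poly_funs: "noetherian_in (poly_funs j :: ((nat \<Rightarrow> 'k::field) \<Rightarrow> 'k) set)"
proof (induction j)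
  case 0
  let ?R = "poly_funs 0 :: ((nat \<Rightarrow> 'k) \<Rightarrow> 'k) set"
  show ?case unfolding noetherian_in_def
  proof (intro allI impI)
    fix f :: "nat \<Rightarrow> (nat \<Rightarrow> 'k) \<Rightarrow> 'k"
    assume f: "range f \<subseteq> ?R"
    have "\<forall>i. \<exists>c. f i = (\<lambda>_. c)"
    proof
      fix i
      have "f i \<in> range (\<lambda>c _. c)" using f by auto
      then show "\<exists>c. f i = (\<lambda>_. c)" by blast
    qed
    then obtain c where c: "\<And>i. f i = (\<lambda>_. c i)" using choice[of "\<lambda>i c. f i = (\<lambda>_. c)"] by blast
    \<comment> \<open>The constants form a field: either f 0 = 0, or f 1 is a multiple of f
      0.\<close>
    show "\<exists>m. f m \<in> ideal_span ?R (f ` {..<m})"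
    proof (cases "c 0 = 0")
      case True
      then have "f 0 = 0" using c by (simp add: zero_fun_def)
      then show ?thesis by (metis ideal_span.zero)
    next
      case False
      then have "f 1 = (\<lambda>_. c 1 / c 0) * f 0 + 0" using c by auto
      also have "\<dots> \<in> ideal_span ?R (f ` {..<1})"
        by (rule ideal_span.step) (auto intro: ideal_span.zero)
      finally show ?thesis by blast
    qed
  qed
next
  case (Suc j)
  show ?case
    unfolding poly_funs.simps
    by (rule noetherian_in_image[OF hilbert_basis[OF ring_closed_poly_funs Suc]]) auto
qed

lemma poly_funs_const: "(\<lambda>_. c) \<in> poly_funs j"
proof (induction j)
  case (Suc j)
  then have "[:\<lambda>_. c:] \<in> polys_over (poly_funs j)"
    using ring_closed_poly_funs[of j]
    by (auto simp: polys_over_def ring_closed_def coeff_pCons split: nat.splits)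
  moreover have "(\<lambda>_. c) = poly [:\<lambda>_. c:] (\<lambda>v. v j)" by auto
  ultimately show ?case unfolding poly_funs.simps by (rule rev_image_eqI)
qed auto

lemma poly_funs_Suc: "poly_funs j \<subseteq> poly_funs (Suc j)"
proof
  fix h :: "(nat \<Rightarrow> 'a) \<Rightarrow> 'a" assume "h \<in> poly_funs j"
  then have "[:h:] \<in> polys_over (poly_funs j)"
    using ring_closed_poly_funs[of j]
    by (auto simp: polys_over_def ring_closed_def coeff_pCons split: nat.splits)
  moreover have "h = poly [:h:] (\<lambda>v. v j)" by simp
  ultimately show "h \<in> poly_funs (Suc j)" unfolding poly_funs.simps by (rule rev_image_eqI)
qed

lemma poly_funs_coord: "i < j \<Longrightarrow> (\<lambda>v. v i) \<in> (poly_funs j :: ((nat \<Rightarrow> 'k::field) \<Rightarrow> 'k) set)"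
proof (induction j)
  case (Suc j)
  show ?case
  proof (cases "i = j")
    case True
    have "[:0, 1:] \<in> polys_over (poly_funs j :: ((nat \<Rightarrow> 'k) \<Rightarrow> 'k) set)"
      using ring_closed_poly_funs[of j]
      by (auto simp: polys_over_def ring_closed_def coeff_pCons split: nat.splits)
    moreover have "(\<lambda>v. v i) = poly [:0, 1:] (\<lambda>v :: nat \<Rightarrow> 'k. v j)"
      using True by (simp add: fun_eq_iff)
    ultimately show ?thesis unfolding poly_funs.simps by (rule rev_image_eqI)
  qed (use Suc poly_funs_Suc[of j] in auto)
qed simp

text \<open>Variables of index above N vanish on \<open>hvecs N\<close>, which is why agreement is
  claimed only there. The property \<open>?Q\<close> is closed under all operations from which
  \<open>peval\<close> is built.\<close>

lemma peval_poly_funs: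
  fixes F :: "'k::field mpoly"
  shows "\<exists>h\<in>poly_funs (Suc N). \<forall>v\<in>hvecs N. peval F v = h v"
proof -
  let ?R = "poly_funs (Suc N) :: ((nat \<Rightarrow> 'k) \<Rightarrow> 'k) set"
  let ?Q = "\<lambda>e. \<exists>h\<in>?R. \<forall>v\<in>hvecs N. e v = h v"
  have R: "ring_closed ?R" by (rule ring_closed_poly_funs)
  have const: "?Q (\<lambda>_. c)" for c by (rule bexI[OF _ poly_funs_const[of c]]) simp
  have coord: "?Q (\<lambda>v. v i)" for i
  proof (cases "i < Suc N")
    case True
    show ?thesis by (rule bexI[OF _ poly_funs_coord[OF True]]) simp
  next
    case False
    then show ?thesis using poly_funs_const[of 0 "Suc N"] by (intro bexI[of _ "\<lambda>_. 0"]) (auto simp: hvecs_def)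
  qed
  have add: "?Q (\<lambda>v. e v + e' v)" if "?Q e" "?Q e'" for e e'
  proof -
    obtain h h' where "h \<in> ?R" "h' \<in> ?R" "\<forall>v\<in>hvecs N. e v = h v" "\<forall>v\<in>hvecs N. e' v = h' v"
      using \<open>?Q e\<close> \<open>?Q e'\<close> by blast
    then show ?thesis using R by (intro bexI[of _ "h + h'"]) (auto simp: ring_closed_def)
  qed
  have mult: "?Q (\<lambda>v. e v * e' v)" if "?Q e" "?Q e'" for e e'
  proof -
    obtain h h' where "h \<in> ?R" "h' \<in> ?R" "\<forall>v\<in>hvecs N. e v = h v" "\<forall>v\<in>hvecs N. e' v = h' v"
      using \<open>?Q e\<close> \<open>?Q e'\<close> by blast
    then show ?thesis using R by (intro bexI[of _ "h * h'"]) (auto simp: ring_closed_def)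
  qed
  have sum: "?Q (\<lambda>v. \<Sum>i\<in>I. e i v)" if "\<And>i. ?Q (e i)" for I :: "(nat \<Rightarrow>\<^sub>0 nat) set" and e
  proof (induction I rule: infinite_finite_induct)
    case (insert i I)
    show ?case unfolding sum.insert[OF insert(1,2)] by (rule add[OF that insert(3)])
  qed (use const[of 0] in simp_all)
  have prod: "?Q (\<lambda>v. \<Prod>i\<in>I. e i v)" if "\<And>i. ?Q (e i)" for I :: "nat set" and e
  proof (induction I rule: infinite_finite_induct)
    case (insert i I)
    show ?case unfolding prod.insert[OF insert(1,2)] by (rule mult[OF that insert(3)])
  qed (use const[of 1] in simp_all)
  have power: "?Q (\<lambda>v. e v ^ d)" if "?Q e" for e d
  proof (induction d)
    case (Suc d)
    show ?case unfolding power_Suc by (rule mult[OF that Suc])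
  qed (use const[of 1] in simp)
  show ?thesis unfolding peval_def mono_val_def
    by (intro sum mult const prod power coord)
qed


section \<open>Zariski closed sets\<close>

lemma hpoint_scale: "c \<noteq> 0 \<Longrightarrow> hpoint (\<lambda>i. c * v i) = hpoint (v :: nat \<Rightarrow> 'k::field)"
proof (intro Set.set_eqI iffI)
  fix w assume c: "c \<noteq> 0"
  show "w \<in> hpoint v" if "w \<in> hpoint (\<lambda>i. c * v i)"
  proof -
    from that obtain d where "d \<noteq> 0" "w = (\<lambda>i. d * (c * v i))" by (auto simp: hpoint_def)
    then show ?thesis using c by (auto simp: hpoint_def intro!: exI[of _ "d * c"])
  qed
  show "w \<in> hpoint (\<lambda>i. c * v i)" if "w \<in> hpoint v"
  proof -
    from that obtain d where "d \<noteq> 0" "w = (\<lambda>i. d * v i)" by (auto simp: hpoint_def)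
    then show ?thesis using c by (auto simp: hpoint_def intro!: exI[of _ "d / c"])
  qed
qed

lemma hpoint_self: "v \<in> hpoint (v :: nat \<Rightarrow> 'k::field)"
  by (auto simp: hpoint_def intro!: exI[of _ 1])

lemma proj_space_hpoint: "v \<in> q \<Longrightarrow> q \<in> proj_space N \<Longrightarrow> hpoint v = q \<and> v \<in> hvecs N"
proof -
  assume v: "v \<in> q" "q \<in> proj_space N"
  then obtain w c where w: "w \<in> hvecs N" "q = hpoint w" "c \<noteq> 0" "v = (\<lambda>i. c * w i)"
    by (auto simp: proj_space_def hpoint_def)
  then show ?thesis by (auto simp: hpoint_scale hvecs_def)
qed

lemma proj_space_obtain:
  assumes "q \<in> proj_space N"
  obtains v where "v \<in> q" "v \<in> hvecs N" "hpoint v = q"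
  using assms hpoint_self by (auto simp: proj_space_def)

lemma homog_zero_iff:
  assumes "q \<in> proj_space N" "v \<in> q" "w \<in> q" "homog d F"
  shows "peval F v = 0 \<longleftrightarrow> peval F w = 0"
proof -
  have "v \<in> hpoint w" using proj_space_hpoint[of w q N] assms by simp
  then obtain c where "c \<noteq> 0" "v = (\<lambda>i. c * w i)" by (auto simp: hpoint_def)
  then show ?thesis using homog_peval_scale[OF assms(4), of c w] by simp
qed

lemma openin_nonvanishing:
  assumes "homog d F"
  shows "openin (zariski N) {q \<in> proj_space N. \<forall>v\<in>q. peval F v \<noteq> 0}"
proof -
  have "{q \<in> proj_space N. \<forall>v\<in>q. peval F v \<noteq> 0} = proj_space N - zero_locus N {F}"
  proof (intro equalityI subsetI)
    fix q :: "'a proj_point"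
    assume q: "q \<in> {q \<in> proj_space N. \<forall>v\<in>q. peval F v \<noteq> 0}"
    then obtain v where "v \<in> q" using proj_space_obtain[of q N] by blast
    then show "q \<in> proj_space N - zero_locus N {F}" using q by (auto simp: zero_locus_def)
  next
    fix q :: "'a proj_point"
    assume "q \<in> proj_space N - zero_locus N {F}"
    then obtain v where v: "q \<in> proj_space N" "v \<in> q" "peval F v \<noteq> 0"
      by (auto simp: zero_locus_def)
    then show "q \<in> {q \<in> proj_space N. \<forall>v\<in>q. peval F v \<noteq> 0}"
      using homog_zero_iff[OF v(1,2) _ assms] by blast
  qed
  then show ?thesis using assms unfolding openin_zariski by blast
qed

lemma closedin_zariski:
  assumes "closedin (zariski N) C"
  obtains S where "\<forall>F\<in>S. \<exists>d. homog d F" "C = zero_locus N S"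
proof -
  have "openin (zariski N) (proj_space N - C)" "C \<subseteq> proj_space N"
    using assms by (auto simp: closedin_def)
  then obtain S where S: "\<forall>F\<in>S. \<exists>d. homog d F" "proj_space N - C = proj_space N - zero_locus N S"
    unfolding openin_zariski by blast
  moreover have "C = zero_locus N S"
    using S(2) \<open>C \<subseteq> proj_space N\<close> unfolding zero_locus_def by blast
  ultimately show ?thesis using that by blast
qed

text \<open>For each i there is a polynomial function h i that vanishes on C (Suc i) but not at some
  vector v i of C i. If h m is a combination of earlier h i, it vanishes on C m, hence at v m. The
  argument takes place on the cones, since forms have values at vectors and not at points.\<close>

lemma zariski_dcc:
  fixes C :: "nat \<Rightarrow> 'k::field proj_point set"
  assumes "\<And>i. closedin (zariski N) (C i)" "\<And>i. C (Suc i) \<subset> C i"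
  shows False
proof -
  let ?R = "poly_funs (Suc N) :: ((nat \<Rightarrow> 'k) \<Rightarrow> 'k) set"
  have "\<exists>h v. h \<in> ?R \<and> v \<in> \<Union>(C i) \<and> h v \<noteq> 0 \<and> (\<forall>w\<in>\<Union>(C (Suc i)). h w = 0)" for i
  proof -
    obtain p where p: "p \<in> C i" "p \<notin> C (Suc i)" using assms(2) by blast
    obtain S where S: "C (Suc i) = zero_locus N S" using closedin_zariski[OF assms(1)] by metis
    have C: "C j \<subseteq> proj_space N" for j using closedin_subset[OF assms(1)] by simp
    then obtain F v where F: "F \<in> S" "v \<in> p" "peval F v \<noteq> 0" using p S by (auto simp: zero_locus_def)
    obtain h where h: "h \<in> ?R" "\<forall>v\<in>hvecs N. peval F v = h v" using peval_poly_funs by blast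
    have "v \<in> hvecs N" using proj_space_hpoint[of v p N] C p F by blast
    moreover have "h w = 0" if "w \<in> q" "q \<in> C (Suc i)" for w q
      using that S F h proj_space_hpoint[of w q N] by (fastforce simp: zero_locus_def)
    ultimately show ?thesis using h F p by (intro exI[of _ h] exI[of _ v]) auto
  qed
  then obtain h v where hv: "\<And>i. h i \<in> ?R" "\<And>i. v i \<in> \<Union>(C i)" "\<And>i. h i (v i) \<noteq> 0"
    "\<And>i w. w \<in> \<Union>(C (Suc i)) \<Longrightarrow> h i w = 0" by metis
  obtain m where m: "h m \<in> ideal_span ?R (h ` {..<m})"
    using noetherian_poly_funs[of "Suc N"] hv(1) unfolding noetherian_in_def by blast
  have mono: "C j \<subseteq> C i" if "i \<le> j" for i j
    using lift_Suc_antimono_le[of C, OF _ that] assms(2) by blast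
  have "x (v m) = 0" if "x \<in> ideal_span ?R (h ` {..<m})" for x
    using that
  proof induction
    case (step r s y)
    then obtain i where i: "i < m" "s = h i" by blast
    have "v m \<in> \<Union>(C (Suc i))" using mono[of "Suc i" m] i(1) hv(2)[of m] by auto
    then show ?case using hv(4) i step by simp
  qed simp
  then show False using m hv(3) by blast
qed

text \<open>The point with coordinates v is cut out by the 2 x 2 minors
  \<open>v j * w i - v i * w j\<close>.\<close>

lemma closedin_zariski_point:
  fixes p :: "'k::field proj_point"
  assumes "p \<in> proj_space N"
  shows "closedin (zariski N) {p}"
proof -
  obtain v where v: "v \<in> p" "v \<in> hvecs N" "hpoint v = p" using proj_space_obtain[OF assms] .
  define X where "X i = (Poly_Mapping.single (i::nat) (1::nat))" for i
  define F :: "nat \<Rightarrow> nat \<Rightarrow> 'k mpoly"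
    where "F i j = Poly_Mapping.single (X i) (v j) + Poly_Mapping.single (X j) (- v i)" for i j
  have X: "mono_val w (X i) = w i" "mono_deg (X i) = 1" for w :: "nat \<Rightarrow> 'k" and i
    by (simp_all add: X_def mono_val_def mono_deg_def)
  have F: "peval (F i j) w = v j * w i - v i * w j" for i j w
    by (simp add: F_def peval_add peval_single X)
  have hom: "homog 1 (F i j)" for i j
    unfolding homog_def
  proof
    have "Poly_Mapping.keys (F i j) \<subseteq> {X i, X j}"
      unfolding F_def by (rule order_trans[OF Poly_Mapping.keys_add]) simp
    moreover fix m assume "m \<in> Poly_Mapping.keys (F i j)"
    ultimately have "m \<in> {X i, X j}" by blast
    then show "mono_deg m = 1" using X by auto
  qed
  have "{p} = zero_locus N {F i j | i j. True}" (is "_ = ?Z")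
  proof (intro equalityI subsetI)
    fix q assume "q \<in> {p}"
    moreover have "peval (F i j) w = 0" if w: "w \<in> p" for i j w
    proof -
      obtain c where "w = (\<lambda>i. c * v i)" using w unfolding v(3)[symmetric] hpoint_def by blast
      then show ?thesis by (simp add: F)
    qed
    ultimately show "q \<in> ?Z" using assms unfolding zero_locus_def by blast
  next
    fix q assume "q \<in> ?Z"
    then have q: "q \<in> proj_space N" "\<And>i j w. w \<in> q \<Longrightarrow> peval (F i j) w = 0"
      unfolding zero_locus_def by blast+
    obtain w where w: "w \<in> q" "w \<in> hvecs N" "hpoint w = q" using proj_space_obtain[OF q(1)] .
    obtain k where k: "w k \<noteq> 0" using w(2) by (auto simp: hvecs_def)
    have eq: "v j * w i = v i * w j" for i j using q(2)[OF w(1), of i j] by (simp add: F)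
    have vk: "v k \<noteq> 0"
    proof
      assume "v k = 0"
      then have "v j = 0" for j using eq[of j k] k by simp
      then show False using v(2) by (auto simp: hvecs_def)
    qed
    have "w = (\<lambda>i. w k / v k * v i)"
    proof
      fix i
      show "w i = w k / v k * v i" using eq[of k i] vk by (simp add: field_simps)
    qed
    then have "hpoint w = hpoint v" using hpoint_scale[of "w k / v k" v] k vk by simp
    then show "q \<in> {p}" using v(3) w(3) by simp
  qed
  moreover have "\<forall>G\<in>{F i j | i j. True}. \<exists>d. homog d G" using hom by auto
  then have "openin (zariski N) (proj_space N - ?Z)"
    unfolding openin_zariski by (intro exI[of _ "{F i j | i j. True}"] conjI refl)
  ultimately have "openin (zariski N) (proj_space N - {p})" by simp
  then show ?thesis using assms unfolding closedin_def by simp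
qed

lemma closedin_zariski_finite:
  "finite A \<Longrightarrow> A \<subseteq> proj_space N \<Longrightarrow> closedin (zariski N) A"
  using closedin_Union[of "(\<lambda>p. {p}) ` A" "zariski N"] closedin_zariski_point by fastforce

section \<open>Dimension one: finiteness of proper closed subsets\<close>

lemma krull_dim_chain:
  assumes "krull_dim T \<le> enat d" "\<And>i. i \<le> n \<Longrightarrow> closedin T (Z i) \<and> irreducible_set T (Z i)"
    "\<And>i. i < n \<Longrightarrow> Z i \<subset> Z (Suc i)"
  shows "n \<le> d"
proof -
  have "enat n \<le> krull_dim T"
    unfolding krull_dim_def using assms(2,3) by (intro Sup_upper) blast
  then have "enat n \<le> enat d" using assms(1) by (rule order_trans)
  then show ?thesis by simp
qed

text \<open>A minimal infinite proper closed subset would be irreducible, giving a chain of length 2.\<close>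

lemma curve_closed_finite:
  fixes X :: "'k::field proj_point set"
  assumes X: "closedin (zariski N) X" "irreducible_set (zariski N) X"
    and dim: "krull_dim (zariski_on N X) = 1"
    and C: "closedin (zariski N) C" "C \<subset> X"
  shows "finite C"
proof (rule ccontr)
  assume inf: "infinite C"
  let ?Q = "\<lambda>C. closedin (zariski N) C \<and> C \<subset> X \<and> infinite C"
  have "\<exists>Y. ?Q Y \<and> (\<forall>Y'. ?Q Y' \<longrightarrow> \<not> Y' \<subset> Y)"
  proof (rule ccontr)
    assume *: "\<not> ?thesis"
    have "\<exists>Y'. ?Q Y \<longrightarrow> ?Q Y' \<and> Y' \<subset> Y" for Y
      using not_ex[THEN iffD1, OF *, THEN spec, of Y] by metis
    then obtain s where s: "\<And>Y. ?Q Y \<longrightarrow> ?Q (s Y) \<and> s Y \<subset> Y"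
      using choice[of "\<lambda>Y Y'. ?Q Y \<longrightarrow> ?Q Y' \<and> Y' \<subset> Y"] by blast
    \<comment> \<open>Without a minimal member, repeated shrinking gives an infinite strictly
      descending chain.\<close>
    define D where "D = rec_nat C (\<lambda>_. s)"
    have D: "D 0 = C" "\<And>i. D (Suc i) = s (D i)" by (simp_all add: D_def)
    have "?Q (D i)" for i
    proof (induction i)
      case 0
      show ?case unfolding D(1) using C inf by blast
    next
      case (Suc i)
      show ?case unfolding D(2) using s[THEN mp, OF Suc] by (rule conjunct1)
    qed note Q = this
    have "D (Suc i) \<subset> D i" for i
      unfolding D(2) using s[THEN mp, OF Q] by (rule conjunct2)
    then show False using zariski_dcc[of N D] Q by blast
  qed
  then obtain Y where Y: "closedin (zariski N) Y" "Y \<subset> X" "infinite Y"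
    and minY: "\<And>Y'. ?Q Y' \<Longrightarrow> \<not> Y' \<subset> Y" by blast
  let ?T = "zariski_on N X"
  have top: "topspace ?T = X" using closedin_subset[OF X(1)] by auto
  have cl: "closedin ?T A \<longleftrightarrow> closedin (zariski N) A \<and> A \<subseteq> X" for A
    using closedin_closed_subtopology[OF X(1)] by blast
  obtain y where y: "y \<in> Y" using infinite_imp_nonempty[OF Y(3)] by blast
  have yP: "y \<in> proj_space N" using y closedin_subset[OF Y(1)] by auto
  have irrY: "irreducible_set ?T Y"
    unfolding irreducible_set_def top cl
  proof (intro conjI allI impI)
    fix A B assume AB: "(closedin (zariski N) A \<and> A \<subseteq> X) \<and> (closedin (zariski N) B \<and> B \<subseteq> X) \<and> Y \<subseteq> A \<union> B"
    show "Y \<subseteq> A \<or> Y \<subseteq> B"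
    proof (rule ccontr)
      assume "\<not> ?thesis"
      then have *: "Y \<inter> A \<subset> Y" "Y \<inter> B \<subset> Y" by auto
      have "finite (Y \<inter> A)" "finite (Y \<inter> B)"
        using minY[of "Y \<inter> A"] minY[of "Y \<inter> B"] * AB Y(1,2) by (auto intro: closedin_Int)
      moreover have "Y = (Y \<inter> A) \<union> (Y \<inter> B)" using AB by blast
      ultimately show False using Y(3) by (metis finite_Un)
    qed
  qed (use Y y in auto)
  have irrX: "irreducible_set ?T X"
    using X(2) unfolding irreducible_set_def top cl by auto
  have irry: "irreducible_set ?T {y}"
    using y Y(2) unfolding irreducible_set_def top by auto
  define Z where "Z i = (if i = 0 then {y} else if i = 1 then Y else X)" for i :: nat
  have "2 \<le> (1::nat)"
  proof (rule krull_dim_chain[of ?T 1 2 Z])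
    show "krull_dim ?T \<le> enat 1" using dim by (simp add: one_enat_def)
    show "closedin ?T (Z i) \<and> irreducible_set ?T (Z i)" for i
      using irrX irrY irry Y(1,2) X(1) y closedin_zariski_point[OF yP] by (auto simp: Z_def cl)
    show "Z i \<subset> Z (Suc i)" if "i < 2" for i
    proof -
      have "{y} \<noteq> Y" using Y(3) by auto
      then show ?thesis using that y Y(2) by (auto simp: Z_def less_2_cases_iff)
    qed
  qed
  then show False by simp
qed

text \<open>Later applied to the nonvanishing locus of a section, so that the bad points can be
  removed from a member of a cover without losing openness.\<close>

lemma curve_openin_cofinite:
  fixes X :: "'k::field proj_point set"
  assumes X: "closedin (zariski N) X" "irreducible_set (zariski N) X"
    and dim: "krull_dim (zariski_on N X) = 1"
    and U: "openin (zariski_on N X) U" "U \<noteq> {}"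
  shows "finite (X - U)"
proof -
  have top: "topspace (zariski_on N X) = X" using closedin_subset[OF X(1)] by auto
  have "closedin (zariski_on N X) (X - U)" "U \<subseteq> X"
    using closedin_diff[OF closedin_topspace U(1)] openin_subset[OF U(1)] unfolding top by blast+
  then show ?thesis
    using closedin_closed_subtopology[OF X(1), of "X - U"] U(2)
    by (intro curve_closed_finite[OF X dim]) blast+
qed

lemma irreducible_openin_Int:
  assumes X: "closedin (zariski N) X" "irreducible_set (zariski N) X"
    and U: "openin (zariski_on N X) U" "U \<noteq> {}" and V: "openin (zariski_on N X) V" "V \<noteq> {}"
  shows "U \<inter> V \<noteq> {}"
proof
  assume *: "U \<inter> V = {}"
  have top: "topspace (zariski_on N X) = X" using closedin_subset[OF X(1)] by auto
  have "closedin (zariski_on N X) (X - U)" "closedin (zariski_on N X) (X - V)"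
    using closedin_diff[OF closedin_topspace U(1)] closedin_diff[OF closedin_topspace V(1)]
    unfolding top by blast+
  then have "closedin (zariski N) (X - U)" "closedin (zariski N) (X - V)"
    using closedin_closed_subtopology[OF X(1)] by auto
  moreover have "X \<subseteq> (X - U) \<union> (X - V)" using * by blast
  ultimately have "X \<subseteq> X - U \<or> X \<subseteq> X - V" using X(2) unfolding irreducible_set_def by blast
  moreover have "U \<subseteq> X" "V \<subseteq> X" using openin_subset[OF U(1)] openin_subset[OF V(1)] top by auto
  ultimately show False using U(2) V(2) by blast
qed

section \<open>The ring of regular functions\<close>

text \<open>Members of \<open>regular_functions\<close> take the value \<open>undefined\<close> off
  V. Here the values off V are arbitrary, so that one expression can be regular on several open
  sets.\<close>

definition regular_on :: "'k::field proj_point topology \<Rightarrow> 'k proj_point set \<Rightarrow> ('k proj_point \<Rightarrow> 'k) \<Rightarrow> bool" where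
  "regular_on T V h \<longleftrightarrow> restrict h V \<in> regular_functions T V"

lemma local_quotientI:
  assumes "openin T W" "p \<in> W" "W \<subseteq> V" "homog d F" "homog d G"
    "\<And>q v. q \<in> W \<Longrightarrow> v \<in> q \<Longrightarrow> peval G v \<noteq> 0 \<and> h q = peval F v / peval G v"
  shows "\<exists>W F G d. openin T W \<and> p \<in> W \<and> W \<subseteq> V \<and> homog d F \<and> homog d G \<and>
     (\<forall>q\<in>W. \<forall>v\<in>q. peval G v \<noteq> 0 \<and> h q = peval F v / peval G v)"
  using assms by blast

lemma regular_onI:
  assumes "\<And>p. p \<in> V \<Longrightarrow> \<exists>W F G d. openin T W \<and> p \<in> W \<and> W \<subseteq> V \<and> homog d F \<and> homog d G \<and>
     (\<forall>q\<in>W. \<forall>v\<in>q. peval G v \<noteq> 0 \<and> h q = peval F v / peval G v)"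
  shows "regular_on T V h"
  unfolding regular_on_def regular_functions_def
proof (intro CollectI conjI ballI)
  fix p assume "p \<in> V"
  from assms[OF this] obtain W F G d where *: "openin T W" "p \<in> W" "W \<subseteq> V" "homog d F" "homog d G"
    "\<forall>q\<in>W. \<forall>v\<in>q. peval G v \<noteq> 0 \<and> h q = peval F v / peval G v" by blast
  then have "\<forall>q\<in>W. \<forall>v\<in>q. peval G v \<noteq> 0 \<and> restrict h V q = peval F v / peval G v"
    using subsetD[OF *(3)] by simp
  with * show "\<exists>W F G d. openin T W \<and> p \<in> W \<and> W \<subseteq> V \<and> homog d F \<and> homog d G \<and>
     (\<forall>q\<in>W. \<forall>v\<in>q. peval G v \<noteq> 0 \<and> restrict h V q = peval F v / peval G v)" by blast
qed simp

lemma regular_onE: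
  assumes "regular_on T V h" "p \<in> V"
  obtains W F G d where "openin T W" "p \<in> W" "W \<subseteq> V" "homog d F" "homog d G"
    "\<And>q v. q \<in> W \<Longrightarrow> v \<in> q \<Longrightarrow> peval G v \<noteq> 0"
    "\<And>q v. q \<in> W \<Longrightarrow> v \<in> q \<Longrightarrow> h q = peval F v / peval G v"
proof -
  from assms obtain W F G d where *: "openin T W" "p \<in> W" "W \<subseteq> V" "homog d F" "homog d G"
    "\<forall>q\<in>W. \<forall>v\<in>q. peval G v \<noteq> 0 \<and> restrict h V q = peval F v / peval G v"
    unfolding regular_on_def regular_functions_def by blast
  show thesis
    by (rule that[OF *(1-5)]) (use *(6) subsetD[OF *(3)] in fastforce)+
qed

lemma regular_on_iff: "h \<in> regular_functions T V \<Longrightarrow> regular_on T V h"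
  unfolding regular_on_def
proof -
  assume h: "h \<in> regular_functions T V"
  then have "restrict h V = h" by (simp add: regular_functions_def extensional_restrict)
  then show "restrict h V \<in> regular_functions T V" using h by simp
qed

lemma regular_on_cong:
  assumes "regular_on T V h" "\<And>z. z \<in> V \<Longrightarrow> h z = h' z"
  shows "regular_on T V h'"
proof -
  have "restrict h V = restrict h' V" using assms(2) by (auto simp: restrict_def)
  then show ?thesis using assms(1) by (simp add: regular_on_def)
qed

lemma regular_on_subset:
  assumes "regular_on T V h" "openin T W" "W \<subseteq> V"
  shows "regular_on T W h"
proof (rule regular_onI)
  fix p assume p: "p \<in> W"
  then have "p \<in> V" using assms(3) by blast
  obtain W' F G d where "openin T W'" "p \<in> W'" "homog d F" "homog d G"
    "\<And>q v. q \<in> W' \<Longrightarrow> v \<in> q \<Longrightarrow> peval G v \<noteq> 0"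
    "\<And>q v. q \<in> W' \<Longrightarrow> v \<in> q \<Longrightarrow> h q = peval F v / peval G v"
    using regular_onE[OF assms(1) \<open>p \<in> V\<close>] by metis
  then show "\<exists>W' F G d. openin T W' \<and> p \<in> W' \<and> W' \<subseteq> W \<and> homog d F \<and> homog d G \<and>
     (\<forall>q\<in>W'. \<forall>v\<in>q. peval G v \<noteq> 0 \<and> h q = peval F v / peval G v)"
    using p assms(2) by (intro local_quotientI[where W = "W' \<inter> W" and F = F and G = G and d = d])
      auto
qed

lemma homog_single: "mono_deg m = d \<Longrightarrow> homog d (Poly_Mapping.single m c)"
  by (simp add: homog_def)

lemma homog_add: "homog d F \<Longrightarrow> homog d G \<Longrightarrow> homog d (F + G)"
  using Poly_Mapping.keys_add[of F G] unfolding homog_def by blast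

lemma peval_const: "peval (Poly_Mapping.single 0 c) v = c"
  by (simp add: peval_single mono_val_def)

lemma homog_const: "homog 0 (Poly_Mapping.single 0 c)"
  by (simp add: homog_single mono_deg_def)

lemma peval_one: "peval 1 v = 1"
  using peval_const[of 1 v] by simp

lemma homog_one: "homog 0 1"
  using homog_const[of 1] by simp

lemma regular_on_const:
  assumes "openin T V"
  shows "regular_on T V (\<lambda>_. c)"
proof (rule regular_onI)
  fix p assume "p \<in> V"
  then show "\<exists>W F G d. openin T W \<and> p \<in> W \<and> W \<subseteq> V \<and> homog d F \<and> homog d G \<and>
     (\<forall>q\<in>W. \<forall>v\<in>q. peval G v \<noteq> 0 \<and> c = peval F v / peval G v)"
    using assms
    by (intro local_quotientI[where W = V and F = "Poly_Mapping.single 0 c" and G = "Poly_Mapping.single 0 1" and d = 0])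
      (simp_all add: peval_const homog_const peval_one homog_one)
qed

lemma regular_on_add:
  assumes "regular_on T V h" "regular_on T V h'"
  shows "regular_on T V (\<lambda>z. h z + h' z)"
proof (rule regular_onI)
  fix p assume p: "p \<in> V"
  obtain W F G d where W: "openin T W" "p \<in> W" "W \<subseteq> V" "homog d F" "homog d G"
    "\<And>q v. q \<in> W \<Longrightarrow> v \<in> q \<Longrightarrow> peval G v \<noteq> 0"
    "\<And>q v. q \<in> W \<Longrightarrow> v \<in> q \<Longrightarrow> h q = peval F v / peval G v"
    using regular_onE[OF assms(1) p] by metis
  obtain W' F' G' d' where W': "openin T W'" "p \<in> W'" "W' \<subseteq> V" "homog d' F'" "homog d' G'"
    "\<And>q v. q \<in> W' \<Longrightarrow> v \<in> q \<Longrightarrow> peval G' v \<noteq> 0"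
    "\<And>q v. q \<in> W' \<Longrightarrow> v \<in> q \<Longrightarrow> h' q = peval F' v / peval G' v"
    using regular_onE[OF assms(2) p] by metis
  have "homog (d + d') (F * G' + G * F')" "homog (d + d') (G * G')"
    using W W' by (auto intro: homog_add homog_mult)
  moreover have "peval (G * G') v \<noteq> 0 \<and> h q + h' q = peval (F * G' + G * F') v / peval (G * G') v"
    if "q \<in> W \<inter> W'" "v \<in> q" for q v
    using W(6)[of q v] W(7)[of q v] W'(6)[of q v] W'(7)[of q v] that by (simp add: peval_mult peval_add add_frac_eq mult.commute)
  ultimately show "\<exists>W F G d. openin T W \<and> p \<in> W \<and> W \<subseteq> V \<and> homog d F \<and> homog d G \<and>
     (\<forall>q\<in>W. \<forall>v\<in>q. peval G v \<noteq> 0 \<and> h q + h' q = peval F v / peval G v)"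
    using W(1-3) W'(1-3)
    by (intro local_quotientI[where W = "W \<inter> W'" and F = "F * G' + G * F'" and G = "G * G'" and d = "d + d'"])
      auto
qed

lemma regular_on_mult:
  assumes "regular_on T V h" "regular_on T V h'"
  shows "regular_on T V (\<lambda>z. h z * h' z)"
proof (rule regular_onI)
  fix p assume p: "p \<in> V"
  obtain W F G d where W: "openin T W" "p \<in> W" "W \<subseteq> V" "homog d F" "homog d G"
    "\<And>q v. q \<in> W \<Longrightarrow> v \<in> q \<Longrightarrow> peval G v \<noteq> 0"
    "\<And>q v. q \<in> W \<Longrightarrow> v \<in> q \<Longrightarrow> h q = peval F v / peval G v"
    using regular_onE[OF assms(1) p] by metis
  obtain W' F' G' d' where W': "openin T W'" "p \<in> W'" "W' \<subseteq> V" "homog d' F'" "homog d' G'"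
    "\<And>q v. q \<in> W' \<Longrightarrow> v \<in> q \<Longrightarrow> peval G' v \<noteq> 0"
    "\<And>q v. q \<in> W' \<Longrightarrow> v \<in> q \<Longrightarrow> h' q = peval F' v / peval G' v"
    using regular_onE[OF assms(2) p] by metis
  have "homog (d + d') (F * F')" "homog (d + d') (G * G')"
    using W W' by (auto intro: homog_mult)
  moreover have "peval (G * G') v \<noteq> 0 \<and> h q * h' q = peval (F * F') v / peval (G * G') v"
    if "q \<in> W \<inter> W'" "v \<in> q" for q v
    using W(6)[of q v] W(7)[of q v] W'(6)[of q v] W'(7)[of q v] that by (simp add: peval_mult)
  ultimately show "\<exists>W F G d. openin T W \<and> p \<in> W \<and> W \<subseteq> V \<and> homog d F \<and> homog d G \<and>
     (\<forall>q\<in>W. \<forall>v\<in>q. peval G v \<noteq> 0 \<and> h q * h' q = peval F v / peval G v)"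
    using W(1-3) W'(1-3)
    by (intro local_quotientI[where W = "W \<inter> W'" and F = "F * F'" and G = "G * G'" and d = "d + d'"])
      auto
qed

lemma regular_on_cmult: "openin T V \<Longrightarrow> regular_on T V h \<Longrightarrow> regular_on T V (\<lambda>z. c * h z)"
  by (rule regular_on_mult[OF regular_on_const])

lemma regular_on_diff:
  assumes "openin T V" "regular_on T V h" "regular_on T V h'"
  shows "regular_on T V (\<lambda>z. h z - h' z)"
  using regular_on_add[OF assms(2) regular_on_cmult[OF assms(1,3), of "-1"]] by simp

lemma regular_on_sum:
  assumes "openin T V" "\<And>i. i \<in> I \<Longrightarrow> regular_on T V (h i)"
  shows "regular_on T V (\<lambda>z. \<Sum>i\<in>I. h i z)"
  using assms(2)
proof (induction I rule: infinite_finite_induct)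
  case (insert i I)
  have "regular_on T V (\<lambda>z. h i z + (\<Sum>i\<in>I. h i z))"
    by (rule regular_on_add) (use insert in auto)
  then show ?case using insert(1,2) by simp
qed (use regular_on_const[OF assms(1), of 0] in simp_all)

lemma regular_on_power:
  assumes "openin T V" "regular_on T V h"
  shows "regular_on T V (\<lambda>z. h z ^ d)"
proof (induction d)
  case (Suc d)
  show ?case unfolding power_Suc by (rule regular_on_mult[OF assms(2) Suc])
qed (use regular_on_const[OF assms(1), of 1] in simp)

lemma regular_on_poly:
  assumes "openin T V" "regular_on T V h"
  shows "regular_on T V (\<lambda>z. poly p (h z))"
  unfolding poly_altdef
  by (intro regular_on_sum regular_on_cmult regular_on_power assms)

lemma openin_zariski_on_nonvanishing:
  assumes "homog d F"
  shows "openin (zariski_on N X) {q \<in> topspace (zariski_on N X). \<forall>v\<in>q. peval F v \<noteq> 0}"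
proof -
  have eq: "{q \<in> topspace (zariski_on N X). \<forall>v\<in>q. peval F v \<noteq> 0} =
      {q \<in> proj_space N. \<forall>v\<in>q. peval F v \<noteq> 0} \<inter> X" by auto
  show ?thesis unfolding eq by (rule openin_subtopology_Int[OF openin_nonvanishing[OF assms]])
qed

lemma regular_on_inverse:
  assumes "regular_on (zariski_on N X) V h" "\<And>z. z \<in> V \<Longrightarrow> h z \<noteq> 0"
  shows "regular_on (zariski_on N X) V (\<lambda>z. inverse (h z))"
proof (rule regular_onI)
  let ?T = "zariski_on N X"
  fix p assume p: "p \<in> V"
  obtain W F G d where W: "openin ?T W" "p \<in> W" "W \<subseteq> V" "homog d F" "homog d G"
    "\<And>q v. q \<in> W \<Longrightarrow> v \<in> q \<Longrightarrow> peval G v \<noteq> 0"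
    "\<And>q v. q \<in> W \<Longrightarrow> v \<in> q \<Longrightarrow> h q = peval F v / peval G v"
    using regular_onE[OF assms(1) p] by metis
  have "peval F v \<noteq> 0 \<and> inverse (h q) = peval G v / peval F v" if q: "q \<in> W" "v \<in> q" for q v
  proof -
    have "h q \<noteq> 0" using assms(2) q(1) W(3) by blast
    then show ?thesis using W(7)[OF q] W(6)[OF q] by auto
  qed
  then show "\<exists>W F G d. openin ?T W \<and> p \<in> W \<and> W \<subseteq> V \<and> homog d F \<and> homog d G \<and>
     (\<forall>q\<in>W. \<forall>v\<in>q. peval G v \<noteq> 0 \<and> inverse (h q) = peval F v / peval G v)"
    using W(1-5) by blast
qed

lemma regular_on_powi:
  assumes "openin (zariski_on N X) V" "regular_on (zariski_on N X) V h" "\<And>z. z \<in> V \<Longrightarrow> h z \<noteq> 0"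
  shows "regular_on (zariski_on N X) V (\<lambda>z. h z powi i)"
  unfolding power_int_def
  by (cases "i \<ge> 0") (simp_all add: regular_on_power regular_on_inverse assms)

text \<open>Locally the function is F / G, and it vanishes exactly where the form F does.\<close>

lemma regular_on_nonzero_open:
  assumes "regular_on (zariski_on N X) V h"
  shows "openin (zariski_on N X) {z \<in> V. h z \<noteq> 0}"
proof (subst openin_subopen, intro ballI)
  let ?T = "zariski_on N X"
  fix p assume p: "p \<in> {z \<in> V. h z \<noteq> 0}"
  then have pV: "p \<in> V" by blast
  obtain W F G d where W: "openin ?T W" "p \<in> W" "W \<subseteq> V" "homog d F" "homog d G"
    "\<And>q v. q \<in> W \<Longrightarrow> v \<in> q \<Longrightarrow> peval G v \<noteq> 0"
    "\<And>q v. q \<in> W \<Longrightarrow> v \<in> q \<Longrightarrow> h q = peval F v / peval G v"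
    using regular_onE[OF assms(1) pV] by metis
  let ?O = "W \<inter> {q \<in> topspace ?T. \<forall>v\<in>q. peval F v \<noteq> 0}"
  have WT: "W \<subseteq> topspace ?T" by (rule openin_subset[OF W(1)])
  have "openin ?T ?O" by (rule openin_Int[OF W(1) openin_zariski_on_nonvanishing[OF W(4)]])
  moreover have "p \<in> ?O" using W(2,7) WT p by force
  moreover have "?O \<subseteq> {z \<in> V. h z \<noteq> 0}"
  proof
    fix q assume q: "q \<in> ?O"
    then have "q \<in> proj_space N" by auto
    then obtain v where "v \<in> q" using proj_space_obtain by blast
    then show "q \<in> {z \<in> V. h z \<noteq> 0}" using q W(3,6,7) by auto
  qed
  ultimately show "\<exists>O'. openin ?T O' \<and> p \<in> O' \<and> O' \<subseteq> {z \<in> V. h z \<noteq> 0}" by blast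
qed

section \<open>The projective line\<close>

definition std_open :: "nat \<Rightarrow> 'k::field proj_point set" where
  "std_open i = {q \<in> proj_space 1. \<forall>v\<in>q. v i \<noteq> 0}"

text \<open>The normalized coordinate vector of the point with affine coordinate w in the chart
  \<open>std_open i\<close>. For i \<le> 1 the truncated difference 1 - i is the other
  index.\<close>

definition affine_vec :: "nat \<Rightarrow> 'k::field \<Rightarrow> nat \<Rightarrow> 'k" where
  "affine_vec i w k = (if k = i then 1 else if k = 1 - i then w else 0)"

definition mono2 :: "nat \<Rightarrow> nat \<Rightarrow> 'k::field mpoly" where
  "mono2 b c = Poly_Mapping.single (Poly_Mapping.single 0 b + Poly_Mapping.single 1 c) 1"

lemma peval_mono2: "peval (mono2 b c) v = v 0 ^ b * v 1 ^ c"
proof -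
  have "mono_val v (Poly_Mapping.single i d) = v i ^ d" for i d and v :: "nat \<Rightarrow> 'a"
    by (simp add: mono_val_def)
  then show ?thesis by (simp add: mono2_def peval_single mono_val_add)
qed

lemma homog_mono2: "homog (b + c) (mono2 b c)"
proof -
  have "mono_deg (Poly_Mapping.single i d) = d" for i d
    by (simp add: mono_deg_def)
  then show ?thesis by (simp add: mono2_def homog_single mono_deg_add)
qed

lemma openin_std_open:
  assumes "i \<le> 1"
  shows "openin (zariski 1) (std_open i :: 'k::field proj_point set)"
proof -
  have "i = 0 \<or> i = 1" using assms by auto
  then obtain b c where bc: "b + c = 1" "\<And>v::nat \<Rightarrow> 'k. v i = v 0 ^ b * v 1 ^ c"
  proof
    assume "i = 0"
    then show thesis using that[of 1 0] by simp
  next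
    assume "i = 1"
    then show thesis using that[of 0 1] by simp
  qed
  have "std_open i = {q \<in> proj_space 1. \<forall>v\<in>q. peval (mono2 b c :: 'k mpoly) v \<noteq> 0}"
    unfolding std_open_def by (simp only: peval_mono2 bc(2)[symmetric])
  then show ?thesis using openin_nonvanishing[OF homog_mono2, of 1 b c] by simp
qed

lemma affine_vec_hvecs: "i \<le> 1 \<Longrightarrow> affine_vec i w \<in> hvecs 1"
  by (auto simp: hvecs_def affine_vec_def intro!: exI[of _ i])

lemma affine_vec_std_open: "i \<le> 1 \<Longrightarrow> hpoint (affine_vec i w) \<in> std_open i"
  using affine_vec_hvecs[of i w]
  by (auto simp: std_open_def proj_space_def) (auto simp: hpoint_def affine_vec_def)

lemma std_open_affine:
  assumes "q \<in> std_open i" "v \<in> q" "i \<le> 1"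
  shows "q = hpoint (affine_vec i (v (1 - i) / v i))" "v = (\<lambda>k. v i * affine_vec i (v (1 - i) / v i) k)"
    "v i \<noteq> 0"
proof -
  have q: "q \<in> proj_space 1" and vi: "v i \<noteq> 0" using assms by (auto simp: std_open_def)
  then have v: "hpoint v = q" "v \<in> hvecs 1" using proj_space_hpoint assms(2) by blast+
  show *: "v = (\<lambda>k. v i * affine_vec i (v (1 - i) / v i) k)"
  proof
    fix k
    show "v k = v i * affine_vec i (v (1 - i) / v i) k"
    proof (cases "k \<le> 1")
      case True
      then have "k = i \<or> k = 1 - i" using assms(3) by linarith
      then show ?thesis using vi by (auto simp: affine_vec_def)
    next
      case False
      then show ?thesis using v(2) assms(3) by (auto simp: affine_vec_def hvecs_def)
    qed
  qed
  show "q = hpoint (affine_vec i (v (1 - i) / v i))"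
    using hpoint_scale[OF vi, of "affine_vec i (v (1 - i) / v i)"] * v(1) by simp
  show "v i \<noteq> 0" by (rule vi)
qed

lemma Union_std_open_iff:
  "V \<subseteq> proj_space N \<Longrightarrow> v \<in> \<Union>V \<longleftrightarrow> hpoint v \<in> V \<and> v \<in> hvecs N"
  using proj_space_hpoint[of v _ N] hpoint_self by blast

lemma peval_affine_vec:
  fixes F :: "'k::field mpoly"
  shows "\<exists>P. \<forall>w. peval F (affine_vec i w) = poly P w"
proof -
  let ?Q = "\<lambda>e :: 'k \<Rightarrow> 'k. \<exists>P. \<forall>w. e w = poly P w"
  have const: "?Q (\<lambda>_. c)" for c by (rule exI[of _ "[:c:]"]) simp
  have mult: "?Q (\<lambda>w. e w * e' w)" if "?Q e" "?Q e'" for e e' :: "'k \<Rightarrow> 'k"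
    using that by (metis poly_mult)
  have add: "?Q (\<lambda>w. e w + e' w)" if "?Q e" "?Q e'" for e e' :: "'k \<Rightarrow> 'k"
    using that by (metis poly_add)
  have coord: "?Q (\<lambda>w. affine_vec i w k)" for k
    by (rule exI[of _ "if k = i then 1 else if k = 1 - i then [:0, 1:] else 0"]) (simp add: affine_vec_def)
  have power: "?Q (\<lambda>w. e w ^ d)" if "?Q e" for e :: "'k \<Rightarrow> 'k" and d
  proof -
    obtain P where "\<forall>w. e w = poly P w" using \<open>?Q e\<close> ..
    then show ?thesis by (intro exI[of _ "P ^ d"]) (simp add: poly_power)
  qed
  have sum: "?Q (\<lambda>w. \<Sum>m\<in>I. e m w)" if "\<And>m. ?Q (e m)" for I :: "(nat \<Rightarrow>\<^sub>0 nat) set" and e :: "_ \<Rightarrow> 'k \<Rightarrow> 'k"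
  proof (induction I rule: infinite_finite_induct)
    case (insert m I)
    show ?case unfolding sum.insert[OF insert(1,2)] by (rule add[OF that insert(3)])
  qed (use const[of 0] in simp_all)
  have prod: "?Q (\<lambda>w. \<Prod>m\<in>I. e m w)" if "\<And>m. ?Q (e m)" for I :: "nat set" and e :: "_ \<Rightarrow> 'k \<Rightarrow> 'k"
  proof (induction I rule: infinite_finite_induct)
    case (insert m I)
    show ?case unfolding prod.insert[OF insert(1,2)] by (rule mult[OF that insert(3)])
  qed (use const[of 1] in simp_all)
  show ?thesis unfolding peval_def mono_val_def
    by (intro sum mult const prod power coord)
qed

text \<open>Some form vanishing on the complement of W is nonzero at the given point; Q is its
  dehomogenization.\<close>

lemma openin_affine_line:
  assumes "openin (zariski 1) W" "hpoint (affine_vec i w0) \<in> W" "i \<le> 1"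
  obtains Q where "poly Q w0 \<noteq> 0" "\<And>w. poly Q w \<noteq> 0 \<Longrightarrow> hpoint (affine_vec i w) \<in> W"
proof -
  obtain S where S: "\<forall>F\<in>S. \<exists>d. homog d F" "W = proj_space 1 - zero_locus 1 S"
    using assms(1) unfolding openin_zariski by blast
  have proj: "hpoint (affine_vec i w) \<in> proj_space 1" for w
    using affine_vec_hvecs[OF assms(3)] by (auto simp: proj_space_def)
  obtain F v where F: "F \<in> S" "v \<in> hpoint (affine_vec i w0)" "peval F v \<noteq> 0"
    using assms(2) S(2) by (auto simp: zero_locus_def)
  obtain d where d: "homog d F" using S(1) F(1) by blast
  have w0: "peval F (affine_vec i w0) \<noteq> 0"
    using homog_zero_iff[OF proj F(2) hpoint_self d] F(3) by blast
  obtain Q where Q: "\<forall>w. peval F (affine_vec i w) = poly Q w" using peval_affine_vec by blast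
  show thesis
  proof
    show "poly Q w0 \<noteq> 0" using w0 Q by simp
    fix w assume "poly Q w \<noteq> 0"
    then have "peval F (affine_vec i w) \<noteq> 0" using Q by simp
    then show "hpoint (affine_vec i w) \<in> W"
      using S(2) F(1) proj[of w] hpoint_self[of "affine_vec i w"] by (auto simp: zero_locus_def)
  qed
qed

section \<open>Sections of O(m) over a chart of the projective line\<close>

lemma poly_all_zero:
  fixes p :: "'k::alg_closed_field poly"
  assumes "\<And>x. poly p x = 0"
  shows "p = 0"
proof (cases "degree p > 0")
  case True
  \<comment> \<open>A root of p - 1 is a point where p takes the value 1.\<close>
  then have "degree (p - 1) > 0" using degree_add_eq_left[of "- 1" p] by simp
  then obtain x where "poly (p - 1) x = 0" using alg_closed_imp_poly_has_root by blast
  then show ?thesis using assms[of x] by simp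
next
  case False
  then obtain c where "p = [:c:]" by (metis degree_0_id gr0I of_nat_0 degree_eq_zeroE)
  then show ?thesis using assms[of 0] by simp
qed

text \<open>The product q * p vanishes at every point, so it is zero.\<close>

lemma poly_zero_of_zero_off:
  fixes p q :: "'k::alg_closed_field poly"
  assumes "q \<noteq> 0" "\<And>x. poly q x \<noteq> 0 \<Longrightarrow> poly p x = 0"
  shows "p = 0"
proof -
  have "q * p = 0" by (rule poly_all_zero) (use assms(2) in auto)
  then show ?thesis using assms(1) by simp
qed

text \<open>
  A local representation of \<open>h\<close> whose denominator has minimal degree has constant denominator:
  comparing with a local representation near a root of the denominator, one sees that the root is
  also a root of the numerator.
\<close>

lemma locally_rational_imp_poly:
  fixes h :: "'k::alg_closed_field \<Rightarrow> 'k"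
  assumes local: "\<And>w0. \<exists>P G Q. poly Q w0 \<noteq> 0 \<and> (\<forall>w. poly Q w \<noteq> 0 \<longrightarrow> poly G w \<noteq> 0 \<and> h w = poly P w / poly G w)"
  shows "\<exists>p. \<forall>w. h w = poly p w"
proof -
  let ?R = "\<lambda>P G Q. Q \<noteq> 0 \<and> (\<forall>w. poly Q w \<noteq> 0 \<longrightarrow> poly G w \<noteq> 0 \<and> h w = poly P w / poly G w)"
  \<comment> \<open>Both fractions equal h off the zeros of Q * Q', which is enough for a polynomial
    identity.\<close>
  have cross: "P * G' = P' * G" if "?R P G Q" "?R P' G' Q'" for P G Q P' G' Q'
  proof -
    have "P * G' - P' * G = 0"
    proof (rule poly_zero_of_zero_off[of "Q * Q'"])
      show "Q * Q' \<noteq> 0" using that by simp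
      fix w assume "poly (Q * Q') w \<noteq> 0"
      then have "poly G w \<noteq> 0" "poly G' w \<noteq> 0" "poly P w / poly G w = poly P' w / poly G' w"
        using that by auto
      then show "poly (P * G' - P' * G) w = 0" by (simp add: frac_eq_eq)
    qed
    then show ?thesis by simp
  qed
  have ex: "\<exists>P G Q. poly Q w0 \<noteq> 0 \<and> ?R P G Q" for w0
  proof -
    obtain P G Q where "poly Q w0 \<noteq> 0"
      "\<forall>w. poly Q w \<noteq> 0 \<longrightarrow> poly G w \<noteq> 0 \<and> h w = poly P w / poly G w"
      using local[of w0] by blast
    then show ?thesis by (intro exI[of _ P] exI[of _ G] exI[of _ Q]) auto
  qed
  define D where "D n \<longleftrightarrow> (\<exists>P G Q. ?R P G Q \<and> degree G = n)" for n
  obtain P0 G0 Q0 where "?R P0 G0 Q0" using ex by blast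
  then have "D (degree G0)" unfolding D_def by blast
  then have "D (LEAST n. D n)" by (rule LeastI)
  then obtain n where n: "D n" "\<And>m. m < n \<Longrightarrow> \<not> D m" using not_less_Least[of _ D] by blast
  then obtain P G Q where R: "?R P G Q" and deg: "degree G = n" unfolding D_def by blast
  have "degree G = 0"
  proof (rule ccontr)
    assume "degree G \<noteq> 0"
    then obtain r where r: "poly G r = 0" using alg_closed_imp_poly_has_root[of G] by blast
    obtain P' G' Q' where *: "poly Q' r \<noteq> 0" "?R P' G' Q'" using ex[of r] by blast
    have "poly P r * poly G' r = poly P' r * poly G r"
      using arg_cong[OF cross[OF R *(2)], of "\<lambda>p. poly p r"] by simp
    then have "poly P r = 0" using r * by simp
    then obtain P1 G1 where P1: "P = [:- r, 1:] * P1" and G1: "G = [:- r, 1:] * G1"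
      using r by (metis poly_eq_0_iff_dvd dvdE)
    have "G1 \<noteq> 0" using G1 \<open>degree G \<noteq> 0\<close> by auto
    then have "degree G = Suc (degree G1)" unfolding G1 by (subst degree_mult_eq) auto
    \<comment> \<open>Where Q is nonzero, so is G and hence its factor \<open>[:- r, 1:]\<close>;
      the same Q therefore serves the cancelled fraction.\<close>
    moreover have "poly [:- r, 1:] w * poly P1 w / (poly [:- r, 1:] w * poly G1 w) = poly P1 w / poly G1 w"
      if "poly [:- r, 1:] w \<noteq> 0" for w using that by (rule mult_divide_mult_cancel_left)
    then have "?R P1 G1 Q" using R unfolding P1 G1 poly_mult by auto
    then have "D (degree G1)" unfolding D_def by blast
    ultimately show False using n(2)[of "degree G1"] deg by simp
  qed
  then obtain c where c: "G = [:c:]" by (rule degree_eq_zeroE)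
  have "c \<noteq> 0"
  proof
    assume "c = 0"
    then have "poly Q w = 0" for w using R c by auto
    then show False using R poly_all_zero by blast
  qed
  \<comment> \<open>So far the formula is known only off the zeros of Q. At an arbitrary w it
    follows by comparison with a representation that is valid at w.\<close>
  have "h w = poly (smult (inverse c) P) w" for w
  proof -
    obtain P' G' Q' where *: "poly Q' w \<noteq> 0" "?R P' G' Q'" using ex[of w] by blast
    have "poly P w * poly G' w = poly P' w * c"
      using arg_cong[OF cross[OF R *(2)], of "\<lambda>p. poly p w"] c by simp
    moreover have "poly G' w \<noteq> 0" "h w = poly P' w / poly G' w" using * by auto
    ultimately have "poly G' w * poly P w = poly G' w * (c * h w)" "poly G' w \<noteq> 0"
      by (simp_all add: field_simps)
    then have "poly P w = c * h w" by (simp only: mult_cancel_left) blast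
    then show ?thesis using \<open>c \<noteq> 0\<close> by simp
  qed
  then show ?thesis by blast
qed

text \<open>Over the chart, O(m) is generated by the m-th power of the i-th coordinate. On
  normalized vectors the section is locally a rational function of one variable, hence a polynomial;
  homogeneity of degree d - e = m determines it on the rest of the cone.\<close>

lemma twist_sections_std_open:
  fixes s :: "(nat \<Rightarrow> 'k::alg_closed_field) \<Rightarrow> 'k"
  assumes s: "s \<in> twist_sections (zariski 1) m (std_open i)" and i: "i \<le> 1"
  shows "\<exists>p. \<forall>v\<in>\<Union>(std_open i). s v = v i powi m * poly p (v (1 - i) / v i)"
proof -
  let ?U = "std_open i :: 'k proj_point set"
  have local: "\<exists>W F G d e. openin (zariski 1) W \<and> q \<in> W \<and> homog d F \<and> homog e G \<and>
     int d - int e = m \<and> (\<forall>q\<in>W. \<forall>v\<in>q. peval G v \<noteq> 0 \<and> s v = peval F v / peval G v)"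
    if "q \<in> ?U" for q
    using s that unfolding twist_sections_def by blast
  have "\<exists>p. \<forall>w. s (affine_vec i w) = poly p w"
  proof (rule locally_rational_imp_poly)
    fix w0
    obtain W F G d e where W: "openin (zariski 1) W" "hpoint (affine_vec i w0) \<in> W"
      "\<forall>q\<in>W. \<forall>v\<in>q. peval G v \<noteq> 0 \<and> s v = peval F v / peval G v"
      using local[OF affine_vec_std_open[OF i, of w0]] by metis
    obtain Q where Q: "poly Q w0 \<noteq> 0" "\<And>w. poly Q w \<noteq> 0 \<Longrightarrow> hpoint (affine_vec i w) \<in> W"
      using openin_affine_line[OF W(1,2) i] by blast
    obtain P G' where P: "\<forall>w. peval F (affine_vec i w) = poly P w"
      and G': "\<forall>w. peval G (affine_vec i w) = poly G' w" using peval_affine_vec by metis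
    have "poly G' w \<noteq> 0 \<and> s (affine_vec i w) = poly P w / poly G' w" if "poly Q w \<noteq> 0" for w
      using W(3) Q(2)[OF that] hpoint_self[of "affine_vec i w"] P G' by metis
    then show "\<exists>P G Q. poly Q w0 \<noteq> 0 \<and>
        (\<forall>w. poly Q w \<noteq> 0 \<longrightarrow> poly G w \<noteq> 0 \<and> s (affine_vec i w) = poly P w / poly G w)"
      using Q(1) by blast
  qed
  then obtain p where p: "\<And>w. s (affine_vec i w) = poly p w" by blast
  have "s v = v i powi m * poly p (v (1 - i) / v i)" if v: "v \<in> \<Union>?U" for v
  proof -
    obtain q where q: "q \<in> ?U" "v \<in> q" using v by blast
    let ?w = "v (1 - i) / v i"
    note aff = std_open_affine[OF q i]
    obtain W F G d e where W: "q \<in> W" "homog d F" "homog e G" "int d - int e = m"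
      "\<forall>q\<in>W. \<forall>v\<in>q. peval G v \<noteq> 0 \<and> s v = peval F v / peval G v"
      using local[OF q(1)] by metis
    have "affine_vec i ?w \<in> q" using hpoint_self aff(1) by metis
    then have sw: "s (affine_vec i ?w) = peval F (affine_vec i ?w) / peval G (affine_vec i ?w)"
      and sv: "s v = peval F v / peval G v" using W q(2) by blast+
    have "peval F v = v i ^ d * peval F (affine_vec i ?w)" "peval G v = v i ^ e * peval G (affine_vec i ?w)"
      using homog_peval_scale[OF W(2), of "v i" "affine_vec i ?w"]
        homog_peval_scale[OF W(3), of "v i" "affine_vec i ?w"] aff(2) by simp_all
    then have "s v = (v i ^ d / v i ^ e) * s (affine_vec i ?w)" using sv sw by simp
    also have "v i ^ d / v i ^ e = v i powi m"
      unfolding W(4)[symmetric] using aff(3) by (simp add: power_int_diff)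
    finally show ?thesis using p by simp
  qed
  then show ?thesis by blast
qed

lemma local_twist_quotientI:
  assumes "openin T W" "p \<in> W" "W \<subseteq> V" "homog d F" "homog e G" "int d - int e = m"
    "\<And>q v. q \<in> W \<Longrightarrow> v \<in> q \<Longrightarrow> peval G v \<noteq> 0 \<and> s v = peval F v / peval G v"
  shows "\<exists>W F G d e. openin T W \<and> p \<in> W \<and> W \<subseteq> V \<and> homog d F \<and> homog e G \<and>
     int d - int e = m \<and> (\<forall>q\<in>W. \<forall>v\<in>q. peval G v \<noteq> 0 \<and> s v = peval F v / peval G v)"
  using assms by blast

lemma twist_sections_monomial:
  assumes V: "openin (zariski 1) V" and b: "b \<ge> 0 \<or> V \<subseteq> std_open 0" and c: "c \<ge> 0 \<or> V \<subseteq> std_open 1"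
  shows "restrict (\<lambda>v. v 0 powi b * v 1 powi c) (\<Union>V) \<in> twist_sections (zariski 1) (b + c) V"
  unfolding twist_sections_def
proof (intro CollectI conjI ballI)
  fix p assume p: "p \<in> V"
  \<comment> \<open>Nonnegative exponents go into the numerator and negative ones into the
    denominator, which has no zeros because V then lies in the chart of that coordinate.\<close>
  let ?F = "mono2 (nat b) (nat c)" and ?G = "mono2 (nat (- b)) (nat (- c))"
  have "peval ?G v \<noteq> 0 \<and> restrict (\<lambda>v. v 0 powi b * v 1 powi c) (\<Union>V) v = peval ?F v / peval ?G v"
    if q: "q \<in> V" "v \<in> q" for q v
  proof -
    have "b \<ge> 0 \<or> v 0 \<noteq> 0" "c \<ge> 0 \<or> v 1 \<noteq> 0" using b c q by (auto simp: std_open_def)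
    then have "v 0 powi b = v 0 ^ nat b / v 0 ^ nat (- b)" "v 0 ^ nat (- b) \<noteq> 0"
      "v 1 powi c = v 1 ^ nat c / v 1 ^ nat (- c)" "v 1 ^ nat (- c) \<noteq> 0"
      by (auto simp: power_int_def divide_inverse power_inverse)
    moreover have "v \<in> \<Union>V" using q by blast
    ultimately show ?thesis by (simp add: peval_mono2)
  qed
  then show "\<exists>W F G d e. openin (zariski 1) W \<and> p \<in> W \<and> W \<subseteq> V \<and> homog d F \<and> homog e G \<and>
     int d - int e = b + c \<and> (\<forall>q\<in>W. \<forall>v\<in>q. peval G v \<noteq> 0 \<and>
       restrict (\<lambda>v. v 0 powi b * v 1 powi c) (\<Union>V) v = peval F v / peval G v)"
    by (intro local_twist_quotientI[OF V p order_refl homog_mono2 homog_mono2]) auto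
qed simp

lemma twist_sections_cmult:
  assumes s: "s \<in> twist_sections T m V"
  shows "restrict (\<lambda>v. c * s v) (\<Union>V) \<in> twist_sections T m V"
  unfolding twist_sections_def
proof (intro CollectI conjI ballI)
  fix p assume "p \<in> V"
  then obtain W F G d e where W: "openin T W" "p \<in> W" "W \<subseteq> V" "homog d F" "homog e G"
    "int d - int e = m" "\<forall>q\<in>W. \<forall>v\<in>q. peval G v \<noteq> 0 \<and> s v = peval F v / peval G v"
    using s unfolding twist_sections_def by blast
  have "homog d (Poly_Mapping.single 0 c * F)"
    using homog_mult[OF homog_const W(4)] by simp
  moreover have "peval G v \<noteq> 0 \<and> restrict (\<lambda>v. c * s v) (\<Union>V) v =
      peval (Poly_Mapping.single 0 c * F) v / peval G v" if "q \<in> W" "v \<in> q" for q v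
  proof -
    have "v \<in> \<Union>V" using that W(3) by blast
    then show ?thesis using W(7) that by (simp add: peval_mult peval_const)
  qed
  ultimately show "\<exists>W F G d e. openin T W \<and> p \<in> W \<and> W \<subseteq> V \<and> homog d F \<and> homog e G \<and>
     int d - int e = m \<and> (\<forall>q\<in>W. \<forall>v\<in>q. peval G v \<noteq> 0 \<and>
       restrict (\<lambda>v. c * s v) (\<Union>V) v = peval F v / peval G v)"
    by (intro local_twist_quotientI[OF W(1-3) _ W(5,6)])
qed simp

text \<open>Junk outside \<open>std_open 0\<close>, where the denominator vanishes.\<close>

definition affine_coord :: "'k::field proj_point \<Rightarrow> 'k" where
  "affine_coord q = (let v = (SOME v. v \<in> q) in v 1 / v 0)"

lemma affine_coord_eq:
  assumes "q \<in> std_open 0" "v \<in> q"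
  shows "affine_coord q = v 1 / v 0"
proof -
  define w where "w = (SOME v. v \<in> q)"
  have "w \<in> q" unfolding w_def by (rule someI[of _ v]) (rule assms(2))
  then have "hpoint v = q" using proj_space_hpoint assms by (auto simp: std_open_def)
  then obtain c where "c \<noteq> 0" "w = (\<lambda>i. c * v i)" using \<open>w \<in> q\<close> by (auto simp: hpoint_def)
  then show ?thesis by (simp add: affine_coord_def Let_def w_def[symmetric])
qed

lemma regular_on_affine_coord: "regular_on (zariski 1) (std_open 0) affine_coord"
proof (rule regular_onI)
  fix p :: "'a proj_point" assume "p \<in> std_open 0"
  then show "\<exists>W F G d. openin (zariski 1) W \<and> p \<in> W \<and> W \<subseteq> std_open 0 \<and> homog d F \<and> homog d G \<and>
     (\<forall>q\<in>W. \<forall>v\<in>q. peval G v \<noteq> 0 \<and> affine_coord q = peval F v / peval G v)"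
    using openin_std_open[of 0] homog_mono2[of 0 1] homog_mono2[of 1 0]
    by (intro local_quotientI[where W = "std_open 0" and F = "mono2 0 1" and G = "mono2 1 0" and d = 1])
      (auto simp: peval_mono2 affine_coord_eq std_open_def)
qed

lemma affine_coord_nonzero: "q \<in> std_open 0 \<inter> std_open 1 \<Longrightarrow> affine_coord q \<noteq> 0"
proof -
  assume q: "q \<in> std_open 0 \<inter> std_open 1"
  then have "q \<in> proj_space 1" unfolding std_open_def by blast
  then obtain v where "v \<in> q" using proj_space_obtain by blast
  then show ?thesis using q affine_coord_eq[of q v] by (auto simp: std_open_def)
qed

section \<open>Sections of a line bundle as functions\<close>

text \<open>The isomorphism with the structure sheaf appears as an argument, and the operations of
  that sheaf are evaluated to pointwise ones.\<close>

definition trivialization ::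
    "'k::field proj_point topology \<Rightarrow> ('k proj_point, 'k, 'm) mod_sheaf \<Rightarrow> 'k proj_point set \<Rightarrow>
      ('k proj_point set \<Rightarrow> 'm \<Rightarrow> 'k proj_point \<Rightarrow> 'k) \<Rightarrow> bool" where
  "trivialization T L U \<phi> \<longleftrightarrow>
     (\<forall>V. openin T V \<and> V \<subseteq> U \<longrightarrow>
        bij_betw (\<phi> V) (carrier (sections L V)) (regular_functions T V) \<and>
        (\<forall>s\<in>carrier (sections L V). \<forall>t\<in>carrier (sections L V).
           \<phi> V (s \<oplus>\<^bsub>sections L V\<^esub> t) = restrict (\<lambda>z. \<phi> V s z + \<phi> V t z) V) \<and>
        (\<forall>a\<in>regular_functions T V. \<forall>s\<in>carrier (sections L V).
           \<phi> V (a \<odot>\<^bsub>sections L V\<^esub> s) = restrict (\<lambda>z. a z * \<phi> V s z) V)) \<and>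
     (\<forall>V W. openin T V \<and> openin T W \<and> W \<subseteq> V \<and> V \<subseteq> U \<longrightarrow>
        (\<forall>s\<in>carrier (sections L V). \<phi> W (restr L V W s) = restrict (\<phi> V s) W))"

lemma trivialization_exists:
  assumes "sheaf_iso_on T U L (structure_sheaf T)"
  shows "\<exists>\<phi>. trivialization T L U \<phi>"
  using assms
  by (simp add: sheaf_iso_on_def trivialization_def structure_sheaf_def regular_ring_def ring.defs)

lemma trivialization_subset:
  assumes "trivialization T L U \<phi>" "U' \<subseteq> U"
  shows "trivialization T L U' \<phi>"
proof -
  have "(\<forall>V. P V \<and> V \<subseteq> U' \<longrightarrow> A V) \<and> (\<forall>V W. P V \<and> P W \<and> W \<subseteq> V \<and> V \<subseteq> U' \<longrightarrow> B V W)"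
    if "(\<forall>V. P V \<and> V \<subseteq> U \<longrightarrow> A V) \<and> (\<forall>V W. P V \<and> P W \<and> W \<subseteq> V \<and> V \<subseteq> U \<longrightarrow> B V W)"
    for P A :: "'a proj_point set \<Rightarrow> bool" and B
    using that assms(2) by (meson order_trans)
  then show ?thesis using assms(1) unfolding trivialization_def by this
qed

text \<open>\<open>Xo\<close> plays the part of the generic point: sections are recorded by their
  values there in the trivialization \<open>\<phi>\<close>, and irreducibility makes this record
  faithful.\<close>

locale trivialized_line_bundle =
  fixes N :: nat and X :: "'k::alg_closed_field proj_point set"
    and L :: "('k proj_point, 'k, 'm) mod_sheaf"
    and Xo :: "'k proj_point set" and \<phi>
  assumes closed: "closedin (zariski N) X" and irreducible: "irreducible_set (zariski N) X"
    and line_bundle: "line_bundle (zariski_on N X) L"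
    and Xo_open: "openin (zariski_on N X) Xo" and Xo_nonempty: "Xo \<noteq> {}"
    and triv: "trivialization (zariski_on N X) L Xo \<phi>"
begin

abbreviation T where "T \<equiv> zariski_on N X"

abbreviation Sec where "Sec V \<equiv> carrier (sections L V)"

lemma topspace_T: "topspace T = X"
  using closedin_subset[OF closed] by auto

sublocale sheaf_of_modules T L
  using line_bundle by (simp add: line_bundle_def)

text \<open>Meaningful only on \<open>V \<inter> Xo\<close>; later statements evaluate it only
  there.\<close>

definition tr :: "'k proj_point set \<Rightarrow> 'm \<Rightarrow> 'k proj_point \<Rightarrow> 'k" where
  "tr V s = \<phi> (V \<inter> Xo) (restr L V (V \<inter> Xo) s)"

lemma Sec_add:
  assumes "openin T V" "s \<in> Sec V" "t \<in> Sec V"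
  shows "s \<oplus>\<^bsub>sections L V\<^esub> t \<in> Sec V"
proof -
  interpret M: Module.module "regular_ring T V" "sections L V" using sections_module[OF assms(1)] .
  show ?thesis using assms(2,3) by (rule M.M.add.m_closed)
qed

lemma Sec_smult:
  assumes "openin T V" "a \<in> regular_functions T V" "s \<in> Sec V"
  shows "a \<odot>\<^bsub>sections L V\<^esub> s \<in> Sec V"
proof -
  interpret M: Module.module "regular_ring T V" "sections L V" using sections_module[OF assms(1)] .
  show ?thesis using assms(2,3) by (intro M.smult_closed) (simp_all add: regular_ring_def)
qed

lemma Sec_nonempty: "openin T V \<Longrightarrow> Sec V \<noteq> {}"
proof -
  assume V: "openin T V"
  interpret M: Module.module "regular_ring T V" "sections L V" using sections_module[OF V] .
  show ?thesis using M.M.zero_closed by blast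
qed

context
  fixes U \<phi>' V
  assumes triv': "trivialization T L U \<phi>'" and V: "openin T V" "V \<subseteq> U"
begin

lemma triv_bij: "bij_betw (\<phi>' V) (Sec V) (regular_functions T V)"
  and triv_add: "s \<in> Sec V \<Longrightarrow> t \<in> Sec V \<Longrightarrow> z \<in> V \<Longrightarrow>
    \<phi>' V (s \<oplus>\<^bsub>sections L V\<^esub> t) z = \<phi>' V s z + \<phi>' V t z"
  and triv_smult: "a \<in> regular_functions T V \<Longrightarrow> s \<in> Sec V \<Longrightarrow> z \<in> V \<Longrightarrow>
    \<phi>' V (a \<odot>\<^bsub>sections L V\<^esub> s) z = a z * \<phi>' V s z"
  and triv_restr: "openin T W \<Longrightarrow> W \<subseteq> V \<Longrightarrow> s \<in> Sec V \<Longrightarrow> z \<in> W \<Longrightarrow>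
    \<phi>' W (restr L V W s) z = \<phi>' V s z"
  using triv' V unfolding trivialization_def by (blast, simp_all)

lemma triv_regular: "s \<in> Sec V \<Longrightarrow> \<phi>' V s \<in> regular_functions T V"
  using triv_bij by (auto simp: bij_betw_def)

lemma triv_eqI:
  assumes "s \<in> Sec V" "t \<in> Sec V" "\<And>z. z \<in> V \<Longrightarrow> \<phi>' V s z = \<phi>' V t z"
  shows "s = t"
proof -
  have "\<phi>' V s \<in> extensional V" "\<phi>' V t \<in> extensional V"
    using triv_regular assms(1,2) by (auto simp: regular_functions_def)
  then have "\<phi>' V s = \<phi>' V t" using assms(3) by (rule extensionalityI)
  then show ?thesis using triv_bij assms(1,2) by (auto simp: bij_betw_def inj_on_def)
qed

end

lemma openin_Xo: "openin T V \<Longrightarrow> openin T (V \<inter> Xo)"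
  using Xo_open by (rule openin_Int[rotated])

lemma restr_Xo: "openin T V \<Longrightarrow> s \<in> Sec V \<Longrightarrow> restr L V (V \<inter> Xo) s \<in> Sec (V \<inter> Xo)"
  by (rule restr_closed) (simp_all add: openin_Xo)

lemma tr_add:
  assumes "openin T V" "s \<in> Sec V" "t \<in> Sec V" "z \<in> V \<inter> Xo"
  shows "tr V (s \<oplus>\<^bsub>sections L V\<^esub> t) z = tr V s z + tr V t z"
  unfolding tr_def
  using assms restr_add[OF assms(1) openin_Xo[OF assms(1)] _ assms(2,3)]
    triv_add[OF triv openin_Xo[OF assms(1)]] restr_Xo by simp

lemma tr_smult:
  assumes "openin T V" "regular_on T V a" "s \<in> Sec V" "z \<in> V \<inter> Xo"
  shows "tr V (restrict a V \<odot>\<^bsub>sections L V\<^esub> s) z = a z * tr V s z"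
proof -
  have a: "restrict a V \<in> regular_functions T V" using assms(2) by (simp add: regular_on_def)
  have a': "restrict (restrict a V) (V \<inter> Xo) \<in> regular_functions T (V \<inter> Xo)"
    using regular_on_subset[OF regular_on_iff[OF a] openin_Xo[OF assms(1)]] by (simp add: regular_on_def)
  show ?thesis
    unfolding tr_def
    using assms restr_smult[OF assms(1) openin_Xo[OF assms(1)] _ a assms(3)]
      triv_smult[OF triv openin_Xo[OF assms(1)] _ a' restr_Xo[OF assms(1,3)]] by simp
qed

lemma tr_restr:
  assumes "openin T V" "openin T W" "W \<subseteq> V" "s \<in> Sec V" "z \<in> W \<inter> Xo"
  shows "tr W (restr L V W s) z = tr V s z"
proof -
  have "W \<inter> Xo \<subseteq> V \<inter> Xo" using assms(3) by blast
  note o = openin_Xo[OF assms(1)] openin_Xo[OF assms(2)]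
  have "restr L W (W \<inter> Xo) (restr L V W s) = restr L V (W \<inter> Xo) s"
    by (rule restr_trans) (use assms o in auto)
  also have "\<dots> = restr L (V \<inter> Xo) (W \<inter> Xo) (restr L V (V \<inter> Xo) s)"
    by (rule restr_trans[symmetric]) (use assms o in auto)
  finally show ?thesis
    unfolding tr_def
    using triv_restr[OF triv o(1) _ o(2) \<open>W \<inter> Xo \<subseteq> V \<inter> Xo\<close> restr_Xo[OF assms(1,4)] assms(5)] by simp
qed

lemma tr_regular:
  assumes "openin T V" "s \<in> Sec V"
  shows "regular_on T (V \<inter> Xo) (tr V s)"
  unfolding tr_def
  by (rule regular_on_iff, rule triv_regular[OF triv]) (use assms restr_Xo openin_Xo in auto)

text \<open>
  In a local trivialization the difference of the sections is a regular function whose nonvanishing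
  locus is an open set that misses \<open>Xo\<close>; by irreducibility it is empty.
\<close>

lemma section_eqI:
  assumes V: "openin T V" and s: "s \<in> Sec V" and t: "t \<in> Sec V"
    and eq: "\<And>z. z \<in> V \<inter> Xo \<Longrightarrow> tr V s z = tr V t z"
  shows "s = t"
proof -
  \<comment> \<open>The open sets on which the two sections agree. They turn out to cover V, so that
    locality applies.\<close>
  let ?C = "{W. openin T W \<and> W \<subseteq> V \<and> restr L V W s = restr L V W t}"
  note VX = openin_Xo[OF V]
  have st: "restr L V (V \<inter> Xo) s = restr L V (V \<inter> Xo) t"
    by (rule triv_eqI[OF triv VX]) (use eq restr_Xo[OF V] s t in \<open>auto simp: tr_def\<close>)
  have "\<exists>W\<in>?C. p \<in> W" if p: "p \<in> V" for p
  proof -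
    have "p \<in> topspace T" using openin_subset[OF V] p by blast
    then obtain U where U: "openin T U" "p \<in> U" "sheaf_iso_on T U L (structure_sheaf T)"
      using line_bundle unfolding line_bundle_def by blast
    then obtain \<phi>' where \<phi>': "trivialization T L U \<phi>'" using trivialization_exists by blast
    define W where "W = V \<inter> U"
    have W: "openin T W" "W \<subseteq> V" "W \<subseteq> U" unfolding W_def using V U(1) by auto
    note W' = openin_Xo[OF W(1)]
    note sW = restr_closed[OF V W(1,2) s] and tW = restr_closed[OF V W(1,2) t]
    let ?d = "\<lambda>z. \<phi>' W (restr L V W s) z - \<phi>' W (restr L V W t) z"
    have "regular_on T W ?d"
      by (rule regular_on_diff[OF W(1)])
        (rule regular_on_iff, rule triv_regular[OF \<phi>' W(1,3)], rule sW tW)+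
    then have D: "openin T {z \<in> W. ?d z \<noteq> 0}" by (rule regular_on_nonzero_open)
    have zero: "?d z = 0" if z: "z \<in> W \<inter> Xo" for z
    proof -
      have eq': "restr L W (W \<inter> Xo) (restr L V W x) = restr L (V \<inter> Xo) (W \<inter> Xo) (restr L V (V \<inter> Xo) x)"
        if x: "x \<in> Sec V" for x
      proof -
        have "restr L W (W \<inter> Xo) (restr L V W x) = restr L V (W \<inter> Xo) x"
          by (rule restr_trans) (use V W W' x in auto)
        also have "\<dots> = restr L (V \<inter> Xo) (W \<inter> Xo) (restr L V (V \<inter> Xo) x)"
          by (rule restr_trans[symmetric]) (use V VX W W' x in auto)
        finally show ?thesis .
      qed
      have "\<phi>' (W \<inter> Xo) (restr L W (W \<inter> Xo) (restr L V W s)) z = \<phi>' W (restr L V W s) z"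
        "\<phi>' (W \<inter> Xo) (restr L W (W \<inter> Xo) (restr L V W t)) z = \<phi>' W (restr L V W t) z"
        by (rule triv_restr[OF \<phi>' W(1,3) W' _ _ z], simp, rule sW tW)+
      then show ?thesis using eq'[OF s] eq'[OF t] st by simp
    qed
    have "{z \<in> W. ?d z \<noteq> 0} = {}"
    proof (rule ccontr)
      assume "{z \<in> W. ?d z \<noteq> 0} \<noteq> {}"
      from irreducible_openin_Int[OF closed irreducible D this Xo_open Xo_nonempty]
      show False using zero by blast
    qed
    then have "restr L V W s = restr L V W t"
      by (intro triv_eqI[OF \<phi>' W(1,3) sW tW]) auto
    then show ?thesis using W U(2) p by (auto simp: W_def)
  qed
  then have union: "\<Union>?C = V" by blast
  show ?thesis
  proof (rule locality[of ?C])
    show "s \<in> Sec (\<Union>?C)" "t \<in> Sec (\<Union>?C)" unfolding union by (rule s t)+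
    show "restr L (\<Union>?C) W s = restr L (\<Union>?C) W t" if "W \<in> ?C" for W
      unfolding union using that by blast
  qed blast
qed

text \<open>Only the values of h on \<open>V \<inter> Xo\<close> matter. One function can therefore
  represent sections over several open sets, and restriction maps disappear from the
  calculations.\<close>

definition is_section :: "'k proj_point set \<Rightarrow> ('k proj_point \<Rightarrow> 'k) \<Rightarrow> bool" where
  "is_section V h \<longleftrightarrow> (\<exists>s\<in>Sec V. \<forall>z\<in>V \<inter> Xo. tr V s z = h z)"

lemma is_section_cong:
  "is_section V h \<Longrightarrow> (\<And>z. z \<in> V \<inter> Xo \<Longrightarrow> h z = h' z) \<Longrightarrow> is_section V h'"
  unfolding is_section_def by auto

lemma is_section_add:
  assumes "openin T V" "is_section V h" "is_section V h'"
  shows "is_section V (\<lambda>z. h z + h' z)"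
proof -
  obtain s t where "s \<in> Sec V" "t \<in> Sec V" "\<forall>z\<in>V \<inter> Xo. tr V s z = h z" "\<forall>z\<in>V \<inter> Xo. tr V t z = h' z"
    using assms(2,3) unfolding is_section_def by blast
  then show ?thesis unfolding is_section_def
    using tr_add[OF assms(1)] Sec_add[OF assms(1)] by (intro bexI[of _ "s \<oplus>\<^bsub>sections L V\<^esub> t"]) auto
qed

lemma is_section_mult:
  assumes "openin T V" "regular_on T V a" "is_section V h"
  shows "is_section V (\<lambda>z. a z * h z)"
proof -
  obtain s where "s \<in> Sec V" "\<forall>z\<in>V \<inter> Xo. tr V s z = h z"
    using assms(3) unfolding is_section_def by blast
  moreover have "restrict a V \<in> regular_functions T V" using assms(2) by (simp add: regular_on_def)
  ultimately show ?thesis unfolding is_section_def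
    using tr_smult[OF assms(1,2)] Sec_smult[OF assms(1)]
    by (intro bexI[of _ "restrict a V \<odot>\<^bsub>sections L V\<^esub> s"]) auto
qed

lemma is_section_cmult: "openin T V \<Longrightarrow> is_section V h \<Longrightarrow> is_section V (\<lambda>z. c * h z)"
  by (rule is_section_mult[OF _ regular_on_const])

lemma is_section_zero: "openin T V \<Longrightarrow> is_section V (\<lambda>_. 0)"
proof -
  assume V: "openin T V"
  then obtain s where "s \<in> Sec V" using Sec_nonempty by blast
  then have "is_section V (tr V s)" unfolding is_section_def by blast
  from is_section_cmult[OF V this, of 0] show ?thesis by simp
qed

lemma is_section_sum:
  assumes "openin T V" "\<And>i. i \<in> I \<Longrightarrow> is_section V (h i)"
  shows "is_section V (\<lambda>z. \<Sum>i\<in>I. h i z)"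
  using assms(2)
proof (induction I rule: infinite_finite_induct)
  case (insert i I)
  have "is_section V (\<lambda>z. h i z + (\<Sum>i\<in>I. h i z))"
    by (rule is_section_add[OF assms(1)]) (use insert in auto)
  then show ?case using insert(1,2) by simp
qed (use is_section_zero[OF assms(1)] in simp_all)

lemma is_section_subset:
  assumes "openin T V" "openin T W" "W \<subseteq> V" "is_section V h"
  shows "is_section W h"
proof -
  obtain s where s: "s \<in> Sec V" "\<forall>z\<in>V \<inter> Xo. tr V s z = h z"
    using assms(4) unfolding is_section_def by blast
  then show ?thesis unfolding is_section_def
    using tr_restr[OF assms(1-3) s(1)] assms(3) restr_closed[OF assms(1-3) s(1)]
    by (intro bexI[of _ "restr L V W s"]) auto
qed

text \<open>Compatibility on overlaps is automatic: the local sections are represented by the same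
  function, and \<open>section_eqI\<close> makes their restrictions equal.\<close>

lemma is_section_glue:
  assumes "\<And>V. V \<in> \<U> \<Longrightarrow> openin T V" "\<And>V. V \<in> \<U> \<Longrightarrow> is_section V h"
  shows "is_section (\<Union>\<U>) h"
proof -
  have "\<forall>V. \<exists>s. V \<in> \<U> \<longrightarrow> s \<in> Sec V \<and> (\<forall>z\<in>V \<inter> Xo. tr V s z = h z)"
    using assms(2) unfolding is_section_def by blast
  from choice[OF this] obtain \<sigma>
    where \<sigma>: "V \<in> \<U> \<Longrightarrow> \<sigma> V \<in> Sec V" "V \<in> \<U> \<Longrightarrow> z \<in> V \<inter> Xo \<Longrightarrow> tr V (\<sigma> V) z = h z" for V z
    by blast
  have U: "openin T (\<Union>\<U>)" using assms(1) by blast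
  have "\<exists>s\<in>Sec (\<Union>\<U>). \<forall>V\<in>\<U>. restr L (\<Union>\<U>) V s = \<sigma> V"
  proof (rule gluing)
    fix V W assume VW: "V \<in> \<U>" "W \<in> \<U>"
    note o = assms(1)[OF VW(1)] assms(1)[OF VW(2)]
    have o': "openin T (V \<inter> W)" using o by (rule openin_Int)
    show "restr L V (V \<inter> W) (\<sigma> V) = restr L W (V \<inter> W) (\<sigma> W)"
    proof (rule section_eqI[OF o'])
      show "restr L V (V \<inter> W) (\<sigma> V) \<in> Sec (V \<inter> W)" "restr L W (V \<inter> W) (\<sigma> W) \<in> Sec (V \<inter> W)"
        using o o' \<sigma>(1) VW by (auto intro: restr_closed)
      fix z assume z: "z \<in> V \<inter> W \<inter> Xo"
      then show "tr (V \<inter> W) (restr L V (V \<inter> W) (\<sigma> V)) z = tr (V \<inter> W) (restr L W (V \<inter> W) (\<sigma> W)) z"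
        using tr_restr[OF o(1) o' _ \<sigma>(1)[OF VW(1)] z] tr_restr[OF o(2) o' _ \<sigma>(1)[OF VW(2)] z]
          \<sigma>(2)[OF VW(1), of z] \<sigma>(2)[OF VW(2), of z] by simp
    qed
  qed (use assms(1) \<sigma>(1) in auto)
  then obtain s where s: "s \<in> Sec (\<Union>\<U>)" "\<And>V. V \<in> \<U> \<Longrightarrow> restr L (\<Union>\<U>) V s = \<sigma> V" by blast
  have "tr (\<Union>\<U>) s z = h z" if z: "z \<in> \<Union>\<U> \<inter> Xo" for z
  proof -
    obtain V where V: "V \<in> \<U>" "z \<in> V \<inter> Xo" using z by blast
    have "tr (\<Union>\<U>) s z = tr V (\<sigma> V) z"
      using tr_restr[OF U assms(1)[OF V(1)] Union_upper[OF V(1)] s(1) V(2)] s(2)[OF V(1)] by simp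
    then show ?thesis using \<sigma>(2)[OF V] by simp
  qed
  then show ?thesis using s(1) unfolding is_section_def by blast
qed

lemma is_section_regular:
  assumes "openin T V" "is_section V h"
  shows "regular_on T (V \<inter> Xo) h"
proof -
  obtain s where "s \<in> Sec V" "\<forall>z\<in>V \<inter> Xo. tr V s z = h z"
    using assms(2) unfolding is_section_def by blast
  then show ?thesis using regular_on_cong[OF tr_regular[OF assms(1)]] by blast
qed

end

section \<open>The splitting in terms of functions\<close>

lemma std_open_Int_open: "openin (zariski 1) (std_open 0 \<inter> std_open 1 :: 'k::field proj_point set)"
  by (intro openin_Int openin_std_open) auto

lemma regular_on_P1_powi:
  assumes "openin (zariski 1) V" "regular_on (zariski 1) V h" "\<And>z. z \<in> V \<Longrightarrow> h z \<noteq> 0"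
  shows "regular_on (zariski 1) V (\<lambda>z. h z powi i)"
  using regular_on_powi[of 1 UNIV V h i] assms by (simp add: subtopology_UNIV)

lemma affine_coord_hpoint:
  assumes "v \<in> \<Union>(std_open 0 \<inter> std_open 1 :: 'k::field proj_point set)"
  shows "affine_coord (hpoint v) = v 1 / v 0" "v 0 \<noteq> 0" "v 1 \<noteq> 0"
proof -
  have "std_open 0 \<inter> std_open 1 \<subseteq> (proj_space 1 :: 'k proj_point set)" by (auto simp: std_open_def)
  then have "hpoint v \<in> std_open 0 \<inter> std_open 1" using assms Union_std_open_iff by blast
  then show "affine_coord (hpoint v) = v 1 / v 0" "v 0 \<noteq> 0" "v 1 \<noteq> 0"
    using affine_coord_eq[of "hpoint v" v] hpoint_self[of v] by (auto simp: std_open_def)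
qed

text \<open>The isomorphism behind \<open>splits_as\<close> is the parameter \<open>\<psi>\<close>,
  with its properties written out. \<open>Xo\<close> has to lie over both charts, so that the pulled
  back coordinate is regular and nonzero on it.\<close>

locale split_line_bundle = trivialized_line_bundle N X L Xo \<phi>
  for N :: nat and X :: "'k::alg_closed_field proj_point set"
    and L :: "('k proj_point, 'k, 'm) mod_sheaf" and Xo \<phi> +
  fixes f :: "'k proj_point \<Rightarrow> 'k proj_point" and n :: nat and a :: "nat \<Rightarrow> int"
    and \<psi> :: "'k proj_point set \<Rightarrow> 'm \<Rightarrow> nat \<Rightarrow> (nat \<Rightarrow> 'k) \<Rightarrow> 'k"
  assumes morphism: "morphism_var (zariski_on N X) (zariski 1) f"
    and f_Xo: "\<And>z. z \<in> Xo \<Longrightarrow> f z \<in> std_open 0 \<inter> std_open 1"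
    and split_bij: "\<And>V. openin (zariski 1) V \<Longrightarrow>
      bij_betw (\<psi> V) (carrier (sections L {x \<in> topspace (zariski_on N X). f x \<in> V}))
        (\<Pi>\<^sub>E j\<in>{1..n}. twist_sections (zariski 1) (a j) V)"
    and split_add: "\<And>V s t. openin (zariski 1) V \<Longrightarrow>
      s \<in> carrier (sections L {x \<in> topspace (zariski_on N X). f x \<in> V}) \<Longrightarrow>
      t \<in> carrier (sections L {x \<in> topspace (zariski_on N X). f x \<in> V}) \<Longrightarrow>
      \<psi> V (s \<oplus>\<^bsub>sections L {x \<in> topspace (zariski_on N X). f x \<in> V}\<^esub> t) =
        (\<lambda>j\<in>{1..n}. restrict (\<lambda>v. \<psi> V s j v + \<psi> V t j v) (\<Union>V))"
    and split_smult: "\<And>V r s. openin (zariski 1) V \<Longrightarrow> r \<in> regular_functions (zariski 1) V \<Longrightarrow>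
      s \<in> carrier (sections L {x \<in> topspace (zariski_on N X). f x \<in> V}) \<Longrightarrow>
      \<psi> V (restrict (r \<circ> f) {x \<in> topspace (zariski_on N X). f x \<in> V}
        \<odot>\<^bsub>sections L {x \<in> topspace (zariski_on N X). f x \<in> V}\<^esub> s) =
        (\<lambda>j\<in>{1..n}. restrict (\<lambda>v. r (hpoint v) * \<psi> V s j v) (\<Union>V))"
    and split_restr: "\<And>V W s. openin (zariski 1) V \<Longrightarrow> openin (zariski 1) W \<Longrightarrow> W \<subseteq> V \<Longrightarrow>
      s \<in> carrier (sections L {x \<in> topspace (zariski_on N X). f x \<in> V}) \<Longrightarrow>
      \<psi> W (restr L {x \<in> topspace (zariski_on N X). f x \<in> V} {x \<in> topspace (zariski_on N X). f x \<in> W} s) =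
        (\<lambda>j\<in>{1..n}. restrict (\<psi> V s j) (\<Union>W))"
begin

definition pre :: "'k proj_point set \<Rightarrow> 'k proj_point set" where
  "pre V = {x \<in> topspace T. f x \<in> V}"

lemmas split_bij' = split_bij[folded pre_def]
  and split_add' = split_add[folded pre_def]
  and split_smult' = split_smult[folded pre_def]
  and split_restr' = split_restr[folded pre_def]

abbreviation U01 :: "'k proj_point set" where "U01 \<equiv> std_open 0 \<inter> std_open 1"

definition u :: "'k proj_point \<Rightarrow> 'k" where "u z = affine_coord (f z)"

lemma openin_pre: "openin (zariski 1) V \<Longrightarrow> openin T (pre V)"
  using morphism openin_continuous_map_preimage unfolding morphism_var_def pre_def by blast

lemma Xo_subset_pre: "Xo \<subseteq> pre U01"
  using f_Xo openin_subset[OF Xo_open] unfolding pre_def by blast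

lemma regular_on_pullback:
  assumes "openin (zariski 1) V" "regular_on (zariski 1) V r"
  shows "regular_on T (pre V) (\<lambda>z. r (f z))"
proof -
  have "restrict (restrict r V \<circ> f) (pre V) \<in> regular_functions T (pre V)"
    using morphism assms unfolding morphism_var_def regular_on_def pre_def by blast
  moreover have "restrict (restrict r V \<circ> f) (pre V) = restrict (\<lambda>z. r (f z)) (pre V)"
    by (auto simp: restrict_def pre_def)
  ultimately show ?thesis by (simp add: regular_on_def)
qed

lemma split_mem:
  assumes "openin (zariski 1) V" "s \<in> Sec (pre V)" "j \<in> {1..n}"
  shows "\<psi> V s j \<in> twist_sections (zariski 1) (a j) V"
proof -
  have "\<psi> V s \<in> (\<Pi>\<^sub>E j\<in>{1..n}. twist_sections (zariski 1) (a j) V)"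
    using split_bij'[OF assms(1)] assms(2) by (auto simp: bij_betw_def)
  then show ?thesis using assms(3) by (rule PiE_mem)
qed

lemma split_eqI:
  assumes V: "openin (zariski 1) V" and s: "s \<in> Sec (pre V)" "t \<in> Sec (pre V)"
    and eq: "\<And>j v. j \<in> {1..n} \<Longrightarrow> v \<in> \<Union>V \<Longrightarrow> \<psi> V s j v = \<psi> V t j v"
  shows "s = t"
proof -
  have mem: "\<psi> V x \<in> (\<Pi>\<^sub>E j\<in>{1..n}. twist_sections (zariski 1) (a j) V)" if "x \<in> Sec (pre V)" for x
    using split_bij'[OF V] that by (auto simp: bij_betw_def)
  have "\<psi> V s = \<psi> V t"
  proof (rule PiE_ext[OF mem[OF s(1)] mem[OF s(2)]])
    fix j assume j: "j \<in> {1..n}"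
    have "\<psi> V s j \<in> extensional (\<Union>V)" "\<psi> V t j \<in> extensional (\<Union>V)"
      using split_mem[OF V _ j] s by (auto simp: twist_sections_def)
    then show "\<psi> V s j = \<psi> V t j" using eq[OF j] by (rule extensionalityI)
  qed
  then show ?thesis using split_bij'[OF V] s by (auto simp: bij_betw_def inj_on_def)
qed

lemma split_surj:
  assumes "openin (zariski 1) V" "\<And>j. j \<in> {1..n} \<Longrightarrow> \<sigma> j \<in> twist_sections (zariski 1) (a j) V"
  obtains s where "s \<in> Sec (pre V)" "\<And>j. j \<in> {1..n} \<Longrightarrow> \<psi> V s j = \<sigma> j"
proof -
  have "restrict \<sigma> {1..n} \<in> \<psi> V ` Sec (pre V)"
    unfolding bij_betw_imp_surj_on[OF split_bij'[OF assms(1)]] using assms(2) by auto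
  then obtain s where s: "restrict \<sigma> {1..n} = \<psi> V s" "s \<in> Sec (pre V)" by (rule imageE)
  show ?thesis by (rule that[OF s(2)]) (simp add: s(1)[symmetric])
qed

text \<open>The generator of the j-th summand given by the power a j of the coordinate x0. Over the
  overlap x0 is invertible, so a j may be negative.\<close>

definition is_basis_section :: "nat \<Rightarrow> 'm \<Rightarrow> bool" where
  "is_basis_section j s \<longleftrightarrow> s \<in> Sec (pre U01) \<and>
     (\<forall>i\<in>{1..n}. \<forall>v\<in>\<Union>U01. \<psi> U01 s i v = (if i = j then v 0 powi a j else 0))"

definition basis_section :: "nat \<Rightarrow> 'm" where
  "basis_section j = (SOME s. is_basis_section j s)"

definition \<theta> :: "nat \<Rightarrow> 'k proj_point \<Rightarrow> 'k" where
  "\<theta> j = tr (pre U01) (basis_section j)"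

text \<open>Since x0^(a j - i) * x1^i = (x1 / x0)^i * x0^(a j), these sections are u^i times the
  j-th basis section. A coordinate that may vanish on V must have a nonnegative exponent: this means
  i \<ge> 0 over \<open>std_open 0\<close> and i \<le> a j over \<open>std_open 1\<close>.\<close>

lemma monomial_section:
  assumes V: "openin (zariski 1) V" "V \<subseteq> std_open 0 \<or> V \<subseteq> std_open 1"
    and j: "i \<le> a j \<or> V \<subseteq> std_open 0" "i \<ge> 0 \<or> V \<subseteq> std_open 1"
  shows "\<exists>s\<in>Sec (pre V). \<forall>i'\<in>{1..n}. \<forall>v\<in>\<Union>V.
    \<psi> V s i' v = (if i' = j then v 0 powi (a j - i) * v 1 powi i else 0)"
proof -
  have "\<exists>\<sigma>\<in>twist_sections (zariski 1) (a i') V. \<forall>v\<in>\<Union>V.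
      \<sigma> v = (if i' = j then v 0 powi (a j - i) * v 1 powi i else 0)" for i'
  proof (cases "i' = j")
    case True
    have "restrict (\<lambda>v. v 0 powi (a j - i) * v 1 powi i) (\<Union>V) \<in> twist_sections (zariski 1) (a j - i + i) V"
      by (rule twist_sections_monomial[OF V(1)]) (use j in auto)
    then show ?thesis using True by (intro bexI) auto
  next
    case False
    \<comment> \<open>Zero has to be written as a quotient of forms with degree difference a i'. It
      is taken as 0 times a power of the coordinate that is invertible on V.\<close>
    obtain b c where bc: "b \<ge> 0 \<or> V \<subseteq> std_open 0" "c \<ge> 0 \<or> V \<subseteq> std_open 1" "b + c = a i'"
      using V(2) by (metis add.right_neutral add.left_neutral order_refl)
    have "restrict (\<lambda>v. 0 * restrict (\<lambda>v. v 0 powi b * v 1 powi c) (\<Union>V) v) (\<Union>V)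
        \<in> twist_sections (zariski 1) (b + c) V"
      by (rule twist_sections_cmult[OF twist_sections_monomial[OF V(1) bc(1,2)]])
    then show ?thesis using False bc(3) by (intro bexI) auto
  qed
  then obtain \<sigma> where \<sigma>: "\<And>i'. \<sigma> i' \<in> twist_sections (zariski 1) (a i') V"
    "\<And>i' v. v \<in> \<Union>V \<Longrightarrow> \<sigma> i' v = (if i' = j then v 0 powi (a j - i) * v 1 powi i else 0)" by metis
  obtain s where "s \<in> Sec (pre V)" "\<And>j. j \<in> {1..n} \<Longrightarrow> \<psi> V s j = \<sigma> j"
    using split_surj[OF V(1), of \<sigma>] \<sigma>(1) by blast
  then show ?thesis using \<sigma>(2) by (intro bexI[of _ s]) auto
qed

lemma basis_section: "is_basis_section j (basis_section j)"
  unfolding basis_section_def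
proof (rule someI_ex)
  obtain s where "s \<in> Sec (pre U01)" "\<forall>i'\<in>{1..n}. \<forall>v\<in>\<Union>U01.
    \<psi> U01 s i' v = (if i' = j then v 0 powi (a j - 0) * v 1 powi 0 else 0)"
    using monomial_section[OF std_open_Int_open, of 0 j] by auto
  then show "\<exists>s. is_basis_section j s" unfolding is_basis_section_def by (intro exI[of _ s]) auto
qed

lemma scaled_basis_section:
  assumes r': "regular_on (zariski 1) U01 (\<lambda>q. r' (affine_coord q))"
  shows "\<exists>s\<in>Sec (pre U01).
    (\<forall>i\<in>{1..n}. \<forall>v\<in>\<Union>U01. \<psi> U01 s i v = (if i = j then r' (v 1 / v 0) * v 0 powi a j else 0)) \<and>
    (\<forall>z\<in>Xo. tr (pre U01) s z = r' (u z) * \<theta> j z)"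
proof -
  note U = std_open_Int_open and P = openin_pre[OF std_open_Int_open]
  define \<alpha> where "\<alpha> = restrict (\<lambda>q. r' (affine_coord q)) U01"
  have \<alpha>: "\<alpha> \<in> regular_functions (zariski 1) U01" using r' by (simp add: \<alpha>_def regular_on_def)
  have e: "basis_section j \<in> Sec (pre U01)" "\<And>i v. i \<in> {1..n} \<Longrightarrow> v \<in> \<Union>U01 \<Longrightarrow>
    \<psi> U01 (basis_section j) i v = (if i = j then v 0 powi a j else 0)"
    using basis_section[of j] by (auto simp: is_basis_section_def)
  let ?s = "restrict (\<alpha> \<circ> f) (pre U01) \<odot>\<^bsub>sections L (pre U01)\<^esub> basis_section j"
  have reg: "regular_on T (pre U01) (\<alpha> \<circ> f)"
    using regular_on_pullback[OF U regular_on_iff[OF \<alpha>]] by (simp add: o_def)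
  have "?s \<in> Sec (pre U01)"
    by (rule Sec_smult[OF P _ e(1)]) (use reg in \<open>simp add: regular_on_def\<close>)
  moreover have "\<psi> U01 ?s i v = (if i = j then r' (v 1 / v 0) * v 0 powi a j else 0)"
    if i: "i \<in> {1..n}" and v: "v \<in> \<Union>U01" for i v
  proof -
    have "hpoint v \<in> U01"
      by (rule Union_std_open_iff[THEN iffD1, THEN conjunct1, OF _ v]) (auto simp: std_open_def)
    then have "\<alpha> (hpoint v) = r' (v 1 / v 0)"
      using affine_coord_hpoint(1)[OF v] by (simp add: \<alpha>_def)
    then show ?thesis using split_smult'[OF U \<alpha> e(1)] e(2)[OF i v] i v by simp
  qed
  moreover have "tr (pre U01) ?s z = r' (u z) * \<theta> j z" if z: "z \<in> Xo" for z
  proof -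
    have "\<alpha> (f z) = r' (u z)" using f_Xo[OF z] by (simp add: \<alpha>_def u_def)
    then show ?thesis
      using tr_smult[OF P reg e(1), of z] z Xo_subset_pre by (auto simp: \<theta>_def)
  qed
  ultimately show ?thesis by (intro bexI[of _ ?s]) auto
qed

text \<open>The components of index above m are recorded as zero, so that induction on m can add one
  summand at a time; the case m = n is the one used.\<close>

lemma split_combination:
  assumes r: "\<And>j. regular_on (zariski 1) U01 (\<lambda>q. r j (affine_coord q))"
  shows "\<exists>s\<in>Sec (pre U01).
    (\<forall>i\<in>{1..n}. \<forall>v\<in>\<Union>U01. \<psi> U01 s i v = (if i \<le> m then r i (v 1 / v 0) * v 0 powi a i else 0)) \<and>
    (\<forall>z\<in>Xo. tr (pre U01) s z = (\<Sum>j=1..m. r j (u z) * \<theta> j z))"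
proof (induction m)
  case 0
  have "regular_on (zariski 1) U01 (\<lambda>q. (\<lambda>_. 0) (affine_coord q) :: 'k)"
    using regular_on_const[OF std_open_Int_open] by simp
  from scaled_basis_section[OF this, of 0] show ?case by auto
next
  case (Suc m)
  note U = std_open_Int_open and P = openin_pre[OF std_open_Int_open]
  obtain s where s: "s \<in> Sec (pre U01)"
    "\<And>i v. i \<in> {1..n} \<Longrightarrow> v \<in> \<Union>U01 \<Longrightarrow>
      \<psi> U01 s i v = (if i \<le> m then r i (v 1 / v 0) * v 0 powi a i else 0)"
    "\<And>z. z \<in> Xo \<Longrightarrow> tr (pre U01) s z = (\<Sum>j=1..m. r j (u z) * \<theta> j z)" using Suc by blast
  obtain t where t: "t \<in> Sec (pre U01)"
    "\<And>i v. i \<in> {1..n} \<Longrightarrow> v \<in> \<Union>U01 \<Longrightarrow>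
      \<psi> U01 t i v = (if i = Suc m then r (Suc m) (v 1 / v 0) * v 0 powi a (Suc m) else 0)"
    "\<And>z. z \<in> Xo \<Longrightarrow> tr (pre U01) t z = r (Suc m) (u z) * \<theta> (Suc m) z"
    using scaled_basis_section[OF r, of "Suc m" "Suc m"] by blast
  let ?w = "s \<oplus>\<^bsub>sections L (pre U01)\<^esub> t"
  have "?w \<in> Sec (pre U01)" by (rule Sec_add[OF P s(1) t(1)])
  moreover have "\<psi> U01 ?w i v = (if i \<le> Suc m then r i (v 1 / v 0) * v 0 powi a i else 0)"
    if iv: "i \<in> {1..n}" "v \<in> \<Union>U01" for i v
  proof -
    have "\<psi> U01 ?w i v = \<psi> U01 s i v + \<psi> U01 t i v"
      using split_add'[OF U s(1) t(1)] iv by simp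
    then show ?thesis using s(2)[OF iv] t(2)[OF iv] by (simp add: le_Suc_eq)
  qed
  moreover have "tr (pre U01) ?w z = (\<Sum>j=1..Suc m. r j (u z) * \<theta> j z)" if z: "z \<in> Xo" for z
    using tr_add[OF P s(1) t(1), of z] s(3)[OF z] t(3)[OF z] z Xo_subset_pre by auto
  ultimately show ?case by (intro bexI[of _ ?w]) auto
qed

lemma tr_split:
  assumes r: "\<And>j. regular_on (zariski 1) U01 (\<lambda>q. r j (affine_coord q))"
    and s: "s \<in> Sec (pre U01)"
    and eq: "\<And>i v. i \<in> {1..n} \<Longrightarrow> v \<in> \<Union>U01 \<Longrightarrow> \<psi> U01 s i v = r i (v 1 / v 0) * v 0 powi a i"
    and z: "z \<in> Xo"
  shows "tr (pre U01) s z = (\<Sum>j=1..n. r j (u z) * \<theta> j z)"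
proof -
  obtain t where t: "t \<in> Sec (pre U01)"
    "\<forall>i\<in>{1..n}. \<forall>v\<in>\<Union>U01. \<psi> U01 t i v = (if i \<le> n then r i (v 1 / v 0) * v 0 powi a i else 0)"
    "\<forall>z\<in>Xo. tr (pre U01) t z = (\<Sum>j=1..n. r j (u z) * \<theta> j z)"
    using split_combination[of r n] r by blast
  have "s = t" by (rule split_eqI[OF std_open_Int_open s t(1)]) (use eq t(2) in auto)
  then show ?thesis using t(3) z by blast
qed

text \<open>A relation makes the combination agree with the zero combination on \<open>Xo\<close>,
  so the two sections coincide and hence so do their components. These are evaluated at the vector
  (1, w), which lies over the overlap because w \<noteq> 0.\<close>

lemma theta_independent:
  assumes r: "\<And>j. regular_on (zariski 1) U01 (\<lambda>q. r j (affine_coord q))"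
    and zero: "\<And>z. z \<in> Xo \<Longrightarrow> (\<Sum>j=1..n. r j (u z) * \<theta> j z) = 0"
    and j: "j \<in> {1..n}" and w: "w \<noteq> 0"
  shows "r j w = 0"
proof -
  obtain s where s: "s \<in> Sec (pre U01)"
    "\<forall>i\<in>{1..n}. \<forall>v\<in>\<Union>U01. \<psi> U01 s i v = (if i \<le> n then r i (v 1 / v 0) * v 0 powi a i else 0)"
    "\<forall>z\<in>Xo. tr (pre U01) s z = (\<Sum>j=1..n. r j (u z) * \<theta> j z)"
    using split_combination[of r n] r by blast
  obtain t where t: "t \<in> Sec (pre U01)"
    "\<forall>i\<in>{1..n}. \<forall>v\<in>\<Union>U01. \<psi> U01 t i v = (if i \<le> n then (\<lambda>_ _. 0) i (v 1 / v 0) * v 0 powi a i else 0)"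
    "\<forall>z\<in>Xo. tr (pre U01) t z = (\<Sum>j=1..n. (\<lambda>_ _. 0) j (u z) * \<theta> j z)"
    using split_combination[of "\<lambda>_ _. 0" n] regular_on_const[OF std_open_Int_open] by blast
  have "s = t"
    by (rule section_eqI[OF openin_pre[OF std_open_Int_open] s(1) t(1)]) (use s(3) t(3) zero in auto)
  define v where "v = affine_vec 0 w"
  have v: "v 0 = 1" "v 1 = w" by (auto simp: v_def affine_vec_def)
  have "hpoint v \<in> std_open 0" unfolding v_def by (rule affine_vec_std_open) simp
  moreover have "hpoint v \<in> std_open 1"
    using affine_vec_hvecs[of 0 w] v w by (auto simp: std_open_def proj_space_def hpoint_def v_def[symmetric])
  ultimately have "v \<in> \<Union>U01" using hpoint_self by blast
  then have "\<psi> U01 s j v = r j (v 1 / v 0) * v 0 powi a j" "\<psi> U01 t j v = 0"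
    using s(2)[THEN bspec, THEN bspec, OF j, of v] t(2)[THEN bspec, THEN bspec, OF j, of v] j by simp_all
  then show ?thesis using v \<open>s = t\<close> by simp
qed

lemma tr_of_split:
  assumes V: "openin (zariski 1) V" "U01 \<subseteq> V"
    and r: "\<And>j. regular_on (zariski 1) U01 (\<lambda>q. r j (affine_coord q))"
    and s: "s \<in> Sec (pre V)"
    and eq: "\<And>i v. i \<in> {1..n} \<Longrightarrow> v \<in> \<Union>U01 \<Longrightarrow> \<psi> V s i v = r i (v 1 / v 0) * v 0 powi a i"
    and z: "z \<in> Xo"
  shows "tr (pre V) s z = (\<Sum>j=1..n. r j (u z) * \<theta> j z)"
proof -
  note U = std_open_Int_open
  have sub: "pre U01 \<subseteq> pre V" using V(2) by (auto simp: pre_def)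
  let ?s = "restr L (pre V) (pre U01) s"
  note P = openin_pre[OF V(1)] openin_pre[OF U]
  have "tr (pre U01) ?s z = (\<Sum>j=1..n. r j (u z) * \<theta> j z)"
  proof (rule tr_split[OF r _ _ z])
    show "?s \<in> Sec (pre U01)" by (rule restr_closed[OF P sub s])
    show "\<psi> U01 ?s i v = r i (v 1 / v 0) * v 0 powi a i" if iv: "i \<in> {1..n}" "v \<in> \<Union>U01" for i v
      using split_restr'[OF V(1) U V(2) s] eq[OF iv] iv by simp
  qed
  moreover have "tr (pre U01) ?s z = tr (pre V) s z"
    by (rule tr_restr[OF P sub s]) (use z Xo_subset_pre in auto)
  ultimately show ?thesis by simp
qed

section \<open>Sections over the two charts in terms of the basis\<close>

lemma regular_on_coord: "regular_on (zariski 1) U01 affine_coord"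
  by (rule regular_on_subset[OF regular_on_affine_coord std_open_Int_open Int_lower1])

lemma regular_on_coord_powi: "regular_on (zariski 1) U01 (\<lambda>q. affine_coord q powi i)"
  by (rule regular_on_P1_powi[OF std_open_Int_open regular_on_coord affine_coord_nonzero])

lemma is_section_monomial:
  assumes V: "openin (zariski 1) V" "U01 \<subseteq> V" "V \<subseteq> std_open 0 \<or> V \<subseteq> std_open 1"
    and i: "i \<le> a j \<or> V \<subseteq> std_open 0" "i \<ge> 0 \<or> V \<subseteq> std_open 1" and j: "j \<in> {1..n}"
  shows "is_section (pre V) (\<lambda>z. u z powi i * \<theta> j z)"
proof -
  obtain s where s: "s \<in> Sec (pre V)" "\<forall>i'\<in>{1..n}. \<forall>v\<in>\<Union>V.
    \<psi> V s i' v = (if i' = j then v 0 powi (a j - i) * v 1 powi i else 0)"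
    using monomial_section[OF V(1,3) i] by blast
  let ?r = "\<lambda>i' w. if i' = j then w powi i else (0::'k)"
  have r: "regular_on (zariski 1) U01 (\<lambda>q. ?r i' (affine_coord q))" for i'
    using regular_on_coord_powi[of i] regular_on_const[OF std_open_Int_open, of 0] by (cases "i' = j") simp_all
  have "tr (pre V) s z = u z powi i * \<theta> j z" if z: "z \<in> Xo" for z
  proof -
    have "tr (pre V) s z = (\<Sum>i'=1..n. ?r i' (u z) * \<theta> i' z)"
    proof (rule tr_of_split[OF V(1,2) r s(1) _ z])
      fix i' v assume iv: "i' \<in> {1..n}" "v \<in> \<Union>U01"
      then have "v \<in> \<Union>V" using V(2) by blast
      then show "\<psi> V s i' v = ?r i' (v 1 / v 0) * v 0 powi a i'"
        using s(2)[THEN bspec, THEN bspec, OF iv(1), of v] affine_coord_hpoint(2,3)[OF iv(2)]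
        by (simp add: power_int_diff power_int_divide_distrib)
    qed
    also have "\<dots> = (\<Sum>i'=1..n. if i' = j then u z powi i * \<theta> j z else 0)"
      by (rule sum.cong) auto
    finally show ?thesis using j by simp
  qed
  then show ?thesis using s(1) unfolding is_section_def by blast
qed

lemma is_section_std_open_0:
  assumes "is_section (pre (std_open 0)) h"
  shows "\<exists>p. \<forall>z\<in>Xo. h z = (\<Sum>j=1..n. poly (p j) (u z) * \<theta> j z)"
proof -
  have V: "openin (zariski 1) (std_open 0 :: 'k proj_point set)" by (rule openin_std_open) simp
  obtain s where s: "s \<in> Sec (pre (std_open 0))" "\<forall>z\<in>pre (std_open 0) \<inter> Xo. tr (pre (std_open 0)) s z = h z"
    using assms unfolding is_section_def by blast
  have "\<exists>p. j \<in> {1..n} \<longrightarrow> (\<forall>v\<in>\<Union>(std_open 0). \<psi> (std_open 0) s j v = v 0 powi a j * poly p (v 1 / v 0))" for j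
    using twist_sections_std_open[OF split_mem[OF V s(1), of j]] by auto
  then obtain p where p: "\<And>j v. j \<in> {1..n} \<Longrightarrow> v \<in> \<Union>(std_open 0) \<Longrightarrow>
    \<psi> (std_open 0) s j v = v 0 powi a j * poly (p j) (v 1 / v 0)" by metis
  have "h z = (\<Sum>j=1..n. poly (p j) (u z) * \<theta> j z)" if z: "z \<in> Xo" for z
  proof -
    have "tr (pre (std_open 0)) s z = (\<Sum>j=1..n. poly (p j) (u z) * \<theta> j z)"
    proof (rule tr_of_split[OF V _ _ s(1) _ z])
      show "regular_on (zariski 1) U01 (\<lambda>q. poly (p j) (affine_coord q))" for j
        by (intro regular_on_poly[OF std_open_Int_open] regular_on_coord)
      fix j v assume jv: "j \<in> {1..n}" "v \<in> \<Union>U01"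
      have "\<psi> (std_open 0) s j v = v 0 powi a j * poly (p j) (v 1 / v 0)"
        by (rule p[OF jv(1)]) (use jv(2) in blast)
      then show "\<psi> (std_open 0) s j v = poly (p j) (v 1 / v 0) * v 0 powi a j" by simp
    qed auto
    then show ?thesis using s(2) z Xo_subset_pre by (auto simp: pre_def)
  qed
  then show ?thesis by blast
qed

text \<open>Over this chart the j-th summand is generated by x1^(a j) = u^(a j) * x0^(a j), which
  accounts for the factor \<open>u z powi a j\<close>.\<close>

lemma is_section_std_open_1:
  assumes "is_section (pre (std_open 1)) h"
  shows "\<exists>p. \<forall>z\<in>Xo. h z = (\<Sum>j=1..n. u z powi a j * poly (p j) (inverse (u z)) * \<theta> j z)"
proof -
  have V: "openin (zariski 1) (std_open 1 :: 'k proj_point set)" by (rule openin_std_open) simp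
  obtain s where s: "s \<in> Sec (pre (std_open 1))" "\<forall>z\<in>pre (std_open 1) \<inter> Xo. tr (pre (std_open 1)) s z = h z"
    using assms unfolding is_section_def by blast
  have "\<exists>p. j \<in> {1..n} \<longrightarrow> (\<forall>v\<in>\<Union>(std_open 1). \<psi> (std_open 1) s j v = v 1 powi a j * poly p (v 0 / v 1))" for j
    using twist_sections_std_open[OF split_mem[OF V s(1), of j]] by auto
  then obtain p where p: "\<And>j v. j \<in> {1..n} \<Longrightarrow> v \<in> \<Union>(std_open 1) \<Longrightarrow>
    \<psi> (std_open 1) s j v = v 1 powi a j * poly (p j) (v 0 / v 1)" by metis
  let ?r = "\<lambda>j w. w powi a j * poly (p j) (w powi (-1))"
  have "h z = (\<Sum>j=1..n. u z powi a j * poly (p j) (inverse (u z)) * \<theta> j z)" if z: "z \<in> Xo" for z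
  proof -
    have "tr (pre (std_open 1)) s z = (\<Sum>j=1..n. ?r j (u z) * \<theta> j z)"
    proof (rule tr_of_split[OF V _ _ s(1) _ z])
      show "regular_on (zariski 1) U01 (\<lambda>q. ?r j (affine_coord q))" for j
        by (intro regular_on_mult regular_on_poly[OF std_open_Int_open] regular_on_coord_powi)
      fix j v assume jv: "j \<in> {1..n}" "v \<in> \<Union>U01"
      note nz = affine_coord_hpoint(2,3)[OF jv(2)]
      have "\<psi> (std_open 1) s j v = v 1 powi a j * poly (p j) (v 0 / v 1)"
        by (rule p[OF jv(1)]) (use jv(2) in blast)
      also have "v 0 / v 1 = (v 1 / v 0) powi (-1)" by (simp add: power_int_minus)
      also have "v 1 powi a j = (v 1 / v 0) powi a j * v 0 powi a j"
        using nz by (simp add: power_int_divide_distrib)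
      finally show "\<psi> (std_open 1) s j v = ?r j (v 1 / v 0) * v 0 powi a j" by (simp add: ac_simps)
    qed auto
    then show ?thesis using s(2) z Xo_subset_pre by (auto simp: pre_def power_int_minus)
  qed
  then show ?thesis by blast
qed

end

section \<open>Linear algebra\<close>

text \<open>Gaussian elimination on the last coordinate, with i0 as pivot.\<close>

lemma linear_dependence:
  fixes A :: "'i \<Rightarrow> nat \<Rightarrow> 'k::field"
  assumes "finite I" "card I > g"
  shows "\<exists>c. (\<exists>i\<in>I. c i \<noteq> 0) \<and> (\<forall>k<g. (\<Sum>i\<in>I. c i * A i k) = 0)"
  using assms
proof (induction g arbitrary: I A)
  case 0
  then obtain i where "i \<in> I" by fastforce
  then show ?case by (intro exI[of _ "\<lambda>_. 1"]) auto
next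
  case (Suc g)
  show ?case
  proof (cases "\<forall>i\<in>I. A i g = 0")
    case True
    obtain c where "\<exists>i\<in>I. c i \<noteq> 0" "\<forall>k<g. (\<Sum>i\<in>I. c i * A i k) = 0"
      using Suc.IH[of I A] Suc.prems by auto
    then show ?thesis using True by (intro exI[of _ c]) (auto simp: less_Suc_eq)
  next
    case False
    then obtain i0 where i0: "i0 \<in> I" "A i0 g \<noteq> 0" by blast
    let ?I = "I - {i0}"
    have "finite ?I" "card ?I > g" using Suc.prems i0(1) by auto
    then obtain c where c: "\<exists>i\<in>?I. c i \<noteq> 0"
      "\<forall>k<g. (\<Sum>i\<in>?I. c i * (A i k - A i g / A i0 g * A i0 k)) = 0"
      using Suc.IH[of ?I "\<lambda>i k. A i k - A i g / A i0 g * A i0 k"] by blast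
    \<comment> \<open>The coefficient of the pivot is chosen to make coordinate g of the combination
      vanish.\<close>
    define d where "d = - (\<Sum>i\<in>?I. c i * (A i g / A i0 g))"
    let ?c = "\<lambda>i. if i = i0 then d else c i"
    have split: "(\<Sum>i\<in>I. ?c i * A i k) = (\<Sum>i\<in>?I. c i * (A i k - A i g / A i0 g * A i0 k))" for k
    proof -
      have "(\<Sum>i\<in>I. ?c i * A i k) = d * A i0 k + (\<Sum>i\<in>?I. ?c i * A i k)"
        using sum.remove[OF Suc.prems(1) i0(1), of "\<lambda>i. ?c i * A i k"] by simp
      also have "(\<Sum>i\<in>?I. ?c i * A i k) = (\<Sum>i\<in>?I. c i * A i k)" by (rule sum.cong) auto
      also have "d * A i0 k + \<dots> = (\<Sum>i\<in>?I. c i * (A i k - A i g / A i0 g * A i0 k))"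
        by (simp add: d_def sum_distrib_left sum_distrib_right sum_subtractf right_diff_distrib mult_ac)
      finally show ?thesis .
    qed
    have "(\<Sum>i\<in>I. ?c i * A i k) = 0" if "k < Suc g" for k
      using that c(2) i0(2) by (auto simp only: split less_Suc_eq) simp
    moreover have "\<exists>i\<in>I. ?c i \<noteq> 0" using c(1) by auto
    ultimately show ?thesis by (intro exI[of _ ?c]) blast
  qed
qed

lemma vector_space_functions: "vector_space (\<lambda>(r::'k::field) (c::'x \<Rightarrow> 'k) x. r * c x)"
  by unfold_locales (auto simp: fun_eq_iff algebra_simps)

lemma linear_functional_sum:
  fixes \<alpha> :: "('x \<Rightarrow> 'k::field) \<Rightarrow> 'k"
  assumes "\<And>b c. \<alpha> (\<lambda>x. b x + c x) = \<alpha> b + \<alpha> c" "\<And>r b. \<alpha> (\<lambda>x. r * b x) = r * \<alpha> b"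
  shows "\<alpha> (\<lambda>x. \<Sum>i\<in>J. r i * b i x) = (\<Sum>i\<in>J. r i * \<alpha> (b i))"
proof -
  have "\<alpha> (\<lambda>_. 0) = 0" using assms(2)[of 0 "\<lambda>_. 0"] by simp
  then show ?thesis by (induction J rule: infinite_finite_induct) (simp_all add: assms)
qed

text \<open>A basis of \<open>B\<close> stays independent after adjoining \<open>w\<close>, so the
  values 0 on it and 1 at \<open>w\<close> can be prescribed. With \<open>B\<close> the space of
  coboundaries, this provides a functional on cohomology in the form of one on cochains.\<close>

lemma linear_functional_exists:
  fixes B :: "('x \<Rightarrow> 'k::field) set"
  assumes zero: "(\<lambda>_. 0) \<in> B" and add: "\<And>b c. b \<in> B \<Longrightarrow> c \<in> B \<Longrightarrow> (\<lambda>x. b x + c x) \<in> B"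
    and mult: "\<And>r b. b \<in> B \<Longrightarrow> (\<lambda>x. r * b x) \<in> B" and w: "w \<notin> B"
  obtains \<alpha> :: "('x \<Rightarrow> 'k) \<Rightarrow> 'k" where "\<And>b c. \<alpha> (\<lambda>x. b x + c x) = \<alpha> b + \<alpha> c"
    "\<And>r b. \<alpha> (\<lambda>x. r * b x) = r * \<alpha> b" "\<And>b. b \<in> B \<Longrightarrow> \<alpha> b = 0" "\<alpha> w = 1"
proof -
  interpret V: vector_space "\<lambda>(r::'k) (c::'x \<Rightarrow> 'k) x. r * c x" by (rule vector_space_functions)
  interpret K: vector_space "(*) :: 'k \<Rightarrow> 'k \<Rightarrow> 'k" by unfold_locales (auto simp: algebra_simps)
  interpret P: vector_space_pair "\<lambda>(r::'k) (c::'x \<Rightarrow> 'k) x. r * c x" "(*) :: 'k \<Rightarrow> 'k \<Rightarrow> 'k" ..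
  have sub: "V.subspace B"
    unfolding V.subspace_def using zero add mult by (simp add: zero_fun_def plus_fun_def)
  obtain S where S: "S \<subseteq> B" "V.independent S" "B \<subseteq> V.span S"
    using V.maximal_independent_subset[of B] by blast
  have "V.span S \<subseteq> B" by (rule V.span_minimal[OF S(1) sub])
  then have "w \<notin> V.span S" using w by blast
  then have ind: "V.independent (insert w S)" using S(2) by (rule V.independent_insertI)
  obtain \<alpha> where \<alpha>: "Vector_Spaces.linear (\<lambda>(r::'k) (c::'x \<Rightarrow> 'k) x. r * c x) (*) \<alpha>"
    "\<forall>x\<in>insert w S. \<alpha> x = (if x = w then 1 else 0)"
    using P.linear_independent_extend[OF ind, of "\<lambda>x. if x = w then 1 else 0"] by blast
  interpret A: Vector_Spaces.linear "\<lambda>(r::'k) (c::'x \<Rightarrow> 'k) x. r * c x" "(*)" \<alpha> by (rule \<alpha>(1))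
  have "w \<notin> S" using w S(1) by blast
  then have S0: "\<alpha> x = 0" if "x \<in> S" for x using \<alpha>(2) that by auto
  have "\<alpha> b = 0" if "b \<in> B" for b
    using P.linear_eq_0_on_span[OF \<alpha>(1) S0] S(3) that by blast
  moreover have "\<alpha> (\<lambda>x. b x + c x) = \<alpha> b + \<alpha> c" for b c
    using A.add[of b c] by (simp add: plus_fun_def)
  moreover have "\<alpha> (\<lambda>x. r * b x) = r * \<alpha> b" for r b by (rule A.scale)
  moreover have "\<alpha> w = 1" using \<alpha>(2) by simp
  ultimately show thesis by (intro that)
qed

text \<open>
  Multiplying the identity by a high power of \<open>w\<close> gives a polynomial identity in which the terms
  of the first sum have degrees that do not occur elsewhere.
\<close>

lemma laurent_gap:
  fixes c :: "int \<Rightarrow> 'k::alg_closed_field"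
  assumes S: "finite S" "\<And>i. i \<in> S \<Longrightarrow> e < i \<and> i < 0"
    and eq: "\<And>w. w \<noteq> 0 \<Longrightarrow> (\<Sum>i\<in>S. c i * w powi i) + poly p w = w powi e * poly q (inverse w)"
    and i: "i \<in> S"
  shows "c i = 0"
proof -
  have e: "e < 0" using S(2)[OF i] by linarith
  \<comment> \<open>K satisfies e + K = degree q. After multiplication by w^K the right-hand side is
    the reflected polynomial of q, of degree at most e + K, and p contributes only degrees at least
    K. The exponents i + K of the first sum lie strictly between.\<close>
  define K where "K = nat (int (degree q) - e)"
  have K: "int K = int (degree q) - e" using e by (simp add: K_def)
  let ?P = "\<Sum>i\<in>S. monom (c i) (nat (i + int K))"
  have "?P + monom 1 K * p - reflect_poly q = 0"
  proof (rule poly_zero_of_zero_off[of "[:0, 1:]"])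
    fix w :: 'k assume "poly [:0, 1:] w \<noteq> 0"
    then have w: "w \<noteq> 0" by simp
    have "poly ?P w = (\<Sum>i\<in>S. c i * w powi i) * w powi int K"
      unfolding poly_sum sum_distrib_right
    proof (rule sum.cong[OF refl])
      fix i assume "i \<in> S"
      then have "i + int K \<ge> 0" using S(2)[of i] K by linarith
      then have "w ^ nat (i + int K) = w powi (i + int K)" by (simp add: power_int_def)
      then show "poly (monom (c i) (nat (i + int K))) w = c i * w powi i * w powi int K"
        using w by (simp add: poly_monom power_int_add)
    qed
    moreover have "poly (monom 1 K * p) w = poly p w * w powi int K"
      by (simp add: poly_monom)
    moreover have "poly (reflect_poly q) w = w powi e * poly q (inverse w) * w powi int K"
    proof -
      have "w powi e * w powi int K = w powi int (degree q)"
        using w K by (simp flip: power_int_add)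
      then show ?thesis using poly_reflect_poly_nz[OF w, of q] by (simp add: mult_ac)
    qed
    ultimately have "poly (?P + monom 1 K * p - reflect_poly q) w =
        ((\<Sum>i\<in>S. c i * w powi i) + poly p w - w powi e * poly q (inverse w)) * w powi int K"
      by (simp only: poly_diff poly_add left_diff_distrib distrib_right)
    then show "poly (?P + monom 1 K * p - reflect_poly q) w = 0" using eq[OF w] by simp
  qed simp
  then have "coeff (?P + monom 1 K * p - reflect_poly q) (nat (i + int K)) = 0" by simp
  moreover have "coeff (monom 1 K * p) (nat (i + int K)) = 0"
  proof -
    have "nat (i + int K) < K" using S(2)[OF i] K by linarith
    then show ?thesis by (simp add: coeff_monom_mult)
  qed
  moreover have "coeff (reflect_poly q) (nat (i + int K)) = 0"
    using S(2)[OF i] K degree_reflect_poly_le[of q] by (intro coeff_eq_0) linarith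
  moreover have "coeff ?P (nat (i + int K)) = (\<Sum>i'\<in>S. if i' = i then c i else 0)"
    unfolding coeff_sum
  proof (rule sum.cong[OF refl])
    fix i' assume "i' \<in> S"
    then have "nat (i' + int K) = nat (i + int K) \<longleftrightarrow> i' = i"
      using S(2)[of i'] S(2)[OF i] K by linarith
    then show "coeff (monom (c i') (nat (i' + int K))) (nat (i + int K)) = (if i' = i then c i else 0)"
      by simp
  qed
  ultimately show ?thesis using S(1) i by simp
qed


section \<open>Cohomology of twists of the line bundle\<close>

locale split_curve = split_line_bundle N X L Xo \<phi> f n a \<psi>
  for N :: nat and X :: "'k::alg_closed_field proj_point set"
    and L :: "('k proj_point, 'k, 'm) mod_sheaf" and Xo \<phi> f n a \<psi> +
  fixes g :: nat
  assumes dim: "krull_dim (zariski_on N X) = 1"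
    and genus: "has_genus (zariski_on N X) g"
begin

definition X0 where "X0 = pre (std_open 0)"

definition X1 where "X1 = pre (std_open 1)"

lemma X0_open: "openin T X0" and X1_open: "openin T X1"
  unfolding X0_def X1_def by (rule openin_pre, rule openin_std_open, simp)+

lemma pre_U01: "pre U01 = X0 \<inter> X1" by (auto simp: pre_def X0_def X1_def)

lemma X01_open: "openin T (X0 \<inter> X1)"
  by (rule openin_Int[OF X0_open X1_open])

lemma Xo_subset: "Xo \<subseteq> X0" "Xo \<subseteq> X1"
  using Xo_subset_pre pre_U01 by auto

lemma cover: "topspace T = X0 \<union> X1"
proof
  show "topspace T \<subseteq> X0 \<union> X1"
  proof
    fix x assume x: "x \<in> topspace T"
    then have fx: "f x \<in> proj_space 1"
      using morphism continuous_map_funspace unfolding morphism_var_def by fastforce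
    obtain v where v: "v \<in> hvecs 1" "hpoint v = f x" using proj_space_obtain[OF fx] by blast
    obtain i where i: "v i \<noteq> 0" using v(1) unfolding hvecs_def by blast
    have "i \<le> 1"
    proof (rule ccontr)
      assume "\<not> i \<le> 1"
      then show False using v(1) i unfolding hvecs_def by simp
    qed
    then have "i = 0 \<or> i = 1" by linarith
    moreover have "f x \<in> std_open i" using fx i v(2)[symmetric] by (auto simp: std_open_def hpoint_def)
    ultimately
    show "x \<in> X0 \<union> X1" using x by (auto simp: pre_def X0_def X1_def)
  qed
qed (auto simp: pre_def X0_def X1_def)

lemma u_nonzero: "z \<in> X0 \<inter> X1 \<Longrightarrow> u z \<noteq> 0"
  unfolding u_def by (rule affine_coord_nonzero) (simp add: pre_def X0_def X1_def)

lemma regular_on_u_powi: "regular_on T (X0 \<inter> X1) (\<lambda>z. u z powi i)"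
  using regular_on_pullback[OF std_open_Int_open regular_on_coord_powi[of i]]
  by (simp only: pre_U01 u_def)

text \<open>
  With respect to the trivialization by \<open>x\<^sub>0\<^sup>m\<close> over \<open>X0\<close>, \<open>b\<close> represents a section over \<open>V\<close> of
  \<open>L\<close> twisted by the pullback of \<open>O(m)\<close>.
\<close>

definition is_twist_section :: "int \<Rightarrow> 'k proj_point set \<Rightarrow> ('k proj_point \<Rightarrow> 'k) \<Rightarrow> bool" where
  "is_twist_section m V b \<longleftrightarrow>
     is_section (V \<inter> X0) b \<and> is_section (V \<inter> X1) (\<lambda>z. u z powi (- m) * b z)"

lemma is_twist_section_add:
  assumes "openin T V" "is_twist_section m V b" "is_twist_section m V c"
  shows "is_twist_section m V (\<lambda>z. b z + c z)"
  using assms X0_open X1_open unfolding is_twist_section_def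
  by (auto intro: is_section_add simp: distrib_left openin_Int)

lemma is_twist_section_mult:
  assumes V: "openin T V" and b: "is_twist_section m V b" and r: "regular_on T V r"
  shows "is_twist_section m V (\<lambda>z. b z * r z)"
proof -
  note o = openin_Int[OF V X0_open] openin_Int[OF V X1_open]
  have "is_section (V \<inter> X0) (\<lambda>z. r z * b z)"
    "is_section (V \<inter> X1) (\<lambda>z. r z * (u z powi (- m) * b z))"
    using b is_section_mult[OF o(1) regular_on_subset[OF r o(1) Int_lower1]]
      is_section_mult[OF o(2) regular_on_subset[OF r o(2) Int_lower1]]
    unfolding is_twist_section_def by blast+
  then show ?thesis unfolding is_twist_section_def by (simp add: mult_ac)
qed

lemma is_twist_section_cmult:
  assumes V: "openin T V" and b: "is_twist_section m V b"
  shows "is_twist_section m V (\<lambda>z. r * b z)"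
  using is_twist_section_mult[OF V b regular_on_const[OF V, of r]] by (simp add: mult.commute)

lemma is_twist_section_zero: "openin T V \<Longrightarrow> is_twist_section m V (\<lambda>_. 0)"
  unfolding is_twist_section_def using X0_open X1_open by (simp add: is_section_zero openin_Int)

lemma is_twist_section_sum:
  assumes "openin T V" "\<And>i. i \<in> I \<Longrightarrow> is_twist_section m V (h i)"
  shows "is_twist_section m V (\<lambda>z. \<Sum>i\<in>I. h i z)"
  using assms(2)
proof (induction I rule: infinite_finite_induct)
  case (insert i I)
  have "is_twist_section m V (\<lambda>z. h i z + (\<Sum>i\<in>I. h i z))"
    by (rule is_twist_section_add[OF assms(1)]) (use insert in auto)
  then show ?case using insert(1,2) by simp
qed (use is_twist_section_zero[OF assms(1)] in simp_all)

lemma is_twist_section_subset: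
  assumes V: "openin T V" and W: "openin T W" "W \<subseteq> V" and b: "is_twist_section m V b"
  shows "is_twist_section m W b"
proof -
  have "W \<inter> X0 \<subseteq> V \<inter> X0" "W \<inter> X1 \<subseteq> V \<inter> X1" using W(2) by auto
  then show ?thesis
    using b is_section_subset openin_Int[OF V X0_open] openin_Int[OF V X1_open]
      openin_Int[OF W(1) X0_open] openin_Int[OF W(1) X1_open]
    unfolding is_twist_section_def by blast
qed

text \<open>The equation is tested on \<open>Xo\<close> only, because the functions b x represent
  sections only there. First cohomology of the twist appears as cochains modulo this space.\<close>

definition twist_coboundaries ::
    "int \<Rightarrow> ('k proj_point \<times> 'k proj_point \<times> 'k proj_point \<Rightarrow> 'k) set" where
  "twist_coboundaries m = {c. \<exists>U b. point_cover T U \<and>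
     (\<forall>x\<in>topspace T. is_twist_section m (U x) (b x)) \<and>
     (\<forall>x\<in>topspace T. \<forall>y\<in>topspace T. \<forall>z\<in>U x \<inter> U y \<inter> Xo. c (x, y, z) = b y z - b x z)}"

lemma twist_coboundariesI:
  assumes "point_cover T U" "\<And>x. x \<in> topspace T \<Longrightarrow> is_twist_section m (U x) (b x)"
    "\<And>x y z. x \<in> topspace T \<Longrightarrow> y \<in> topspace T \<Longrightarrow> z \<in> U x \<Longrightarrow> z \<in> U y \<Longrightarrow> z \<in> Xo \<Longrightarrow>
      c (x, y, z) = b y z - b x z"
  shows "c \<in> twist_coboundaries m"
  unfolding twist_coboundaries_def using assms
  by (intro CollectI exI[of _ U] exI[of _ b]) auto

lemma twist_coboundariesE:
  assumes "c \<in> twist_coboundaries m"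
  obtains U b where "\<And>x. x \<in> topspace T \<Longrightarrow> openin T (U x)" "\<And>x. x \<in> topspace T \<Longrightarrow> x \<in> U x"
    "\<And>x. x \<in> topspace T \<Longrightarrow> is_twist_section m (U x) (b x)"
    "\<And>x y z. x \<in> topspace T \<Longrightarrow> y \<in> topspace T \<Longrightarrow> z \<in> U x \<Longrightarrow> z \<in> U y \<Longrightarrow> z \<in> Xo \<Longrightarrow>
      c (x, y, z) = b y z - b x z"
proof -
  obtain U b where *: "point_cover T U" "\<forall>x\<in>topspace T. is_twist_section m (U x) (b x)"
    "\<forall>x\<in>topspace T. \<forall>y\<in>topspace T. \<forall>z\<in>U x \<inter> U y \<inter> Xo. c (x, y, z) = b y z - b x z"
    using assms unfolding twist_coboundaries_def by blast
  show thesis by (rule that[of U b]) (use * in \<open>auto simp: point_cover_def\<close>)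
qed

lemma twist_coboundaries_zero: "(\<lambda>_. 0) \<in> twist_coboundaries m"
  by (rule twist_coboundariesI[of "\<lambda>_. topspace T" _ "\<lambda>_ _. 0"])
    (auto simp: point_cover_def is_twist_section_zero simp del: topspace_subtopology)

lemma twist_coboundaries_add:
  assumes "c \<in> twist_coboundaries m" "d \<in> twist_coboundaries m"
  shows "(\<lambda>x. c x + d x) \<in> twist_coboundaries m"
proof -
  obtain U b where U: "\<And>x. x \<in> topspace T \<Longrightarrow> openin T (U x)" "\<And>x. x \<in> topspace T \<Longrightarrow> x \<in> U x"
    "\<And>x. x \<in> topspace T \<Longrightarrow> is_twist_section m (U x) (b x)"
    "\<And>x y z. x \<in> topspace T \<Longrightarrow> y \<in> topspace T \<Longrightarrow> z \<in> U x \<Longrightarrow> z \<in> U y \<Longrightarrow> z \<in> Xo \<Longrightarrow>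
      c (x, y, z) = b y z - b x z"
    by (rule twist_coboundariesE[OF assms(1)], rule that, assumption+)
  obtain V e where V: "\<And>x. x \<in> topspace T \<Longrightarrow> openin T (V x)" "\<And>x. x \<in> topspace T \<Longrightarrow> x \<in> V x"
    "\<And>x. x \<in> topspace T \<Longrightarrow> is_twist_section m (V x) (e x)"
    "\<And>x y z. x \<in> topspace T \<Longrightarrow> y \<in> topspace T \<Longrightarrow> z \<in> V x \<Longrightarrow> z \<in> V y \<Longrightarrow> z \<in> Xo \<Longrightarrow>
      d (x, y, z) = e y z - e x z"
    by (rule twist_coboundariesE[OF assms(2)], rule that, assumption+)
  show ?thesis
  proof (rule twist_coboundariesI[of "\<lambda>x. U x \<inter> V x" m "\<lambda>x z. b x z + e x z"])
    show "point_cover T (\<lambda>x. U x \<inter> V x)" using U(1,2) V(1,2) by (simp add: point_cover_def openin_Int)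
    fix x assume x: "x \<in> topspace T"
    note o = openin_Int[OF U(1)[OF x] V(1)[OF x]]
    show "is_twist_section m (U x \<inter> V x) (\<lambda>z. b x z + e x z)"
      by (rule is_twist_section_add[OF o is_twist_section_subset[OF U(1)[OF x] o _ U(3)[OF x]]
        is_twist_section_subset[OF V(1)[OF x] o _ V(3)[OF x]]]) auto
  next
    fix x y z assume "x \<in> topspace T" "y \<in> topspace T" "z \<in> U x \<inter> V x" "z \<in> U y \<inter> V y" "z \<in> Xo"
    then show "c (x, y, z) + d (x, y, z) = b y z + e y z - (b x z + e x z)"
      using U(4)[of x y z] V(4)[of x y z] by simp
  qed
qed

lemma twist_coboundaries_cmult:
  assumes "c \<in> twist_coboundaries m"
  shows "(\<lambda>x. r * c x) \<in> twist_coboundaries m"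
proof -
  obtain U b where U: "\<And>x. x \<in> topspace T \<Longrightarrow> openin T (U x)" "\<And>x. x \<in> topspace T \<Longrightarrow> x \<in> U x"
    "\<And>x. x \<in> topspace T \<Longrightarrow> is_twist_section m (U x) (b x)"
    "\<And>x y z. x \<in> topspace T \<Longrightarrow> y \<in> topspace T \<Longrightarrow> z \<in> U x \<Longrightarrow> z \<in> U y \<Longrightarrow> z \<in> Xo \<Longrightarrow>
      c (x, y, z) = b y z - b x z"
    by (rule twist_coboundariesE[OF assms], rule that, assumption+)
  show ?thesis
  proof (rule twist_coboundariesI[of U m "\<lambda>x z. r * b x z"])
    show "point_cover T U" using U(1,2) by (simp add: point_cover_def)
    show "is_twist_section m (U x) (\<lambda>z. r * b x z)" if "x \<in> topspace T" for x
      by (rule is_twist_section_cmult[OF U(1,3)]) (rule that)+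
    fix x y z assume "x \<in> topspace T" "y \<in> topspace T" "z \<in> U x" "z \<in> U y" "z \<in> Xo"
    then show "r * c (x, y, z) = r * b y z - r * b x z"
      using U(4)[of x y z] by (simp add: right_diff_distrib)
  qed
qed

lemma twist_coboundaries_sum:
  assumes "\<And>i. i \<in> I \<Longrightarrow> c i \<in> twist_coboundaries m"
  shows "(\<lambda>x. \<Sum>i\<in>I. c i x) \<in> twist_coboundaries m"
  using assms
proof (induction I rule: infinite_finite_induct)
  case (insert i I)
  have "(\<lambda>x. c i x + (\<Sum>i\<in>I. c i x)) \<in> twist_coboundaries m"
    by (rule twist_coboundaries_add) (use insert in auto)
  then show ?case using insert(1,2) by simp
qed (use twist_coboundaries_zero in simp_all)

text \<open>This makes multiplication by a global section well defined from the first cohomology of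
  the structure sheaf to that of the twist.\<close>

lemma twist_coboundaries_mult:
  assumes c: "c \<in> cech_coboundaries T" and s: "is_twist_section m (topspace T) s"
  shows "(\<lambda>(x, y, z). s z * c (x, y, z)) \<in> twist_coboundaries m"
proof -
  obtain U b where U: "point_cover T U"
    "\<forall>x\<in>topspace T. restrict (b x) (U x) \<in> regular_functions T (U x)"
    "\<forall>x\<in>topspace T. \<forall>y\<in>topspace T. \<forall>z\<in>U x \<inter> U y. c (x, y, z) = b y z - b x z"
    using c unfolding cech_coboundaries_def by blast
  show ?thesis
  proof (rule twist_coboundariesI[OF U(1), of m "\<lambda>x z. s z * b x z"])
    fix x assume x: "x \<in> topspace T"
    then have o: "openin T (U x)" using U(1) by (simp add: point_cover_def)
    show "is_twist_section m (U x) (\<lambda>z. s z * b x z)"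
      by (rule is_twist_section_mult[OF o is_twist_section_subset[OF openin_topspace o openin_subset[OF o] s]])
        (use U(2) x in \<open>simp add: regular_on_def\<close>)
  qed (use U(3) in \<open>auto simp: right_diff_distrib\<close>)
qed

text \<open>
  The alternating cochain of a function \<open>w\<close> on \<open>X0 \<inter> X1\<close>, on covers that refine the cover by
  \<open>X0\<close> and \<open>X1\<close>.
\<close>

definition side :: "'k proj_point \<Rightarrow> 'k" where
  "side x = (if x \<in> X0 then 0 else 1)"

definition cochain :: "('k proj_point \<Rightarrow> 'k) \<Rightarrow> 'k proj_point \<times> 'k proj_point \<times> 'k proj_point \<Rightarrow> 'k" where
  "cochain w = (\<lambda>(x, y, z). (side y - side x) * w z)"

text \<open>A class of the two-set cover that dies on some cover already dies on \<open>X0\<close>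
  and \<open>X1\<close>. To see this, the family b is replaced by its diagonal, the function sending
  z to \<open>b z z\<close>, which is meaningful because z \<in> U z: up to a multiple of w it
  agrees with each b x on \<open>V x \<inter> Xo\<close>, so it glues.\<close>

lemma cochain_coboundary_split:
  assumes cob: "cochain w \<in> twist_coboundaries m" and w: "is_section (X0 \<inter> X1) w"
  shows "\<exists>b0 b1. is_section X0 b0 \<and> is_section X1 b1 \<and> (\<forall>z\<in>Xo. w z = u z powi m * b1 z - b0 z)"
proof -
  obtain U b where U: "\<And>x. x \<in> topspace T \<Longrightarrow> openin T (U x)" "\<And>x. x \<in> topspace T \<Longrightarrow> x \<in> U x"
    "\<And>x. x \<in> topspace T \<Longrightarrow> is_twist_section m (U x) (b x)"
    "\<And>x y z. x \<in> topspace T \<Longrightarrow> y \<in> topspace T \<Longrightarrow> z \<in> U x \<Longrightarrow> z \<in> U y \<Longrightarrow> z \<in> Xo \<Longrightarrow>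
      cochain w (x, y, z) = b y z - b x z"
    by (rule twist_coboundariesE[OF cob], rule that, assumption+)
  define V where "V x = U x \<inter> (if x \<in> X0 then X0 else X1)" for x
  have V: "openin T (V x)" "x \<in> V x" if x: "x \<in> topspace T" for x
    using U(1,2)[OF x] X0_open X1_open x cover by (auto simp: V_def openin_Int)
  have bV: "is_section (V x \<inter> X0) (b x)" "is_section (V x \<inter> X1) (\<lambda>z. u z powi (- m) * b x z)"
    if x: "x \<in> topspace T" for x
    using is_twist_section_subset[OF U(1)[OF x] V(1)[OF x] _ U(3)[OF x]]
    by (auto simp: V_def is_twist_section_def)
  \<comment> \<open>Points of \<open>Xo\<close> have side 0, so the coboundary equation with y = z
    compares b x with the diagonal: they agree if x \<in> X0 and differ by w otherwise.\<close>
  have diag: "b z z = b x z - side x * w z" if x: "x \<in> topspace T" and z: "z \<in> V x" "z \<in> Xo" for x z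
  proof -
    have zT: "z \<in> topspace T" "side z = 0"
      using z(2) Xo_subset openin_subset[OF Xo_open] by (auto simp: side_def)
    have "cochain w (x, z, z) = b z z - b x z"
      by (rule U(4)[OF x zT(1) _ U(2)[OF zT(1)] z(2)]) (use z(1) in \<open>simp add: V_def\<close>)
    then show ?thesis using zT(2) by (simp add: cochain_def algebra_simps)
  qed
  have "is_section (V x \<inter> X0) (\<lambda>z. b z z)" if x: "x \<in> topspace T" for x
  proof (cases "x \<in> X0")
    case True
    show ?thesis
      by (rule is_section_cong[OF bV(1)[OF x]]) (use diag[OF x] True in \<open>auto simp: side_def\<close>)
  next
    case False
    have o: "openin T (V x \<inter> X0)" "V x \<inter> X0 \<subseteq> X0 \<inter> X1"
      using V(1)[OF x] X0_open False by (auto simp: V_def)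
    have "is_section (V x \<inter> X0) (\<lambda>z. b x z + (- 1) * w z)"
      by (intro is_section_add[OF o(1) bV(1)[OF x]] is_section_cmult[OF o(1)]
          is_section_subset[OF X01_open o w])
    then show ?thesis
      by (rule is_section_cong) (use diag[OF x] False in \<open>auto simp: side_def\<close>)
  qed
  then have "is_section (\<Union>((\<lambda>x. V x \<inter> X0) ` topspace T)) (\<lambda>z. b z z)"
    using V(1) X0_open by (intro is_section_glue) (auto simp: openin_Int simp del: topspace_subtopology)
  moreover have "\<Union>((\<lambda>x. V x \<inter> X0) ` topspace T) = X0"
    using V(2) openin_subset[OF X0_open] by blast
  ultimately have b0: "is_section X0 (\<lambda>z. b z z)" by simp
  \<comment> \<open>For x outside \<open>X0\<close> the sum \<open>b z z + w z\<close> is just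
    \<open>b x z\<close>; for x in \<open>X0\<close> the additional w is a section on the overlap.
    The power of u is the change of frame from \<open>X0\<close> to \<open>X1\<close>.\<close>
  let ?b1 = "\<lambda>z. u z powi (- m) * (b z z + w z)"
  have "is_section (V x \<inter> X1) ?b1" if x: "x \<in> topspace T" for x
  proof (cases "x \<in> X0")
    case True
    have o: "openin T (V x \<inter> X1)" "V x \<inter> X1 \<subseteq> X0 \<inter> X1"
      using V(1)[OF x] X1_open True by (auto simp: V_def)
    have "is_section (V x \<inter> X1) (\<lambda>z. u z powi (- m) * b x z + u z powi (- m) * w z)"
      by (intro is_section_add[OF o(1) bV(2)[OF x]] is_section_subset[OF X01_open o]
          is_section_mult[OF X01_open regular_on_u_powi w])
    then show ?thesis
      by (rule is_section_cong) (use diag[OF x] True in \<open>auto simp: side_def distrib_left\<close>)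
  next
    case False
    show ?thesis
      by (rule is_section_cong[OF bV(2)[OF x]]) (use diag[OF x] False in \<open>auto simp: side_def\<close>)
  qed
  then have "is_section (\<Union>((\<lambda>x. V x \<inter> X1) ` topspace T)) ?b1"
    using V(1) X1_open by (intro is_section_glue) (auto simp: openin_Int simp del: topspace_subtopology)
  moreover have "\<Union>((\<lambda>x. V x \<inter> X1) ` topspace T) = X1"
    using V(2) openin_subset[OF X1_open] by blast
  ultimately have b1: "is_section X1 ?b1" by simp
  have "w z = u z powi m * ?b1 z - b z z" if z: "z \<in> Xo" for z
  proof -
    have "u z \<noteq> 0" by (rule u_nonzero) (use z Xo_subset in blast)
    then have "u z powi m * u z powi (- m) = 1" by (simp add: power_int_minus)
    then show ?thesis by (simp flip: mult.assoc)
  qed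
  then show ?thesis using b0 b1 by blast
qed

text \<open>
  Multiplication by a nonzero section of the twist is surjective on first cohomology: the
  section is invertible on \<open>X0 \<inter> U1\<close>, where \<open>U1\<close> is obtained from \<open>X1\<close> by removing finitely
  many points of \<open>X0\<close>.
\<close>

lemma cocycle_quotient:
  assumes s: "is_twist_section m (topspace T) s" and nz: "z0 \<in> Xo" "s z0 \<noteq> 0"
    and w: "is_section (X0 \<inter> X1) w"
  shows "\<exists>c\<in>cech_cocycles T. (\<lambda>(x, y, z). s z * c (x, y, z) - cochain w (x, y, z)) \<in> twist_coboundaries m"
proof -
  have TX0: "topspace T \<inter> X0 = X0" using openin_subset[OF X0_open] by blast
  have XoE: "X0 \<inter> Xo = Xo" "X0 \<inter> X1 \<inter> Xo = Xo" using Xo_subset by auto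
  have rs: "regular_on T Xo s"
    using is_section_regular[OF X0_open] s unfolding is_twist_section_def TX0 by (simp add: XoE)
  have rw: "regular_on T Xo w" using is_section_regular[OF X01_open w] by (simp add: XoE)
  define D where "D = {z \<in> Xo. s z \<noteq> 0}"
  have D: "openin T D" "D \<noteq> {}" "D \<subseteq> Xo" "D \<subseteq> X0" "D \<subseteq> X1"
    using regular_on_nonzero_open[OF rs] nz Xo_subset by (auto simp: D_def)
  have fin: "finite (X - D)" by (rule curve_openin_cofinite[OF closed irreducible dim D(1,2)])
  have X0X: "X0 \<subseteq> X" using openin_subset[OF X0_open] topspace_T by simp
  have "finite (X0 - D)" by (rule finite_subset[OF _ fin]) (use X0X in blast)
  then have "closedin (zariski N) (X0 - D)"
    by (rule closedin_zariski_finite) (use openin_subset[OF X0_open] in auto)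
  then have "closedin T (X0 - D)" using closedin_closed_subtopology[OF closed] X0X by blast
  then have U1: "openin T (topspace T - (X0 - D))" by blast
  define U where "U x = (if x \<in> X0 then X0 else topspace T - (X0 - D))" for x
  have pc: "point_cover T U" using X0_open U1 by (auto simp: point_cover_def U_def simp del: topspace_subtopology)
  have inter: "U x \<inter> U y = D" if "side x \<noteq> side y" for x y
    using that D(4) openin_subset[OF X0_open] by (auto simp: U_def side_def split: if_splits)
  \<comment> \<open>Off D the quotient may have junk values, but there the two sides are equal and
    the cochain carries the factor 0.\<close>
  let ?q = "\<lambda>z. w z / s z"
  have rq: "regular_on T D ?q"
  proof -
    have "regular_on T D (\<lambda>z. w z * inverse (s z))"
      by (intro regular_on_mult regular_on_inverse regular_on_subset[OF rw D(1,3)]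
          regular_on_subset[OF rs D(1,3)]) (auto simp: D_def)
    then show ?thesis by (simp add: divide_inverse)
  qed
  have "cochain ?q \<in> cech_cocycles T"
    unfolding cech_cocycles_def
  proof (intro CollectI exI[of _ U] conjI ballI)
    fix x y assume xy: "x \<in> topspace T" "y \<in> topspace T"
    have o: "openin T (U x \<inter> U y)" using pc xy by (simp add: point_cover_def openin_Int)
    have "regular_on T (U x \<inter> U y) (\<lambda>z. (side y - side x) * ?q z)"
    proof (cases "side x = side y")
      case True
      then show ?thesis using regular_on_const[OF o, of 0] by simp
    next
      case False
      show ?thesis unfolding inter[OF False] by (rule regular_on_cmult[OF D(1) rq])
    qed
    then show "restrict (\<lambda>z. cochain ?q (x, y, z)) (U x \<inter> U y) \<in> regular_functions T (U x \<inter> U y)"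
      by (simp add: cochain_def regular_on_def)
  qed (use pc in \<open>auto simp: cochain_def algebra_simps\<close>)
  \<comment> \<open>The difference is identically zero on this cover, so zero functions serve as its
    bounding family.\<close>
  moreover have "(\<lambda>(x, y, z). s z * cochain ?q (x, y, z) - cochain w (x, y, z)) \<in> twist_coboundaries m"
  proof (rule twist_coboundariesI[OF pc, of m "\<lambda>_ _. 0"])
    show "is_twist_section m (U x) (\<lambda>_. 0)" if "x \<in> topspace T" for x
      using pc that by (simp add: point_cover_def is_twist_section_zero)
    fix x y z assume z: "z \<in> U x" "z \<in> U y"
    have "s z \<noteq> 0" if "side x \<noteq> side y"
      using inter[OF that] z unfolding D_def by blast
    then have "s z \<noteq> 0 \<or> side y = side x" by metis
    then show "(case (x, y, z) of (x, y, z) \<Rightarrow> s z * cochain ?q (x, y, z) - cochain w (x, y, z)) = 0 - 0"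
      by (auto simp: cochain_def)
  qed
  ultimately show ?thesis by blast
qed

section \<open>Bounds by the genus\<close>

lemma genus_basis:
  obtains e where "\<And>c. c \<in> cech_cocycles T \<Longrightarrow>
    \<exists>r :: nat \<Rightarrow> 'k. (\<lambda>x. c x - (\<Sum>k<g. r k * e k x)) \<in> cech_coboundaries T"
proof -
  obtain e :: "nat \<Rightarrow> 'k proj_point \<times> 'k proj_point \<times> 'k proj_point \<Rightarrow> 'k" where
    e: "\<forall>z\<in>cech_cocycles T. \<exists>!c :: nat \<Rightarrow> 'k. (\<forall>i\<ge>g. c i = 0) \<and>
      (\<lambda>x. z x - (\<Sum>i<g. c i * e i x)) \<in> cech_coboundaries T"
    using genus unfolding has_genus_def quot_dim_def by blast
  show ?thesis by (rule that[of e]) (use e in blast)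
qed

text \<open>The hypothesis \<open>indep\<close> expresses that the classes of the w i are linearly
  independent in the first cohomology of the twist. Each of them is s times a class of the structure
  sheaf, and these are combinations of g classes, so more than g of them would be dependent.\<close>

lemma cohomology_dim_le_genus:
  assumes s: "is_twist_section m (topspace T) s" and nz: "z0 \<in> Xo" "s z0 \<noteq> 0"
    and I: "finite I" and w: "\<And>i. i \<in> I \<Longrightarrow> is_section (X0 \<inter> X1) (w i)"
    and indep: "\<And>r b0 b1 i. is_section X0 b0 \<Longrightarrow> is_section X1 b1 \<Longrightarrow>
      (\<And>z. z \<in> Xo \<Longrightarrow> (\<Sum>i\<in>I. r i * w i z) = u z powi m * b1 z - b0 z) \<Longrightarrow> i \<in> I \<Longrightarrow> r i = 0"
  shows "card I \<le> g"
proof (rule ccontr)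
  assume "\<not> card I \<le> g"
  then have card: "card I > g" by simp
  obtain e where e: "\<And>c. c \<in> cech_cocycles T \<Longrightarrow>
    \<exists>r :: nat \<Rightarrow> 'k. (\<lambda>x. c x - (\<Sum>k<g. r k * e k x)) \<in> cech_coboundaries T" by (rule genus_basis, rule that, assumption+)
  have "\<forall>i. \<exists>c. i \<in> I \<longrightarrow> c \<in> cech_cocycles T \<and>
    (\<lambda>(x, y, z). s z * c (x, y, z) - cochain (w i) (x, y, z)) \<in> twist_coboundaries m"
    using cocycle_quotient[OF s nz w] by blast
  from choice[OF this] obtain c where c: "\<And>i. i \<in> I \<Longrightarrow> c i \<in> cech_cocycles T"
    "\<And>i. i \<in> I \<Longrightarrow> (\<lambda>(x, y, z). s z * c i (x, y, z) - cochain (w i) (x, y, z)) \<in> twist_coboundaries m"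
    by blast
  have "\<forall>i. \<exists>r :: nat \<Rightarrow> 'k. i \<in> I \<longrightarrow> (\<lambda>x. c i x - (\<Sum>k<g. r k * e k x)) \<in> cech_coboundaries T"
    using e c(1) by blast
  from choice[OF this] obtain A :: "'a \<Rightarrow> nat \<Rightarrow> 'k"
    where A: "\<And>i. i \<in> I \<Longrightarrow> (\<lambda>x. c i x - (\<Sum>k<g. A i k * e k x)) \<in> cech_coboundaries T"
    by blast
  obtain r where r: "\<exists>i\<in>I. r i \<noteq> 0" "\<And>k. k < g \<Longrightarrow> (\<Sum>i\<in>I. r i * A i k) = 0"
    using linear_dependence[OF I card, of A] by blast
  let ?W = "\<lambda>z. \<Sum>i\<in>I. r i * w i z"
  \<comment> \<open>In each summand the terms s * c i cancel, leaving \<open>cochain (w i)\<close>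
    minus a combination of the s * e k. With the weights r i these combinations add up to
    zero.\<close>
  have "(\<lambda>x. \<Sum>i\<in>I. r i * ((case x of (x, y, z) \<Rightarrow> s z * (c i (x, y, z) - (\<Sum>k<g. A i k * e k (x, y, z)))) +
      (-1) * (case x of (x, y, z) \<Rightarrow> s z * c i (x, y, z) - cochain (w i) (x, y, z)))) \<in> twist_coboundaries m"
    by (intro twist_coboundaries_sum twist_coboundaries_cmult twist_coboundaries_add c(2)
        twist_coboundaries_mult[OF A s])
  also have "(\<lambda>x. \<Sum>i\<in>I. r i * ((case x of (x, y, z) \<Rightarrow> s z * (c i (x, y, z) - (\<Sum>k<g. A i k * e k (x, y, z)))) +
      (-1) * (case x of (x, y, z) \<Rightarrow> s z * c i (x, y, z) - cochain (w i) (x, y, z)))) = cochain ?W"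
  proof
    fix xyz :: "'k proj_point \<times> 'k proj_point \<times> 'k proj_point"
    obtain x y z where xyz: "xyz = (x, y, z)" by (cases xyz)
    have "(\<Sum>i\<in>I. r i * (\<Sum>k<g. A i k * e k (x, y, z))) = (\<Sum>k<g. (\<Sum>i\<in>I. r i * A i k) * e k (x, y, z))"
      by (simp add: sum_distrib_left sum_distrib_right mult.assoc) (rule sum.swap)
    also have "\<dots> = 0" using r(2) by simp
    finally have zero: "(\<Sum>i\<in>I. r i * (\<Sum>k<g. A i k * e k (x, y, z))) = 0" .
    have "(\<Sum>i\<in>I. r i * (s z * (c i (x, y, z) - (\<Sum>k<g. A i k * e k (x, y, z))) +
        (-1) * (s z * c i (x, y, z) - cochain (w i) (x, y, z)))) =
      (\<Sum>i\<in>I. r i * cochain (w i) (x, y, z) - s z * (r i * (\<Sum>k<g. A i k * e k (x, y, z))))"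
      by (rule sum.cong[OF refl]) (simp add: algebra_simps)
    also have "\<dots> = (\<Sum>i\<in>I. r i * cochain (w i) (x, y, z))"
      by (simp add: sum_subtractf zero flip: sum_distrib_left)
    also have "\<dots> = cochain ?W (x, y, z)"
      unfolding cochain_def prod.case sum_distrib_left by (rule sum.cong) (simp_all only: mult_ac)
    finally show "(\<Sum>i\<in>I. r i * ((case xyz of (x, y, z) \<Rightarrow> s z * (c i (x, y, z) - (\<Sum>k<g. A i k * e k (x, y, z)))) +
      (-1) * (case xyz of (x, y, z) \<Rightarrow> s z * c i (x, y, z) - cochain (w i) (x, y, z)))) = cochain ?W xyz"
      by (simp add: xyz)
  qed
  finally have "cochain ?W \<in> twist_coboundaries m" .
  moreover have "is_section (X0 \<inter> X1) ?W"
    by (intro is_section_sum[OF X01_open] is_section_cmult[OF X01_open] w)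
  ultimately obtain b0 b1 where "is_section X0 b0" "is_section X1 b1"
    "\<forall>z\<in>Xo. ?W z = u z powi m * b1 z - b0 z" using cochain_coboundary_split by blast
  then have "r i = 0" if "i \<in> I" for i using indep[of b0 b1 r i] that by blast
  then show False using r(1) by blast
qed

text \<open>
  If the first cohomology of the twist is nonzero, then a nonzero functional \<open>\<alpha>\<close> on it pairs
  global sections with the first cohomology of the structure sheaf, and the pairing is nondegenerate
  on the side of the sections.
\<close>

lemma sections_dim_le_genus:
  assumes I: "finite I" and s: "\<And>i. i \<in> I \<Longrightarrow> is_twist_section m (topspace T) (s i)"
    and indep: "\<And>r i. (\<And>z. z \<in> Xo \<Longrightarrow> (\<Sum>i\<in>I. r i * s i z) = 0) \<Longrightarrow> i \<in> I \<Longrightarrow> r i = 0"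
    and w: "is_section (X0 \<inter> X1) w"
    and nontrivial: "\<And>b0 b1. is_section X0 b0 \<Longrightarrow> is_section X1 b1 \<Longrightarrow>
      \<exists>z\<in>Xo. w z \<noteq> u z powi m * b1 z - b0 z"
  shows "card I \<le> g"
proof (rule ccontr)
  assume "\<not> card I \<le> g"
  then have card: "card I > g" by simp
  obtain e where e: "\<And>c. c \<in> cech_cocycles T \<Longrightarrow>
    \<exists>r :: nat \<Rightarrow> 'k. (\<lambda>x. c x - (\<Sum>k<g. r k * e k x)) \<in> cech_coboundaries T" by (rule genus_basis, rule that, assumption+)
  have notin: "cochain w \<notin> twist_coboundaries m"
    using cochain_coboundary_split[OF _ w, of m] nontrivial by blast
  obtain \<alpha> where \<alpha>: "\<And>b c. \<alpha> (\<lambda>x. b x + c x) = \<alpha> b + \<alpha> c" "\<And>r b. \<alpha> (\<lambda>x. r * b x) = r * \<alpha> b"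
    "\<And>b. b \<in> twist_coboundaries m \<Longrightarrow> \<alpha> b = 0" "\<alpha> (cochain w) = 1"
    by (rule linear_functional_exists[of "twist_coboundaries m" "cochain w"],
        rule twist_coboundaries_zero, rule twist_coboundaries_add, assumption+,
        rule twist_coboundaries_cmult, assumption, rule notin, rule that, assumption+)
  note \<alpha>sum = linear_functional_sum[of \<alpha>, OF \<alpha>(1,2)]
  let ?m = "\<lambda>t c. \<lambda>(x, y, z). t z * c (x, y, z) :: 'k"
  \<comment> \<open>With more than g sections, some nontrivial combination t of them is orthogonal
    to every e k under the pairing that sends s and c to the value of \<open>\<alpha>\<close> at s *
    c.\<close>
  obtain r where r: "\<exists>i\<in>I. r i \<noteq> 0" "\<And>k. k < g \<Longrightarrow> (\<Sum>i\<in>I. r i * \<alpha> (?m (s i) (e k))) = 0"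
    using linear_dependence[OF I card, of "\<lambda>i k. \<alpha> (?m (s i) (e k))"] by blast
  define t where "t z = (\<Sum>i\<in>I. r i * s i z)" for z
  have t: "is_twist_section m (topspace T) t"
    unfolding t_def
    by (intro is_twist_section_sum is_twist_section_cmult openin_topspace s)
  obtain z0 where z0: "z0 \<in> Xo" "t z0 \<noteq> 0" using indep[of r] r(1) unfolding t_def by blast
  have te: "\<alpha> (?m t (e k)) = 0" if "k < g" for k
  proof -
    have "?m t (e k) = (\<lambda>x. \<Sum>i\<in>I. r i * ?m (s i) (e k) x)"
      by (auto simp: t_def sum_distrib_right mult.assoc)
    then show ?thesis using \<alpha>sum[of r "\<lambda>i. ?m (s i) (e k)" I] r(2)[OF that] by simp
  qed
  \<comment> \<open>As t is not zero, the class of w is t times some class c, which is a combination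
    of the e k. Hence \<open>\<alpha>\<close> vanishes on it, although it was normalized to
    1.\<close>
  obtain c where c: "c \<in> cech_cocycles T"
    "(\<lambda>(x, y, z). t z * c (x, y, z) - cochain w (x, y, z)) \<in> twist_coboundaries m"
    using cocycle_quotient[OF t z0 w] by blast
  obtain q where q: "(\<lambda>x. c x - (\<Sum>k<g. q k * e k x)) \<in> cech_coboundaries T" using e[OF c(1)] by blast
  have "?m t c = (\<lambda>x. ?m t (\<lambda>x. c x - (\<Sum>k<g. q k * e k x)) x + (\<Sum>k<g. q k * ?m t (e k) x))"
    by (auto simp: right_diff_distrib sum_distrib_left mult_ac)
  then have "\<alpha> (?m t c) = \<alpha> (?m t (\<lambda>x. c x - (\<Sum>k<g. q k * e k x))) + \<alpha> (\<lambda>x. \<Sum>k<g. q k * ?m t (e k) x)"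
    by (simp only: \<alpha>(1))
  also have "\<alpha> (?m t (\<lambda>x. c x - (\<Sum>k<g. q k * e k x))) = 0"
    by (rule \<alpha>(3)[OF twist_coboundaries_mult[OF q t]])
  also have "\<alpha> (\<lambda>x. \<Sum>k<g. q k * ?m t (e k) x) = 0"
    using \<alpha>sum[of q "\<lambda>k. ?m t (e k)" "{..<g}"] te by simp
  finally have tc: "\<alpha> (?m t c) = 0" by simp
  have "?m t c = (\<lambda>x. (\<lambda>(x, y, z). t z * c (x, y, z) - cochain w (x, y, z)) x + cochain w x)" by auto
  then have "\<alpha> (?m t c) = \<alpha> (\<lambda>(x, y, z). t z * c (x, y, z) - cochain w (x, y, z)) + \<alpha> (cochain w)"
    by (simp only: \<alpha>(1))
  then show False using tc \<alpha>(3)[OF c(2)] \<alpha>(4) by simp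
qed

end

section \<open>The splitting gap\<close>

context split_curve
begin

section \<open>Monomials as sections and as cohomology classes\<close>

lemma monomial_is_section:
  assumes "j \<in> {1..n}"
  shows "i \<ge> 0 \<Longrightarrow> is_section X0 (\<lambda>z. u z powi i * \<theta> j z)"
    and "i \<le> a j \<Longrightarrow> is_section X1 (\<lambda>z. u z powi i * \<theta> j z)"
    and "is_section (X0 \<inter> X1) (\<lambda>z. u z powi i * \<theta> j z)"
proof -
  have o: "openin (zariski 1) (std_open 0 :: 'k proj_point set)" "openin (zariski 1) (std_open 1 :: 'k proj_point set)"
    by (rule openin_std_open, simp)+
  show "is_section X0 (\<lambda>z. u z powi i * \<theta> j z)" if "i \<ge> 0"
    unfolding X0_def by (rule is_section_monomial[OF o(1) _ _ _ _ assms]) (use that in auto)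
  show "is_section X1 (\<lambda>z. u z powi i * \<theta> j z)" if "i \<le> a j"
    unfolding X1_def by (rule is_section_monomial[OF o(2) _ _ _ _ assms]) (use that in auto)
  show "is_section (X0 \<inter> X1) (\<lambda>z. u z powi i * \<theta> j z)"
    unfolding pre_U01[symmetric] by (rule is_section_monomial[OF std_open_Int_open _ _ _ _ assms]) auto
qed

text \<open>These exponents belong to the monomials of degree a j + m, a basis of H^0(O(a j + m)).
  The upper bound comes from \<open>X1\<close>, where the change of frame shifts the exponent by -
  m.\<close>

lemma monomial_is_twist_section:
  assumes "j \<in> {1..n}" "0 \<le> i" "i \<le> a j + m"
  shows "is_twist_section m (topspace T) (\<lambda>z. u z powi i * \<theta> j z)"
proof -
  have eq: "topspace T \<inter> X0 = X0" "topspace T \<inter> X1 = X1" using cover by auto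
  have "is_section X1 (\<lambda>z. u z powi (i - m) * \<theta> j z)"
    by (rule monomial_is_section(2)[OF assms(1)]) (use assms(3) in simp)
  then have "is_section X1 (\<lambda>z. u z powi (- m) * (u z powi i * \<theta> j z))"
  proof (rule is_section_cong)
    fix z assume "z \<in> X1 \<inter> Xo"
    then have "u z \<noteq> 0" using u_nonzero Xo_subset by blast
    then have "u z powi (i - m) = u z powi (- m) * u z powi i" by (simp flip: power_int_add)
    then show "u z powi (i - m) * \<theta> j z = u z powi (- m) * (u z powi i * \<theta> j z)" by simp
  qed
  then show ?thesis
    unfolding is_twist_section_def eq using monomial_is_section(1)[OF assms(1,2)] by blast
qed

lemma regular_on_laurent:
  "regular_on (zariski 1) U01 (\<lambda>q. \<Sum>i\<in>S. c i * affine_coord q powi i)"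
  by (intro regular_on_sum[OF std_open_Int_open] regular_on_cmult[OF std_open_Int_open] regular_on_coord_powi)

text \<open>By \<open>theta_independent\<close> the coefficient of each \<open>\<theta> j\<close>
  vanishes for all w \<noteq> 0, hence is zero as a polynomial. Coefficients are indexed by pairs to
  fit sums over the set \<open>Sigma {1..n} S\<close>.\<close>

lemma monomials_independent:
  assumes S: "\<And>j. finite (S j)" "\<And>i j. i \<in> S j \<Longrightarrow> i \<ge> 0"
    and zero: "\<And>z. z \<in> Xo \<Longrightarrow> (\<Sum>j=1..n. \<Sum>i\<in>S j. c (j, i) * (u z powi i * \<theta> j z)) = 0"
    and j: "j \<in> {1..n}" and i: "i \<in> S j"
  shows "c (j, i) = 0"
proof -
  let ?r = "\<lambda>j w. \<Sum>i\<in>S j. c (j, i) * w powi i"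
  have w: "?r j w = 0" if "w \<noteq> 0" for w
  proof (rule theta_independent[OF _ _ j that, of ?r])
    show "regular_on (zariski 1) U01 (\<lambda>q. ?r j (affine_coord q))" for j
      by (rule regular_on_laurent)
    show "(\<Sum>j=1..n. ?r j (u z) * \<theta> j z) = 0" if "z \<in> Xo" for z
      using zero[OF that] by (simp add: sum_distrib_right mult.assoc)
  qed
  have "(\<Sum>i\<in>S j. monom (c (j, i)) (nat i)) = 0"
  proof (rule poly_zero_of_zero_off[of "[:0, 1:]"])
    fix w assume "poly [:0, 1 :: 'k:] w \<noteq> 0"
    then have "w \<noteq> 0" by simp
    have "poly (\<Sum>i\<in>S j. monom (c (j, i)) (nat i)) w = ?r j w"
      unfolding poly_sum by (rule sum.cong) (use S(2) in \<open>auto simp: poly_monom power_int_def\<close>)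
    then show "poly (\<Sum>i\<in>S j. monom (c (j, i)) (nat i)) w = 0" using w[OF \<open>w \<noteq> 0\<close>] by simp
  qed simp
  then have "0 = coeff (\<Sum>i\<in>S j. monom (c (j, i)) (nat i)) (nat i)" by simp
  also have "\<dots> = (\<Sum>i'\<in>S j. if i' = i then c (j, i) else 0)"
    unfolding coeff_sum
  proof (rule sum.cong[OF refl])
    fix i' assume "i' \<in> S j"
    then have "nat i' = nat i \<longleftrightarrow> i' = i" using S(2)[of i' j] S(2)[OF i] by linarith
    then show "coeff (monom (c (j, i')) (nat i')) (nat i) = (if i' = i then c (j, i) else 0)" by simp
  qed
  also have "\<dots> = c (j, i)" using S(1)[of j] i by simp
  finally show ?thesis by simp
qed

text \<open>In the coefficient of \<open>\<theta> j\<close>, b0 contributes exponents \<ge> 0 and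
  \<open>u z powi m * b1 z\<close> contributes exponents \<le> a j + m. The exponents strictly
  between are untouched; they form the usual Cech basis of H^1(O(a j + m)).\<close>

lemma cohomology_monomials_independent:
  assumes S: "\<And>j. finite (S j)" "\<And>i j. i \<in> S j \<Longrightarrow> a j + m < i \<and> i < 0"
    and b: "is_section X0 b0" "is_section X1 b1"
    and eq: "\<And>z. z \<in> Xo \<Longrightarrow>
      (\<Sum>j=1..n. \<Sum>i\<in>S j. c (j, i) * (u z powi i * \<theta> j z)) = u z powi m * b1 z - b0 z"
    and j: "j \<in> {1..n}" and i: "i \<in> S j"
  shows "c (j, i) = 0"
proof -
  obtain p where p: "\<And>z. z \<in> Xo \<Longrightarrow> b0 z = (\<Sum>j=1..n. poly (p j) (u z) * \<theta> j z)"
    using is_section_std_open_0 b(1) unfolding X0_def by blast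
  obtain q where q: "\<And>z. z \<in> Xo \<Longrightarrow>
      b1 z = (\<Sum>j=1..n. u z powi a j * poly (q j) (inverse (u z)) * \<theta> j z)"
    using is_section_std_open_1 b(2) unfolding X1_def by blast
  let ?r = "\<lambda>j w. ((\<Sum>i\<in>S j. c (j, i) * w powi i) + poly (p j) w) -
    w powi m * (w powi a j * poly (q j) (w powi (-1)))"
  have r: "?r j w = 0" if "w \<noteq> 0" for w
  proof (rule theta_independent[OF _ _ j that, of ?r])
    show "regular_on (zariski 1) U01 (\<lambda>q. ?r j (affine_coord q))" for j
      by (intro regular_on_diff[OF std_open_Int_open] regular_on_add regular_on_laurent
          regular_on_mult regular_on_poly[OF std_open_Int_open] regular_on_coord regular_on_coord_powi)
    fix z assume z: "z \<in> Xo"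
    have factor: "(\<Sum>i\<in>S j. c (j, i) * (u z powi i * \<theta> j z)) = (\<Sum>i\<in>S j. c (j, i) * u z powi i) * \<theta> j z" for j
      by (simp add: sum_distrib_right mult.assoc)
    have "(\<Sum>j=1..n. ?r j (u z) * \<theta> j z) =
        (\<Sum>j=1..n. \<Sum>i\<in>S j. c (j, i) * (u z powi i * \<theta> j z)) + b0 z - u z powi m * b1 z"
      unfolding p[OF z] q[OF z] factor sum_distrib_left[of "u z powi m"] sum.distrib[symmetric] sum_subtractf[symmetric]
      by (rule sum.cong[OF refl])
        (simp add: power_int_minus distrib_right left_diff_distrib mult.assoc)
    then show "(\<Sum>j=1..n. ?r j (u z) * \<theta> j z) = 0" using eq[OF z] by simp
  qed
  show ?thesis
  proof (rule laurent_gap[where S = "S j" and e = "a j + m" and c = "\<lambda>i. c (j, i)" and p = "p j" and q = "q j"])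
    fix w :: 'k assume w: "w \<noteq> 0"
    have "w powi (a j + m) = w powi m * w powi a j" using w by (simp add: power_int_add)
    then show "(\<Sum>i\<in>S j. c (j, i) * w powi i) + poly (p j) w = w powi (a j + m) * poly (q j) (inverse w)"
      using r[OF w] by (simp add: power_int_minus mult.assoc)
  qed (use S i in auto)
qed

lemma theta_nonzero:
  assumes "j \<in> {1..n}"
  shows "\<exists>z\<in>Xo. \<theta> j z \<noteq> 0"
proof (rule ccontr)
  assume "\<not> ?thesis"
  then have zero: "\<theta> j z = 0" if "z \<in> Xo" for z using that by blast
  \<comment> \<open>Otherwise the single monomial with exponent 0 and coefficient 1 would be a
    relation.\<close>
  have "(1 :: 'k) = 0"
    by (rule monomials_independent[of "\<lambda>i. if i = j then {0} else {}" "\<lambda>_. 1" j 0])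
      (use zero assms in \<open>auto split: if_splits intro!: sum.neutral\<close>)
  then show False by simp
qed

lemma sum_Sigma_monomials:
  assumes "\<And>j. finite (S j)"
  shows "(\<Sum>x\<in>Sigma {1..n} S. h x) = (\<Sum>j=1..n. \<Sum>i\<in>S j. h (j, i))"
  using sum.Sigma[of "{1..n}" S "\<lambda>j i. h (j, i)"] assms by (simp add: case_prod_unfold)

section \<open>The two bounds and their sum\<close>

lemma top_degree_bound:
  assumes J: "J \<in> {1..n}"
  shows "(\<Sum>j=1..n. nat (a J - a j - 1)) \<le> g"
proof -
  \<comment> \<open>These are a J - a j - 1 exponents, or none if that number is negative, and they
    index the basis of H^1(O(a j - a J)).\<close>
  define S where "S j = {a j - a J + 1..-1}" for j
  have S: "\<And>j. finite (S j)" "\<And>i j. i \<in> S j \<Longrightarrow> a j + (- a J) < i \<and> i < 0" by (auto simp: S_def)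
  obtain z0 where z0: "z0 \<in> Xo" "\<theta> J z0 \<noteq> 0" using theta_nonzero[OF J] by blast
  have "card (Sigma {1..n} S) \<le> g"
  proof (rule cohomology_dim_le_genus[of "- a J" "\<lambda>z. u z powi 0 * \<theta> J z" z0 _ "\<lambda>(j, i) z. u z powi i * \<theta> j z"])
    \<comment> \<open>Twisted by - a J, the J-th summand is O(0), and this is its constant section,
      with the factor \<open>u z powi 0\<close> to match the form of the monomials.\<close>
    show "is_twist_section (- a J) (topspace T) (\<lambda>z. u z powi 0 * \<theta> J z)"
      by (rule monomial_is_twist_section[OF J]) auto
    show "u z0 powi 0 * \<theta> J z0 \<noteq> 0" using z0(2) by simp
    show "finite (Sigma {1..n} S)" using S(1) by blast
    show "is_section (X0 \<inter> X1) ((\<lambda>(j, i) z. u z powi i * \<theta> j z) x)" if "x \<in> Sigma {1..n} S" for x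
      using that monomial_is_section(3) by auto
    fix r b0 b1 x assume b: "is_section X0 b0" "is_section X1 b1" and x: "x \<in> Sigma {1..n} S"
      and eq: "\<And>z. z \<in> Xo \<Longrightarrow> (\<Sum>i\<in>Sigma {1..n} S. r i * (\<lambda>(j, i) z. u z powi i * \<theta> j z) i z) =
        u z powi (- a J) * b1 z - b0 z"
    obtain j i where ji: "x = (j, i)" "j \<in> {1..n}" "i \<in> S j" using x by blast
    show "r x = 0"
      unfolding ji(1)
    proof (rule cohomology_monomials_independent[where S = S and m = "- a J" and c = r, OF S b _ ji(2,3)])
      fix z assume "z \<in> Xo"
      from eq[OF this] show "(\<Sum>j=1..n. \<Sum>i\<in>S j. r (j, i) * (u z powi i * \<theta> j z)) =
          u z powi (- a J) * b1 z - b0 z"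
        unfolding sum_Sigma_monomials[of S, OF S(1)] by simp
    qed
  qed (rule z0(1))
  also have "card (Sigma {1..n} S) = (\<Sum>j=1..n. nat (a J - a j - 1))"
    using S(1) by (simp add: S_def)
  finally show ?thesis .
qed

lemma bottom_degree_bound:
  assumes I: "I \<in> {1..n}"
  shows "(\<Sum>j=1..n. nat (a j - a I - 1)) \<le> g"
proof -
  \<comment> \<open>The I-th summand becomes O(-2). Its H^1 is spanned by the exponent -1, the only
    integer strictly between -2 and 0.\<close>
  define m where "m = - a I - 2"
  define S where "S j = {0..a j + m}" for j
  have S: "\<And>j. finite (S j)" "\<And>i j. i \<in> S j \<Longrightarrow> 0 \<le> i" by (auto simp: S_def)
  have "card (Sigma {1..n} S) \<le> g"
  proof (rule sections_dim_le_genus[of _ m "\<lambda>(j, i) z. u z powi i * \<theta> j z" "\<lambda>z. u z powi (-1) * \<theta> I z"])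
    show "finite (Sigma {1..n} S)" using S(1) by blast
    show "is_twist_section m (topspace T) ((\<lambda>(j, i) z. u z powi i * \<theta> j z) x)"
      if "x \<in> Sigma {1..n} S" for x
      using that monomial_is_twist_section by (auto simp: S_def)
    show "r x = 0" if "\<And>z. z \<in> Xo \<Longrightarrow> (\<Sum>i\<in>Sigma {1..n} S. r i * (\<lambda>(j, i) z. u z powi i * \<theta> j z) i z) = 0"
      and x: "x \<in> Sigma {1..n} S" for r x
    proof -
      obtain j i where ji: "x = (j, i)" "j \<in> {1..n}" "i \<in> S j" using x by blast
      show ?thesis
        unfolding ji(1)
      proof (rule monomials_independent[where S = S and c = r, OF S _ ji(2,3)])
        fix z assume "z \<in> Xo"
        from that(1)[OF this] show "(\<Sum>j=1..n. \<Sum>i\<in>S j. r (j, i) * (u z powi i * \<theta> j z)) = 0"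
          unfolding sum_Sigma_monomials[of S, OF S(1)] by simp
      qed
    qed
    show "is_section (X0 \<inter> X1) (\<lambda>z. u z powi (-1) * \<theta> I z)" by (rule monomial_is_section(3)[OF I])
    fix b0 b1 assume b: "is_section X0 b0" "is_section X1 b1"
    show "\<exists>z\<in>Xo. u z powi (-1) * \<theta> I z \<noteq> u z powi m * b1 z - b0 z"
    proof (rule ccontr)
      assume "\<not> ?thesis"
      then have eq: "u z powi (-1) * \<theta> I z = u z powi m * b1 z - b0 z" if "z \<in> Xo" for z using that by blast
      \<comment> \<open>Triviality of the class would be a relation with the single coefficient 1 at
        the exponent -1 of summand I.\<close>
      let ?R = "\<lambda>j. if j = I then {-1::int} else {}"
      have "(1 :: 'k) = 0"
      proof (rule cohomology_monomials_independent[of ?R m b0 b1 "\<lambda>_. 1" I "-1"])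
        fix z assume z: "z \<in> Xo"
        have "(\<Sum>j=1..n. \<Sum>i\<in>?R j. 1 * (u z powi i * \<theta> j z)) =
            (\<Sum>j=1..n. if j = I then u z powi (-1) * \<theta> I z else 0)"
          by (rule sum.cong) auto
        then show "(\<Sum>j=1..n. \<Sum>i\<in>?R j. 1 * (u z powi i * \<theta> j z)) = u z powi m * b1 z - b0 z"
          using eq[OF z] I by simp
      qed (use b I in \<open>auto simp: m_def split: if_splits\<close>)
      then show False by simp
    qed
  qed
  also have "card (Sigma {1..n} S) = (\<Sum>j=1..n. nat (a j - a I - 1))"
    using S(1) by (simp add: S_def m_def)
  finally show ?thesis .
qed

text \<open>Before truncation the two terms for j add up to a J - a I - 2, which is at least 1
  exactly when the gap is at least 3. For j = I the first term alone is a J - a I - 1 \<ge> 2, and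
  for j = J the second is.\<close>

lemma degree_bound_of_gap:
  assumes IJ: "I \<in> {1..n}" "J \<in> {1..n}" and gap: "a J - a I \<ge> 3"
  shows "n + 2 \<le> 2 * g"
proof -
  have "I \<noteq> J" using gap by auto
  have "n + 2 = (\<Sum>j=1..n. 1 + (if j = I then 1 else 0) + (if j = J then 1 else 0))"
    unfolding sum.distrib using IJ by simp
  also have "\<dots> \<le> (\<Sum>j=1..n. nat (a J - a j - 1) + nat (a j - a I - 1))"
    by (rule sum_mono) (use gap \<open>I \<noteq> J\<close> in \<open>auto simp: nat_add_distrib\<close>)
  also have "\<dots> \<le> g + g"
    unfolding sum.distrib by (intro add_mono top_degree_bound bottom_degree_bound IJ)
  finally show ?thesis by simp
qed

end

text \<open>The isomorphism in \<open>splits_as\<close> becomes an argument, and the records of the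
  pushforward, the twists and the direct sum are unfolded, so that the assumptions of the locale can
  be read off.\<close>

definition splitting_map ::
    "'k::field proj_point topology \<Rightarrow> ('k proj_point \<Rightarrow> 'k proj_point) \<Rightarrow>
      ('k proj_point, 'k, 'm) mod_sheaf \<Rightarrow> nat \<Rightarrow> (nat \<Rightarrow> int) \<Rightarrow>
      ('k proj_point set \<Rightarrow> 'm \<Rightarrow> nat \<Rightarrow> (nat \<Rightarrow> 'k) \<Rightarrow> 'k) \<Rightarrow> bool" where
  "splitting_map T f L n a \<psi> \<longleftrightarrow>
    (let pre = \<lambda>V. {x \<in> topspace T. f x \<in> V} in
     (\<forall>V. openin (zariski 1) V \<and> V \<subseteq> proj_space 1 \<longrightarrow>
        bij_betw (\<psi> V) (carrier (sections L (pre V))) (\<Pi>\<^sub>E j\<in>{1..n}. twist_sections (zariski 1) (a j) V) \<and>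
        (\<forall>s\<in>carrier (sections L (pre V)). \<forall>t\<in>carrier (sections L (pre V)).
           \<psi> V (s \<oplus>\<^bsub>sections L (pre V)\<^esub> t) = (\<lambda>j\<in>{1..n}. restrict (\<lambda>v. \<psi> V s j v + \<psi> V t j v) (\<Union>V))) \<and>
        (\<forall>r\<in>regular_functions (zariski 1) V. \<forall>s\<in>carrier (sections L (pre V)).
           \<psi> V (restrict (r \<circ> f) (pre V) \<odot>\<^bsub>sections L (pre V)\<^esub> s) =
             (\<lambda>j\<in>{1..n}. restrict (\<lambda>v. r (hpoint v) * \<psi> V s j v) (\<Union>V)))) \<and>
     (\<forall>V W. openin (zariski 1) V \<and> openin (zariski 1) W \<and> W \<subseteq> V \<and> V \<subseteq> proj_space 1 \<longrightarrow>
        (\<forall>s\<in>carrier (sections L (pre V)).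
           \<psi> W (restr L (pre V) (pre W) s) = (\<lambda>j\<in>{1..n}. restrict (\<psi> V s j) (\<Union>W)))))"

lemma splitting_map_exists: "splits_as T f L n a \<Longrightarrow> \<exists>\<psi>. splitting_map T f L n a \<psi>"
  by (simp add: splits_as_def sheaf_iso_on_def splitting_map_def pushforward_def direct_sum_def
      twist_def Let_def)

theorem mainTheorem6:
  fixes X :: "'k::alg_closed_field proj_point set"
    and f :: "'k proj_point \<Rightarrow> 'k proj_point"
    and L :: "('k proj_point, 'k, 'm) mod_sheaf"
    and N g n :: nat
    and a :: "nat \<Rightarrow> int"
  assumes curve: "smooth_projective_curve N X"
    and genus: "has_genus (zariski_on N X) g" "g > 1"
    and morphism: "morphism_var (zariski_on N X) (zariski 1) f"
    and surjective: "f ` X = proj_space 1"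
    and degree: "has_degree (zariski_on N X) (zariski 1) f n"
    and line_bundle: "line_bundle (zariski_on N X) L"
    and splitting: "splits_as (zariski_on N X) f L n a"
    and large_degree: "n > 2 * g - 2"
  shows "splitting_gap n a \<le> 2"
proof -
  \<comment> \<open>This makes the set of differences nonempty, so that its \<open>Max\<close> is
    attained.\<close>
  have n: "n \<ge> 1" using large_degree genus(2) by simp
  let ?T = "zariski_on N X" and ?U01 = "std_open 0 \<inter> std_open 1 :: 'k proj_point set"
  let ?pre = "\<lambda>V. {x \<in> topspace ?T. f x \<in> V}"
  note X = curve[unfolded smooth_projective_curve_def]
  have top: "topspace ?T = X" using closedin_subset[of "zariski N" X] X by auto
  \<comment> \<open>The point (1 : 1) lies in both charts. A preimage of it under f, which exists by
    surjectivity, shows that \<open>Xo\<close> is nonempty.\<close>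
  have p: "hpoint (affine_vec 0 1) \<in> ?U01"
    using affine_vec_std_open[of 0 "1 :: 'k"] by (auto simp: std_open_def hpoint_def affine_vec_def)
  moreover have "?U01 \<subseteq> f ` X" unfolding surjective by (auto simp: std_open_def)
  ultimately have "hpoint (affine_vec 0 1) \<in> f ` X" by (rule rev_subsetD)
  then obtain x where "hpoint (affine_vec 0 1) = f x" "x \<in> X" by (rule imageE)
  with p have x: "x \<in> X" "f x \<in> ?U01" by simp_all
  obtain U where U: "openin ?T U" "x \<in> U" "sheaf_iso_on ?T U L (structure_sheaf ?T)"
    using line_bundle x(1) top unfolding line_bundle_def by blast
  obtain \<phi> where \<phi>: "trivialization ?T L U \<phi>" using trivialization_exists[OF U(3)] by blast
  define Xo where "Xo = U \<inter> ?pre ?U01"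
  have pre_open: "openin ?T (?pre ?U01)"
    using morphism std_open_Int_open unfolding morphism_var_def
    by (blast intro: openin_continuous_map_preimage)
  obtain \<psi> where \<psi>: "splitting_map ?T f L n a \<psi>" using splitting_map_exists[OF splitting] by blast
  note \<psi>1 = \<psi>[unfolded splitting_map_def Let_def, THEN conjunct1, THEN spec, THEN mp]
    and \<psi>2 = \<psi>[unfolded splitting_map_def Let_def, THEN conjunct2, THEN spec, THEN spec, THEN mp, THEN bspec]
  have P1: "V \<subseteq> proj_space 1" if "openin (zariski 1) V" for V :: "'k proj_point set"
    using openin_subset[OF that] by simp
  interpret split_curve N X L Xo \<phi> f n a \<psi> g
  proof
    show "closedin (zariski N) X" "irreducible_set (zariski N) X" "krull_dim ?T = 1" using X by auto
    show "Defs.line_bundle ?T L" "morphism_var ?T (zariski 1) f" "has_genus ?T g"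
      by (rule line_bundle morphism genus)+
    show "openin ?T Xo" unfolding Xo_def by (rule openin_Int[OF U(1) pre_open])
    show "Xo \<noteq> {}" using x U(2) top by (auto simp: Xo_def)
    show "trivialization ?T L Xo \<phi>" by (rule trivialization_subset[OF \<phi>]) (auto simp: Xo_def)
    show "f z \<in> ?U01" if "z \<in> Xo" for z using that by (auto simp: Xo_def)
  next
    fix V :: "'k proj_point set" assume V: "openin (zariski 1) V"
    note \<psi>V = \<psi>1[OF conjI[OF V P1[OF V]]]
    show "bij_betw (\<psi> V) (carrier (sections L (?pre V))) (\<Pi>\<^sub>E j\<in>{1..n}. twist_sections (zariski 1) (a j) V)"
      by (rule \<psi>V[THEN conjunct1])
    show "\<psi> V (s \<oplus>\<^bsub>sections L (?pre V)\<^esub> t) = (\<lambda>j\<in>{1..n}. restrict (\<lambda>v. \<psi> V s j v + \<psi> V t j v) (\<Union>V))"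
      if "s \<in> carrier (sections L (?pre V))" "t \<in> carrier (sections L (?pre V))" for s t
      by (rule \<psi>V[THEN conjunct2, THEN conjunct1, THEN bspec, THEN bspec, OF that])
    show "\<psi> V (restrict (r \<circ> f) (?pre V) \<odot>\<^bsub>sections L (?pre V)\<^esub> s) =
        (\<lambda>j\<in>{1..n}. restrict (\<lambda>v. r (hpoint v) * \<psi> V s j v) (\<Union>V))"
      if "r \<in> regular_functions (zariski 1) V" "s \<in> carrier (sections L (?pre V))" for r s
      by (rule \<psi>V[THEN conjunct2, THEN conjunct2, THEN bspec, THEN bspec, OF that])
    show "\<psi> W (restr L (?pre V) (?pre W) s) = (\<lambda>j\<in>{1..n}. restrict (\<psi> V s j) (\<Union>W))"
      if "openin (zariski 1) W" "W \<subseteq> V" "s \<in> carrier (sections L (?pre V))" for W s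
      by (rule \<psi>2[OF conjI[OF V conjI[OF that(1) conjI[OF that(2) P1[OF V]]]] that(3)])
  qed
  have gap: "a i - a j \<le> 2" if "i \<in> {1..n}" "j \<in> {1..n}" for i j
  proof (rule ccontr)
    assume "\<not> a i - a j \<le> 2"
    then have "n + 2 \<le> 2 * g" by (intro degree_bound_of_gap[OF that(2,1)]) simp
    then show False using large_degree by simp
  qed
  let ?D = "{\<bar>a i - a j\<bar> | i j. i \<in> {1..n} \<and> j \<in> {1..n}}"
  have "?D \<subseteq> (\<lambda>(i, j). \<bar>a i - a j\<bar>) ` ({1..n} \<times> {1..n})" by auto
  then have "finite ?D" by (rule finite_subset) simp
  moreover have "\<bar>a 1 - a 1\<bar> \<in> ?D" using n by (intro CollectI exI[of _ 1]) simp
  then have "?D \<noteq> {}" by blast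
  ultimately have "Max ?D \<in> ?D" by (rule Max_in)
  then obtain i j where ij: "i \<in> {1..n}" "j \<in> {1..n}" "Max ?D = \<bar>a i - a j\<bar>" by blast
  have "\<bar>a i - a j\<bar> \<le> 2" using gap[OF ij(1,2)] gap[OF ij(2,1)] by linarith
  then show ?thesis using ij(3) by (simp only: splitting_gap_def)
qed

end
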